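(* Consider $\beta=0$, let $h_c^H:=-H'(0)\in[-\infty,\infty)$, $h_b:=-H'(\rho_c)$, and $\rho_h:=\textsc{f}_H'(h)$. For every $h\ne h_c^H$, in $\mathbf P^\Psi_{N,h}$-probability, \[ \lim_{N\to\infty}\frac{|\tau\cap(0,N)|}{N}=\rho_h. \] If moreover $\rho_c>0$ and $h\ne h_b$, then in $\mathbf P^\Psi_{N,h}$-probability \[ \lim_{N\to\infty}\frac{\eta_{1,N}}N=\Big(1-\frac{\rho_h}{\rho_c}\Big)_+,\qquad \lim_{N\to\infty}\frac{\eta_{2,N}}N=0. \] If $\rho_c=0$ and $h>h_c^H=h_b$, then $\lim_{N\to\infty}\eta_{1,N}/N=0$ in $\mathbf P^\Psi_{N,h}$-probability.
   Context: Let $\tau=(\tau_j)_{j\ge0}$ be a renewal process with $\tau_0=0$ and i.i.d. increments $\eta_j=\tau_j-\tau_{j-1}$ with values in $\mathbb N$, law $\mathbf P$, expectation $\mathbf E$. Let $K(n)=\mathbf P(\eta_1=n)$; assume $K(n)>0$ for all $n$ and $K(n)\sim C_Kn^{-(1+\alpha)}$, $\alpha>0$, $C_K>0$. Identify $\tau$ with the set $\{\tau_0,\tau_1,\dots\}$, set $\delta_n=\mathbf 1_{n\in\tau}$, and $\rho_c:=1/\mathbf E[\eta_1]$ ($\rho_c=0$ when $\mathbf E[\eta_1]=\infty$). Let $\Psi(m,N)=Q(m,N)\exp(NH(m/N))$ ($N\in\mathbb N$, $1\le m\le N$) where: $H:[0,1]\to\mathbb R\cup\{-\infty\}$ is concave,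 real analytic in $(0,1)$, continuous on $[0,1]$ (possibly $H(0)$ and/or $H(1)$ equal $-\infty$); $Q\ge0$; for every $b>0$ there is $c>0$ with $Q(m,N)\le ce^{bN}$ for all $m\le N$; for all $0<u<v<1$, $b>0$ there is $c>0$ with $Q(m,N)\ge ce^{-bN}$ whenever $m/N\in[u,v]$. $H'(0):=\lim_{x\searrow0}H'(x)$. For $h\in\mathbb R$ let $Z^\Psi_{N,h}=\mathbf E[\exp(h\sum_{j=1}^N\delta_j)\Psi(\sum_{j=1}^N\delta_j,N)\delta_N]$, let $\mathbf P^\Psi_{N,h}$ be the probability on subsets of $\{0,\dots,N\}$ given by $\mathbf P^\Psi_{N,h}(\{A\})=\mathbf E[\exp(h\sum_{j=1}^N\delta_j)\Psi(\sum_{j=1}^N\delta_j,N)\mathbf 1_{\tau\cap[0,N]=A}\delta_N]/Z^\Psi_{N,h}$, and $\textsc{f}_H(h)=\lim_N\frac1N\log Z^\Psi_{N,h}$ (this limit exists and is differentiable at every $h\ne h_c^H$). Order statistics: under $\mathbf P^\Psi_{N,h}$ one has $N\in\tau$; let $\eta_{1,N}\ge\eta_{2,N}\ge\dots$ be the decreasing rearrangement of $\eta_1,\dots,\eta_{|\tau\cap(0,N]|}$, with the convention $\eta_{2,N}=0$ if $|\tau\cap(0,N]|=1$. *)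

theory Defs
  imports "HOL-Analysis.Analysis" "HOL-Library.Landau_Symbols"
begin

definition real_analytic_on :: "real set \<Rightarrow> (real \<Rightarrow> real) \<Rightarrow> bool" where
  "real_analytic_on S f \<longleftrightarrow>
     (\<forall>x\<in>S. \<exists>r>0. \<exists>c::nat \<Rightarrow> real. \<forall>y. \<bar>y - x\<bar> < r \<longrightarrow> (\<lambda>n. c n * (y - x) ^ n) sums f y)"

text \<open>Possible values of tau intersected with [0,N] under the pinned measure:
  subsets of {0..N} containing 0 and N.\<close>
definition confs :: "nat \<Rightarrow> nat set set" where
  "confs N = {A. A \<subseteq> {0..N} \<and> 0 \<in> A \<and> N \<in> A}"

definition gaps :: "nat set \<Rightarrow> nat list" where
  "gaps A = (let xs = sorted_list_of_set A in
             map (\<lambda>i. xs ! Suc i - xs ! i) [0..<length xs - 1])"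

text \<open>Renewal law: P(tau intersected with [0,N] = A) = product of K over the gaps,
  for A containing 0 and N.\<close>
definition renewal_prob :: "(nat \<Rightarrow> real) \<Rightarrow> nat set \<Rightarrow> real" where
  "renewal_prob K A = prod_list (map K (gaps A))"

definition Psi :: "(nat \<Rightarrow> nat \<Rightarrow> real) \<Rightarrow> (real \<Rightarrow> ereal) \<Rightarrow> nat \<Rightarrow> nat \<Rightarrow> real" where
  "Psi Q H m N = (if H (real m / real N) = - \<infinity> then 0
                  else Q m N * exp (real N * real_of_ereal (H (real m / real N))))"

text \<open>Number of renewal points in (0,N].\<close>
definition nren :: "nat set \<Rightarrow> nat" where
  "nren A = card A - 1"

definition pin_weight :: "(nat \<Rightarrow> real) \<Rightarrow> (nat \<Rightarrow> nat \<Rightarrow> real) \<Rightarrow> (real \<Rightarrow> ereal)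
    \<Rightarrow> real \<Rightarrow> nat \<Rightarrow> nat set \<Rightarrow> real" where
  "pin_weight K Q H h N A = exp (h * real (nren A)) * Psi Q H (nren A) N * renewal_prob K A"

definition Zpin :: "(nat \<Rightarrow> real) \<Rightarrow> (nat \<Rightarrow> nat \<Rightarrow> real) \<Rightarrow> (real \<Rightarrow> ereal)
    \<Rightarrow> nat \<Rightarrow> real \<Rightarrow> real" where
  "Zpin K Q H N h = (\<Sum>A\<in>confs N. pin_weight K Q H h N A)"

definition Ppin :: "(nat \<Rightarrow> real) \<Rightarrow> (nat \<Rightarrow> nat \<Rightarrow> real) \<Rightarrow> (real \<Rightarrow> ereal)
    \<Rightarrow> nat \<Rightarrow> real \<Rightarrow> nat set set \<Rightarrow> real" where
  "Ppin K Q H N h E = (\<Sum>A\<in>confs N \<inter> E. pin_weight K Q H h N A) / Zpin K Q H N h"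

definition free_energy :: "(nat \<Rightarrow> real) \<Rightarrow> (nat \<Rightarrow> nat \<Rightarrow> real) \<Rightarrow> (real \<Rightarrow> ereal)
    \<Rightarrow> real \<Rightarrow> real" where
  "free_energy K Q H h = lim (\<lambda>N. ln (Zpin K Q H N h) / real N)"

definition rho_c :: "(nat \<Rightarrow> real) \<Rightarrow> real" where
  "rho_c K = (if summable (\<lambda>n. real n * K n) then 1 / (\<Sum>n. real n * K n) else 0)"

definition Hder0 :: "(real \<Rightarrow> ereal) \<Rightarrow> ereal" where
  "Hder0 H = Lim (at_right 0) (\<lambda>x. ereal (deriv (\<lambda>y. real_of_ereal (H y)) x))"

definition h_b :: "(nat \<Rightarrow> real) \<Rightarrow> (real \<Rightarrow> ereal) \<Rightarrow> ereal" where
  "h_b K H = (if rho_c K > 0 then ereal (- deriv (\<lambda>y. real_of_ereal (H y)) (rho_c K))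
              else - Hder0 H)"

definition eta1 :: "nat set \<Rightarrow> nat" where
  "eta1 A = (let ds = rev (sort (gaps A)) in if ds = [] then 0 else ds ! 0)"

definition eta2 :: "nat set \<Rightarrow> nat" where
  "eta2 A = (let ds = rev (sort (gaps A)) in if length ds < 2 then 0 else ds ! 1)"

definition conv_in_prob :: "(nat \<Rightarrow> nat set set \<Rightarrow> real) \<Rightarrow> (nat \<Rightarrow> nat set \<Rightarrow> real) \<Rightarrow> real \<Rightarrow> bool" where
  "conv_in_prob P X c \<longleftrightarrow> (\<forall>\<epsilon>>0. (\<lambda>N. P N {A. \<bar>X N A - c\<bar> > \<epsilon>}) \<longlonglongrightarrow> 0)"

end

theory Submission
  imports Defs "HOL-Real_Asymp.Real_Asymp" "HOL-Complex_Analysis.Cauchy_Integral_Formula"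
begin

text \<open>
  Decomposing over the number \<open>m\<close> of gaps, the partition function is the sum of
  \<open>exp (h m) \<Psi>(m, N) P(\<tau>\<^sub>m = N)\<close>. Cramer's theorem gives \<open>P(\<tau>\<^sub>m = N) = exp (N G(m/N) + o(N))\<close> with
  \<open>G(x) = inf\<^sub>l (l + x ln E[exp (- l \<eta>\<^sub>1)])\<close> over \<open>l \<ge> 0\<close>, so the free energy is the supremum of the
  concave function \<open>h x + H(x) + G(x)\<close>. This function is constant on no interval where it is maximal:
  otherwise both \<open>H\<close> and \<open>G\<close> would be affine there, which forces \<open>G = 0\<close> (the log-Laplace transform is
  differentiable), and then, \<open>H\<close> being analytic, \<open>H' = - h\<close> everywhere, i.e. \<open>h = h\<^sub>c\<close>. Hence the
  maximiser \<open>\<rho>\<close> is unique, equals the derivative of the free energy, and \<open>m/N\<close> concentrates at \<open>\<rho>\<close>.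

  Given \<open>m\<close>, the gaps are i.i.d. conditioned on their sum being \<open>N\<close>. If \<open>\<rho> \<ge> \<rho>\<^sub>c\<close>, a gap of order
  \<open>N\<close> has an exponential cost. If \<open>\<rho> < \<rho>\<^sub>c\<close>, then \<open>N\<close> exceeds the typical sum \<open>m / \<rho>\<^sub>c\<close> by order \<open>N\<close>, and
  since \<open>K\<close> has a power tail the excess is carried by a single gap: it costs \<open>m N\<^bsup>-1-\<alpha>\<^esup>\<close>, whereas
  several large gaps, or none, cost a smaller order.
\<close>

section \<open>Product weights on lists of gaps\<close>

definition seqs :: "nat \<Rightarrow> nat \<Rightarrow> nat list set" where
  "seqs m N = {xs. length xs = m \<and> set xs \<subseteq> {1..N}}"

definition mass :: "(nat \<Rightarrow> real) \<Rightarrow> nat \<Rightarrow> nat \<Rightarrow> (nat list \<Rightarrow> bool) \<Rightarrow> real" where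
  "mass p m N E = (\<Sum>xs | xs \<in> seqs m N \<and> E xs. prod_list (map p xs))"

lemma finite_seqs [simp]: "finite (seqs m N)"
  unfolding seqs_def by (rule finite_subset[OF _ finite_lists_length_eq[of "{1..N}" m]]) auto

lemma seqs_0 [simp]: "seqs 0 N = {[]}"
  by (auto simp: seqs_def)

lemma sum_seqs_Suc:
  assumes "i \<le> m"
  shows "(\<Sum>xs\<in>seqs (Suc m) N. g xs) =
         (\<Sum>n=1..N. \<Sum>ys\<in>seqs m N. g (take i ys @ n # drop i ys))"
proof -
  have "(\<Sum>xs\<in>seqs (Suc m) N. g xs) =
        (\<Sum>(n, ys)\<in>{1..N} \<times> seqs m N. g (take i ys @ n # drop i ys))"
  proof (rule sum.reindex_bij_witness[where
        i = "\<lambda>(n, ys). take i ys @ n # drop i ys" and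
        j = "\<lambda>xs. (xs ! i, take i xs @ drop (Suc i) xs)"])
    fix xs assume xs: "xs \<in> seqs (Suc m) N"
    hence i: "i < length xs" using assms by (auto simp: seqs_def)
    show "(case (xs ! i, take i xs @ drop (Suc i) xs) of
            (n, ys) \<Rightarrow> take i ys @ n # drop i ys) = xs"
      using i by (simp add: id_take_nth_drop[symmetric] min_def)
    show "(xs ! i, take i xs @ drop (Suc i) xs) \<in> {1..N} \<times> seqs m N"
      using xs i nth_mem[OF i] set_take_subset[of i xs] set_drop_subset[of "Suc i" xs]
      unfolding seqs_def by (simp add: subset_iff)
    show "(case (xs ! i, take i xs @ drop (Suc i) xs) of
            (n, ys) \<Rightarrow> g (take i ys @ n # drop i ys)) = g xs"
      using i by (simp add: id_take_nth_drop[symmetric] min_def)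
  next
    fix a assume a: "a \<in> {1..N} \<times> seqs m N"
    obtain n ys where [simp]: "a = (n, ys)" by force
    have l: "length ys = m" using a by (auto simp: seqs_def)
    show "((case a of (n, ys) \<Rightarrow> take i ys @ n # drop i ys) ! i,
           take i (case a of (n, ys) \<Rightarrow> take i ys @ n # drop i ys) @
           drop (Suc i) (case a of (n, ys) \<Rightarrow> take i ys @ n # drop i ys)) = a"
      using l assms by (simp add: nth_append)
    show "(case a of (n, ys) \<Rightarrow> take i ys @ n # drop i ys) \<in> seqs (Suc m) N"
      using a l assms set_take_subset[of i ys] set_drop_subset[of i ys]
      by (auto simp: seqs_def)
  qed
  thus ?thesis by (simp add: sum.cartesian_product)
qed

lemma sum_list_insert_nth:
  "sum_list (take i ys @ (n::nat) # drop i ys) = n + sum_list ys"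
proof -
  have "sum_list ys = sum_list (take i ys) + sum_list (drop i ys)"
    by (metis append_take_drop_id sum_list_append)
  thus ?thesis by simp
qed

lemma prod_list_insert_nth:
  "prod_list (map p (take i ys @ n # drop i ys)) = (p n :: real) * prod_list (map p ys)"
proof -
  have "prod_list (map p ys) = prod_list (map p (take i ys)) * prod_list (map p (drop i ys))"
    by (metis append_take_drop_id map_append prod_list.append)
  thus ?thesis by simp
qed

lemma sum_seqs_prod:
  "(\<Sum>xs\<in>seqs m N. prod_list (map f xs)) = (\<Sum>n=1..N. f n :: real) ^ m"
proof (induction m)
  case (Suc m)
  show ?case
    by (subst sum_seqs_Suc[where i = 0]) (simp_all add: Suc sum_distrib_left[symmetric] sum_distrib_right[symmetric])
qed simp

lemma mass_conv_sum_if: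
  "mass p m N E = (\<Sum>xs\<in>seqs m N. if E xs then prod_list (map p xs) else 0)"
  unfolding mass_def by (simp add: sum.inter_filter[symmetric])

lemma prod_list_map_nonneg:
  "(\<And>n. p n \<ge> (0::real)) \<Longrightarrow> prod_list (map p xs) \<ge> 0"
  by (induction xs) auto

context
  fixes p :: "nat \<Rightarrow> real"
  assumes p_nonneg: "\<And>n. p n \<ge> 0"
begin

lemma mass_nonneg: "mass p m N E \<ge> 0"
  unfolding mass_def by (intro sum_nonneg prod_list_map_nonneg p_nonneg)

lemma mass_mono:
  assumes "\<And>xs. xs \<in> seqs m N \<Longrightarrow> E xs \<Longrightarrow> F xs"
  shows "mass p m N E \<le> mass p m N F"
  unfolding mass_def
  by (intro sum_mono2) (use assms in \<open>auto intro: prod_list_map_nonneg p_nonneg\<close>)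

lemma mass_disj_le: "mass p m N (\<lambda>xs. E xs \<or> F xs) \<le> mass p m N E + mass p m N F"
  unfolding mass_conv_sum_if sum.distrib[symmetric]
  by (intro sum_mono) (auto intro: prod_list_map_nonneg p_nonneg)

lemma mass_split: "mass p m N (\<lambda>xs. True) = mass p m N E + mass p m N (\<lambda>xs. \<not> E xs)"
  unfolding mass_conv_sum_if sum.distrib[symmetric] by (intro sum.cong) auto

lemma mass_sum_values:
  assumes "finite B" "inj_on v B"
  shows "(\<Sum>n\<in>B. mass p m N (\<lambda>xs. sum_list xs = v n \<and> E xs)) =
         mass p m N (\<lambda>xs. sum_list xs \<in> v ` B \<and> E xs)"
proof -
  have "(\<Sum>n\<in>B. if sum_list xs = v n \<and> E xs then prod_list (map p xs) else 0) =
        (if sum_list xs \<in> v ` B \<and> E xs then prod_list (map p xs) else 0)" for xs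
  proof (cases "sum_list xs \<in> v ` B \<and> E xs")
    case True
    then obtain n0 where n0: "n0 \<in> B" "sum_list xs = v n0" by auto
    have "(\<Sum>n\<in>B. if sum_list xs = v n \<and> E xs then prod_list (map p xs) else 0) =
          (\<Sum>n\<in>B. if n = n0 then prod_list (map p xs) else 0)"
      using True n0 assms(2) by (intro sum.cong) (auto dest: inj_onD)
    thus ?thesis using n0 assms True by simp
  next
    case False
    thus ?thesis by (auto intro!: sum.neutral)
  qed
  thus ?thesis unfolding mass_conv_sum_if by (subst sum.swap) (intro sum.cong, auto)
qed

lemma mass_Chernoff:
  assumes "\<And>n. f n \<ge> 0" "c \<ge> 0"
    and "\<And>xs. xs \<in> seqs m N \<Longrightarrow> E xs \<Longrightarrow> 1 \<le> c * prod_list (map f xs)"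
  shows "mass p m N E \<le> c * (\<Sum>n=1..N. p n * f n) ^ m"
proof -
  have pm: "prod_list (map (\<lambda>n. p n * f n) xs) = prod_list (map p xs) * prod_list (map f xs)" for xs
    by (induction xs) auto
  have "mass p m N E \<le> (\<Sum>xs\<in>seqs m N. c * prod_list (map (\<lambda>n. p n * f n) xs))"
    unfolding mass_conv_sum_if
  proof (intro sum_mono)
    fix xs assume xs: "xs \<in> seqs m N"
    have P: "prod_list (map p xs) \<ge> 0" "prod_list (map f xs) \<ge> 0"
      by (auto intro: prod_list_map_nonneg p_nonneg assms)
    show "(if E xs then prod_list (map p xs) else 0) \<le> c * prod_list (map (\<lambda>n. p n * f n) xs)"
    proof (cases "E xs")
      case True
      have "prod_list (map p xs) * 1 \<le> prod_list (map p xs) * (c * prod_list (map f xs))"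
        by (intro mult_left_mono assms(3) xs True P)
      thus ?thesis unfolding pm using True by (simp add: mult_ac)
    qed (use P assms in \<open>auto simp: pm\<close>)
  qed
  also have "\<dots> = c * (\<Sum>n=1..N. p n * f n) ^ m"
    by (simp add: sum_distrib_left[symmetric] sum_seqs_prod)
  finally show ?thesis .
qed

lemma mass_union_bound:
  assumes "\<And>xs. xs \<in> seqs (Suc m) N \<Longrightarrow> E xs \<Longrightarrow> \<exists>i\<le>m. P (xs ! i) (take i xs @ drop (Suc i) xs)"
  shows "mass p (Suc m) N E \<le> real (Suc m) * (\<Sum>n=1..N. p n * mass p m N (P n))"
proof -
  let ?F = "\<lambda>i xs. if P (xs ! i) (take i xs @ drop (Suc i) xs) then prod_list (map p xs) else 0"
  have "mass p (Suc m) N E \<le> (\<Sum>xs\<in>seqs (Suc m) N. \<Sum>i\<le>m. ?F i xs)"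
    unfolding mass_conv_sum_if
  proof (intro sum_mono)
    fix xs assume xs: "xs \<in> seqs (Suc m) N"
    have P0: "prod_list (map p xs) \<ge> 0" by (intro prod_list_map_nonneg p_nonneg)
    show "(if E xs then prod_list (map p xs) else 0) \<le> (\<Sum>i\<le>m. ?F i xs)"
    proof (cases "E xs")
      case True
      then obtain i where i: "i \<le> m" "P (xs ! i) (take i xs @ drop (Suc i) xs)"
        using assms xs by blast
      have "?F i xs \<le> (\<Sum>i\<le>m. ?F i xs)"
        by (rule member_le_sum) (use i P0 in auto)
      thus ?thesis using True i by simp
    qed (auto intro!: sum_nonneg simp: P0)
  qed
  also have "\<dots> = (\<Sum>i\<le>m. \<Sum>xs\<in>seqs (Suc m) N. ?F i xs)" by (rule sum.swap)
  also have "\<dots> = (\<Sum>i\<le>m. \<Sum>n=1..N. p n * mass p m N (P n))"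
  proof (intro sum.cong refl)
    fix i assume i: "i \<in> {..m}"
    have "?F i (take i ys @ n # drop i ys) = (if P n ys then p n * prod_list (map p ys) else 0)"
      if "ys \<in> seqs m N" for ys n
    proof -
      have "length ys = m" using that by (simp add: seqs_def)
      hence "(take i ys @ n # drop i ys) ! i = n"
        "take i (take i ys @ n # drop i ys) @ drop (Suc i) (take i ys @ n # drop i ys) = ys"
        using i by (auto simp: nth_append)
      thus ?thesis by (simp only: prod_list_insert_nth)
    qed
    hence "(\<Sum>xs\<in>seqs (Suc m) N. ?F i xs) =
           (\<Sum>n=1..N. \<Sum>ys\<in>seqs m N. if P n ys then p n * prod_list (map p ys) else 0)"
      using i by (subst sum_seqs_Suc[where i = i]) (auto intro!: sum.cong)
    also have "\<dots> = (\<Sum>n=1..N. p n * mass p m N (P n))"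
      by (simp add: mass_conv_sum_if sum_distrib_left if_distrib cong: if_cong)
    finally show "(\<Sum>xs\<in>seqs (Suc m) N. ?F i xs) = (\<Sum>n=1..N. p n * mass p m N (P n))" .
  qed
  also have "\<dots> = real (Suc m) * (\<Sum>n=1..N. p n * mass p m N (P n))" by simp
  finally show ?thesis .
qed

text \<open>A list of positive integers with sum at most \<open>N\<close> has at most \<open>1/\<kappa>\<close> entries of size at
  least \<open>\<kappa>N\<close>, so summing over the position of such an entry overcounts by at most \<open>1/\<kappa>\<close>.\<close>
lemma mass_one_large_entry:
  assumes "\<kappa> > 0" "N \<ge> 1"
  shows "mass p (Suc m) N (\<lambda>xs. sum_list xs = N) \<ge>
         \<kappa> * real (Suc m) * (\<Sum>n | n \<in> {1..N} \<and> real n \<ge> \<kappa> * real N.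
            p n * mass p m N (\<lambda>ys. sum_list ys = N - n))"
proof -
  define P where "P = (\<lambda>x::nat. real x \<ge> \<kappa> * real N)"
  let ?w = "\<lambda>xs. prod_list (map p xs)"
  let ?F = "\<lambda>i xs. if sum_list xs = N \<and> P (xs ! i) then ?w xs else 0"
  have cnt: "(\<Sum>i\<le>m. ?F i xs) \<le> (1 / \<kappa>) * (if sum_list xs = N then ?w xs else 0)"
    if xs: "xs \<in> seqs (Suc m) N" for xs
  proof (cases "sum_list xs = N")
    case True
    have P0: "?w xs \<ge> 0" by (intro prod_list_map_nonneg p_nonneg)
    have l: "length xs = Suc m" using xs by (simp add: seqs_def)
    have "real (card {i. i \<le> m \<and> P (xs ! i)}) * (\<kappa> * real N) = (\<Sum>i | i \<le> m \<and> P (xs ! i). \<kappa> * real N)"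
      by simp
    also have "\<dots> \<le> (\<Sum>i | i \<le> m \<and> P (xs ! i). real (xs ! i))"
      by (intro sum_mono) (auto simp: P_def)
    also have "\<dots> \<le> (\<Sum>i\<le>m. real (xs ! i))" by (intro sum_mono2) auto
    also have "\<dots> = real (sum_list xs)"
      by (simp add: sum_list_sum_nth l atLeast0LessThan lessThan_Suc_atMost)
    also have "\<dots> = real N" using True by simp
    finally have "real (card {i. i \<le> m \<and> P (xs ! i)}) \<le> 1 / \<kappa>"
      using assms by (simp add: field_simps)
    moreover have "(\<Sum>i\<le>m. ?F i xs) = real (card {i. i \<le> m \<and> P (xs ! i)}) * ?w xs"
    proof -
      have "(\<Sum>i\<le>m. ?F i xs) = (\<Sum>i | i \<in> {..m} \<and> P (xs ! i). ?w xs)"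
        using True by (subst sum.inter_filter) auto
      thus ?thesis by simp
    qed
    ultimately show ?thesis using True P0 mult_right_mono by fastforce
  qed auto
  have F: "(\<Sum>xs\<in>seqs (Suc m) N. ?F i xs) =
     (\<Sum>n | n \<in> {1..N} \<and> P n. p n * mass p m N (\<lambda>ys. sum_list ys = N - n))" if i: "i \<le> m" for i
  proof -
    have "?F i (take i ys @ n # drop i ys) =
          (if P n then if sum_list ys = N - n then p n * ?w ys else 0 else 0)"
      if "ys \<in> seqs m N" "n \<in> {1..N}" for ys n
    proof -
      have "length ys = m" using that by (simp add: seqs_def)
      hence "(take i ys @ n # drop i ys) ! i = n" using i by (auto simp: nth_append)
      thus ?thesis using that by (auto simp only: prod_list_insert_nth sum_list_insert_nth)
          (auto simp: prod_list_insert_nth)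
    qed
    hence "(\<Sum>xs\<in>seqs (Suc m) N. ?F i xs) = (\<Sum>n=1..N. \<Sum>ys\<in>seqs m N.
            if P n then if sum_list ys = N - n then p n * ?w ys else 0 else 0)"
      using i by (subst sum_seqs_Suc[where i = i]) (auto intro!: sum.cong)
    also have "\<dots> = (\<Sum>n=1..N. if P n then p n * mass p m N (\<lambda>ys. sum_list ys = N - n) else 0)"
      by (intro sum.cong refl) (auto simp: mass_conv_sum_if sum_distrib_left intro!: sum.cong)
    finally show ?thesis by (simp add: sum.inter_filter[symmetric])
  qed
  have "real (Suc m) * (\<Sum>n | n \<in> {1..N} \<and> P n. p n * mass p m N (\<lambda>ys. sum_list ys = N - n)) =
        (\<Sum>i\<le>m. \<Sum>xs\<in>seqs (Suc m) N. ?F i xs)"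
    using F by simp
  also have "\<dots> = (\<Sum>xs\<in>seqs (Suc m) N. \<Sum>i\<le>m. ?F i xs)" by (rule sum.swap)
  also have "\<dots> \<le> (\<Sum>xs\<in>seqs (Suc m) N. (1 / \<kappa>) * (if sum_list xs = N then ?w xs else 0))"
    by (intro sum_mono cnt)
  also have "\<dots> = (1 / \<kappa>) * mass p (Suc m) N (\<lambda>xs. sum_list xs = N)"
    by (simp add: mass_conv_sum_if sum_distrib_left)
  finally show ?thesis using assms by (simp add: field_simps P_def)
qed

lemma mass_last_entry:
  "mass p (Suc m) N (\<lambda>xs. sum_list xs = N) =
         (\<Sum>n=1..N. p n * mass p m N (\<lambda>ys. sum_list ys = N - n))"
  unfolding mass_conv_sum_if
  by (subst sum_seqs_Suc[where i = 0])
     (auto intro!: sum.cong simp: sum_distrib_left if_distrib)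

end

section \<open>Finite-mean laws\<close>

lemma prod_list_exp: "prod_list (map (\<lambda>n. exp (s * real n)) xs) = exp (s * real (sum_list xs))"
  by (induction xs) (auto simp: algebra_simps exp_add)

lemma prod_list_exp_truncated:
  assumes "\<forall>x\<in>set xs. P x"
  shows "prod_list (map (\<lambda>n. if P n then exp (s * real n) else 0) xs) = exp (s * real (sum_list xs))"
  using assms by (induction xs) (auto simp: algebra_simps exp_add)

lemma exp_le_one_plus_mult_exp: "exp y \<le> 1 + y * exp (y::real)"
proof -
  have "(1 - y) * exp y \<le> exp (- y) * exp y"
    by (intro mult_right_mono) (use exp_ge_add_one_self[of "- y"] in auto)
  thus ?thesis by (simp add: exp_minus algebra_simps)
qed

locale finite_mean_law =
  fixes p :: "nat \<Rightarrow> real" and \<mu> :: real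
  assumes p_nonneg: "p n \<ge> 0"
    and p_0: "p 0 = 0"
    and p_sums: "p sums 1"
    and p_mean: "(\<lambda>n. real n * p n) sums \<mu>"
begin

lemma sum_p_le_1: "finite B \<Longrightarrow> (\<Sum>n\<in>B. p n) \<le> 1"
  using sum_le_suminf[of p B] p_sums p_nonneg by (simp add: sums_iff)

lemma sum_mean_le: "finite B \<Longrightarrow> (\<Sum>n\<in>B. real n * p n) \<le> \<mu>"
  using sum_le_suminf[of "\<lambda>n. real n * p n" B] p_mean p_nonneg by (simp add: sums_iff)

lemma mean_nonneg: "\<mu> \<ge> 0"
  using sum_mean_le[of "{}"] by simp

lemma partial_mean_near:
  assumes "\<epsilon> > 0"
  obtains L where "(\<Sum>n\<le>L. real n * p n) > \<mu> - \<epsilon>"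
proof -
  have "(\<lambda>L. \<Sum>n\<le>L. real n * p n) \<longlonglongrightarrow> \<mu>" using p_mean by (simp add: sums_def_le)
  hence "eventually (\<lambda>L. (\<Sum>n\<le>L. real n * p n) > \<mu> - \<epsilon>) sequentially"
    using assms by (intro order_tendstoD) auto
  thus ?thesis using that by (auto simp: eventually_at_top_linorder)
qed

lemma tail_small:
  assumes "\<gamma> > 0" "\<eta> > 0"
  shows "eventually (\<lambda>N::nat. \<forall>B. finite B \<longrightarrow> (\<forall>n\<in>B. \<gamma> * real N < real n) \<longrightarrow>
           real N * (\<Sum>n\<in>B. p n) \<le> \<eta>) sequentially"
proof -
  obtain L where L: "(\<Sum>n\<le>L. real n * p n) > \<mu> - \<eta> * \<gamma>"
    using partial_mean_near[of "\<eta> * \<gamma>"] assms by auto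
  have "eventually (\<lambda>N::nat. real N \<ge> real L / \<gamma>) sequentially" by real_asymp
  thus ?thesis
  proof eventually_elim
    case (elim N)
    show ?case
    proof (intro allI impI)
      fix B assume B: "finite B" "\<forall>n\<in>B. \<gamma> * real N < real n"
      have gt: "n > L" if "n \<in> B" for n
      proof -
        have "real L \<le> \<gamma> * real N" using elim assms by (simp add: field_simps)
        also have "\<dots> < real n" using B that by auto
        finally show ?thesis by simp
      qed
      have "real N * (\<Sum>n\<in>B. p n) * \<gamma> = (\<Sum>n\<in>B. (\<gamma> * real N) * p n)"
        by (simp add: sum_distrib_left mult_ac)
      also have "\<dots> \<le> (\<Sum>n\<in>B. real n * p n)"
        using B by (intro sum_mono mult_right_mono p_nonneg) auto
      also have "\<dots> = (\<Sum>n\<in>B \<union> {..L}. real n * p n) - (\<Sum>n\<le>L. real n * p n)"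
        using B gt by (subst sum.union_disjoint) fastforce+
      also have "\<dots> \<le> \<eta> * \<gamma>" using sum_mean_le[of "B \<union> {..L}"] B L by simp
      finally show "real N * (\<Sum>n\<in>B. p n) \<le> \<eta>" using assms by simp
    qed
  qed
qed

lemma total_mass_ge:
  assumes "\<eta> > 0"
  shows "eventually (\<lambda>N. \<forall>m\<le>N. mass p m N (\<lambda>xs. True) \<ge> 1 - \<eta>) sequentially"
proof -
  have "eventually (\<lambda>N::nat. \<forall>B. finite B \<longrightarrow> (\<forall>n\<in>B. 1/2 * real N < real n) \<longrightarrow>
           real N * (\<Sum>n\<in>B. p n) \<le> \<eta>) sequentially"
    by (rule tail_small) (use assms in auto)
  thus ?thesis using eventually_gt_at_top[of 0]
  proof eventually_elim
    case (elim N)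
    let ?S = "\<Sum>n=1..N. p n"
    have "(\<lambda>M. \<Sum>n\<le>M. p n) \<longlonglongrightarrow> 1" using p_sums by (simp add: sums_def_le)
    moreover have "(\<Sum>n\<le>M. p n) \<le> ?S + \<eta> / real N" for M
    proof -
      have "(\<Sum>n\<le>M. p n) \<le> (\<Sum>n\<in>insert 0 {1..N} \<union> {N<..M}. p n)"
        by (intro sum_mono2) (auto simp: p_nonneg)
      also have "\<dots> = ?S + (\<Sum>n\<in>{N<..M}. p n)"
        by (subst sum.union_disjoint) (auto simp: p_0)
      also have "(\<Sum>n\<in>{N<..M}. p n) \<le> \<eta> / real N"
        using elim(1)[rule_format, of "{N<..M}"] elim(2) by (auto simp: field_simps)
      finally show ?thesis by simp
    qed
    ultimately have S: "1 \<le> ?S + \<eta> / real N" by (intro LIMSEQ_le_const2) auto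
    show ?case
    proof (intro allI impI)
      fix m assume m: "m \<le> N"
      have "1 - \<eta> \<le> 1 + real m * (?S - 1)"
      proof -
        have "real m * (1 - ?S) \<le> real N * (\<eta> / real N)"
          using m S sum_p_le_1[of "{1..N}"] by (intro mult_mono) auto
        thus ?thesis using elim(2) by (simp add: algebra_simps)
      qed
      also have "\<dots> \<le> (1 + (?S - 1)) ^ m"
        by (intro Bernoulli_inequality) (simp add: sum_nonneg p_nonneg)
      also have "\<dots> = mass p m N (\<lambda>xs. True)" by (simp add: mass_conv_sum_if sum_seqs_prod)
      finally show "1 - \<eta> \<le> mass p m N (\<lambda>xs. True)" .
    qed
  qed
qed

lemma mass_le_1: "mass p m N E \<le> 1"
proof -
  have "mass p m N E \<le> mass p m N (\<lambda>xs. True)" by (intro mass_mono p_nonneg) auto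
  also have "\<dots> = (\<Sum>n=1..N. p n) ^ m" by (simp add: mass_conv_sum_if sum_seqs_prod)
  also have "\<dots> \<le> 1" by (intro power_le_one sum_nonneg p_nonneg sum_p_le_1) auto
  finally show ?thesis .
qed

lemma mass_large_entry_le:
  "mass p m N (\<lambda>xs. \<exists>x\<in>set xs. P x) \<le> real m * (\<Sum>n | n \<in> {1..N} \<and> P n. p n)"
proof (cases m)
  case 0
  thus ?thesis by (simp add: mass_def)
next
  case (Suc k)
  have "mass p (Suc k) N (\<lambda>xs. \<exists>x\<in>set xs. P x) \<le>
        real (Suc k) * (\<Sum>n=1..N. p n * mass p k N (\<lambda>ys. P n))"
  proof (rule mass_union_bound[OF p_nonneg])
    fix xs assume "xs \<in> seqs (Suc k) N" "\<exists>x\<in>set xs. P x"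
    thus "\<exists>i\<le>k. P (xs ! i)"
      by (auto simp: seqs_def in_set_conv_nth less_Suc_eq_le)
  qed
  also have "(\<Sum>n=1..N. p n * mass p k N (\<lambda>ys. P n)) \<le> (\<Sum>n=1..N. if P n then p n else 0)"
    by (intro sum_mono) (auto simp: mass_def[of _ _ _ "\<lambda>_. False"] p_nonneg intro!: mult_left_le mass_le_1)
  also have "\<dots> = (\<Sum>n | n \<in> {1..N} \<and> P n. p n)" by (simp add: sum.inter_filter[symmetric])
  finally show ?thesis by (simp add: Suc)
qed

lemma truncated_Chernoff:
  assumes "s \<ge> 0" and y: "(\<Sum>n=1..N. p n * (if real n \<le> b then exp (s * real n) else 0)) \<le> 1 + y"
  shows "mass p m N (\<lambda>xs. real (sum_list xs) \<ge> t \<and> (\<forall>x\<in>set xs. real x \<le> b)) \<le> exp (real m * y - s * t)"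
proof -
  let ?f = "\<lambda>n. if real n \<le> b then exp (s * real n) else 0"
  have "mass p m N (\<lambda>xs. real (sum_list xs) \<ge> t \<and> (\<forall>x\<in>set xs. real x \<le> b))
        \<le> exp (- s * t) * (\<Sum>n=1..N. p n * ?f n) ^ m"
  proof (rule mass_Chernoff[OF p_nonneg])
    fix xs assume *: "real (sum_list xs) \<ge> t \<and> (\<forall>x\<in>set xs. real x \<le> b)"
    hence "s * t \<le> s * real (sum_list xs)" using assms by (intro mult_left_mono) auto
    thus "1 \<le> exp (- s * t) * prod_list (map ?f xs)"
      using * by (subst prod_list_exp_truncated) (auto simp: exp_add[symmetric])
  qed auto
  also have "\<dots> \<le> exp (- s * t) * exp y ^ m"
  proof (intro mult_left_mono power_mono)
    show "(\<Sum>n=1..N. p n * ?f n) \<le> exp y" by (rule order_trans[OF y exp_ge_add_one_self])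
  qed (auto intro!: sum_nonneg simp: p_nonneg)
  also have "\<dots> = exp (real m * y - s * t)"
    by (simp add: exp_of_nat_mult[symmetric] exp_add[symmetric])
  finally show ?thesis .
qed

lemma upper_tail:
  assumes "\<epsilon> > 0" "\<eta> > 0"
  shows "eventually (\<lambda>N. \<forall>m\<le>N. mass p m N (\<lambda>xs. real (sum_list xs) > real m * \<mu> + \<epsilon> * real N) \<le> \<eta>) sequentially"
proof -
  obtain C where C: "C > 0" "exp (- C * (\<epsilon> / 2)) \<le> \<eta> / 2"
  proof -
    have "eventually (\<lambda>C::real. exp (- C * (\<epsilon> / 2)) \<le> \<eta> / 2) at_top"
      using assms by real_asymp
    hence "eventually (\<lambda>C::real. C > 0 \<and> exp (- C * (\<epsilon> / 2)) \<le> \<eta> / 2) at_top"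
      by (intro eventually_conj eventually_gt_at_top)
    thus ?thesis using that by (auto simp: eventually_at_top_linorder)
  qed
  define \<gamma> where "\<gamma> = ln (1 + \<epsilon> / (2 * \<mu> + 2)) / C"
  have mu: "\<mu> \<ge> 0" by (rule mean_nonneg)
  have pos: "1 + \<epsilon> / (2 * \<mu> + 2) > 1" using mu assms by (simp add: field_simps)
  have g: "\<gamma> > 0" using C pos unfolding \<gamma>_def by (intro divide_pos_pos ln_gt_zero) auto
  have e: "exp (C * \<gamma>) = 1 + \<epsilon> / (2 * \<mu> + 2)" using C pos by (simp add: \<gamma>_def)
  have me: "\<mu> * (exp (C * \<gamma>) - 1) \<le> \<epsilon> / 2"
    unfolding e using mu assms by (simp add: field_simps)
  have "eventually (\<lambda>N::nat. \<forall>B. finite B \<longrightarrow> (\<forall>n\<in>B. \<gamma> * real N < real n) \<longrightarrow>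
           real N * (\<Sum>n\<in>B. p n) \<le> \<eta> / 2) sequentially"
    by (rule tail_small) (use assms g in auto)
  thus ?thesis using eventually_gt_at_top[of 0]
  proof eventually_elim
    case (elim N)
    have N: "N > 0" using elim by simp
    show ?case
    proof (intro allI impI)
      fix m assume m: "m \<le> N"
      define s where "s = C / real N"
      have s: "s > 0" using C N by (simp add: s_def)
      let ?t = "real m * \<mu> + \<epsilon> * real N"
      let ?f = "\<lambda>n. if real n \<le> \<gamma> * real N then exp (s * real n) else 0"
      have fs: "(\<Sum>n=1..N. p n * ?f n) \<le> 1 + s * \<mu> * exp (C * \<gamma>)"
      proof -
        have f: "?f n \<le> 1 + s * real n * exp (C * \<gamma>)" for n
        proof (cases "real n \<le> \<gamma> * real N")
          case True
          have le: "exp (s * real n) \<le> exp (C * \<gamma>)"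
            using True N C by (auto simp: s_def field_simps)
          have "exp (s * real n) \<le> 1 + s * real n * exp (s * real n)"
            by (rule exp_le_one_plus_mult_exp)
          also have "\<dots> \<le> 1 + s * real n * exp (C * \<gamma>)"
            using le s by (intro add_left_mono mult_left_mono) auto
          finally show ?thesis using True by simp
        qed (use s in auto)
        have "(\<Sum>n=1..N. p n * ?f n) \<le> (\<Sum>n=1..N. p n * (1 + s * real n * exp (C * \<gamma>)))"
          by (intro sum_mono mult_left_mono f p_nonneg)
        also have "\<dots> = (\<Sum>n=1..N. p n) + s * exp (C * \<gamma>) * (\<Sum>n=1..N. real n * p n)"
          by (simp add: algebra_simps sum.distrib sum_distrib_left)
        also have "\<dots> \<le> 1 + s * exp (C * \<gamma>) * \<mu>"
          using s by (intro add_mono mult_left_mono sum_p_le_1 sum_mean_le) auto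
        finally show ?thesis by (simp add: algebra_simps)
      qed
      have "mass p m N (\<lambda>xs. real (sum_list xs) > ?t \<and> (\<forall>x\<in>set xs. real x \<le> \<gamma> * real N)) \<le>
            mass p m N (\<lambda>xs. real (sum_list xs) \<ge> ?t \<and> (\<forall>x\<in>set xs. real x \<le> \<gamma> * real N))"
        by (intro mass_mono p_nonneg) auto
      also have "\<dots> \<le> exp (real m * (s * \<mu> * exp (C * \<gamma>)) - s * ?t)"
        by (rule truncated_Chernoff[OF less_imp_le[OF s] fs])
      also have "\<dots> = exp (s * real m * (\<mu> * (exp (C * \<gamma>) - 1)) - C * \<epsilon>)"
        using N by (simp add: s_def field_simps)
      also have "\<dots> \<le> exp (C * (\<epsilon> / 2) - C * \<epsilon>)"
      proof -
        have "s * real m \<le> C" using m N C by (auto simp: s_def field_simps)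
        hence "s * real m * (\<mu> * (exp (C * \<gamma>) - 1)) \<le> C * (\<epsilon> / 2)"
          using me s assms C g mu by (intro mult_mono) auto
        thus ?thesis by simp
      qed
      also have "\<dots> \<le> \<eta> / 2" using C by (simp add: algebra_simps)
      finally have A: "mass p m N (\<lambda>xs. real (sum_list xs) > ?t \<and> (\<forall>x\<in>set xs. real x \<le> \<gamma> * real N))
         \<le> \<eta> / 2" .
      have "mass p m N (\<lambda>xs. \<exists>x\<in>set xs. real x > \<gamma> * real N) \<le>
            real m * (\<Sum>n | n \<in> {1..N} \<and> real n > \<gamma> * real N. p n)"
        by (rule mass_large_entry_le)
      also have "\<dots> \<le> real N * (\<Sum>n | n \<in> {1..N} \<and> real n > \<gamma> * real N. p n)"
        using m by (intro mult_right_mono sum_nonneg p_nonneg) auto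
      also have "\<dots> \<le> \<eta> / 2" using elim(1) by auto
      finally have B: "mass p m N (\<lambda>xs. \<exists>x\<in>set xs. real x > \<gamma> * real N) \<le> \<eta> / 2" .
      have "mass p m N (\<lambda>xs. real (sum_list xs) > ?t) \<le>
         mass p m N (\<lambda>xs. (real (sum_list xs) > ?t \<and> (\<forall>x\<in>set xs. real x \<le> \<gamma> * real N))
                 \<or> (\<exists>x\<in>set xs. real x > \<gamma> * real N))"
        by (intro mass_mono p_nonneg) (auto simp: not_less)
      also have "\<dots> \<le> \<eta> / 2 + \<eta> / 2"
        by (rule order_trans[OF mass_disj_le[OF p_nonneg] add_mono[OF A B]])
      finally show "mass p m N (\<lambda>xs. real (sum_list xs) > ?t) \<le> \<eta>" by simp
    qed
  qed
qed

lemma lower_tail: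
  assumes "\<epsilon> > 0" "\<eta> > 0"
  shows "eventually (\<lambda>N. \<forall>m\<le>N. mass p m N (\<lambda>xs. real (sum_list xs) < real m * \<mu> - \<epsilon> * real N) \<le> \<eta>) sequentially"
proof -
  obtain L where L: "(\<Sum>n\<le>L. real n * p n) > \<mu> - \<epsilon> / 4"
    using partial_mean_near[of "\<epsilon> / 4"] assms by auto
  define s where "s = min (1 / (real L + 1)) (\<epsilon> / (4 * (real L ^ 2 + 1)))"
  have s: "s > 0" using assms by (auto simp: s_def intro!: divide_pos_pos add_nonneg_pos)
  have sL: "s * real L ^ 2 \<le> \<epsilon> / 4"
  proof -
    have "s * real L ^ 2 \<le> \<epsilon> / (4 * (real L ^ 2 + 1)) * (real L ^ 2 + 1)"
      using assms s by (intro mult_mono) (auto simp: s_def)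
    also have "\<dots> = \<epsilon> / 4" by (simp add: field_simps add_nonneg_eq_0_iff)
    finally show ?thesis .
  qed
  have sL1: "s * real n \<le> 1" if "n \<le> L" for n
  proof -
    have "s * real n \<le> 1 / (real L + 1) * (real L + 1)"
      using that s by (intro mult_mono) (auto simp: s_def)
    thus ?thesis by simp
  qed
  have sum_le: "(\<Sum>n=1..N. p n * exp (- s * real n)) \<le> exp (- s * (\<mu> - \<epsilon> / 2))" for N
  proof -
    have q: "exp (- s * real n) \<le> 1 - (if n \<le> L then s * real n - s * \<epsilon> / 4 else 0)" for n
    proof (cases "n \<le> L")
      case True
      have "exp (- (s * real n)) * (1 + s * real n) \<le> exp (- (s * real n)) * exp (s * real n)"
        by (intro mult_left_mono) auto
      hence "exp (- (s * real n)) * (1 + s * real n) \<le> 1" by (simp add: exp_minus)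
      hence "exp (- (s * real n)) \<le> 1 / (1 + s * real n)"
        using s by (subst pos_le_divide_eq) (auto intro: add_pos_nonneg)
      also have "\<dots> \<le> 1 - s * real n + (s * real n) ^ 2"
      proof -
        have "1 \<le> (1 - s * real n + (s * real n) ^ 2) * (1 + s * real n)"
          using s by (simp add: algebra_simps power2_eq_square)
        thus ?thesis using s by (subst pos_divide_le_eq) (auto intro: add_pos_nonneg)
      qed
      also have "(s * real n) ^ 2 \<le> s * (\<epsilon> / 4)"
      proof -
        have "(s * real n) ^ 2 = s * (s * real n ^ 2)" by (simp add: power2_eq_square)
        also have "\<dots> \<le> s * (s * real L ^ 2)"
          using s True by (intro mult_left_mono power_mono) auto
        also have "\<dots> \<le> s * (\<epsilon> / 4)" using s sL by (intro mult_left_mono) auto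
        finally show ?thesis .
      qed
      finally show ?thesis using True by simp
    qed (use s in auto)
    have "(\<Sum>n=1..N. p n * exp (- s * real n)) \<le> (\<Sum>n\<in>{1..N} \<union> {..L}. p n * exp (- s * real n))"
      by (intro sum_mono2) (auto simp: p_nonneg)
    also have "\<dots> \<le> (\<Sum>n\<in>{1..N} \<union> {..L}. p n * (1 - (if n \<le> L then s * real n - s * \<epsilon> / 4 else 0)))"
      by (intro sum_mono mult_left_mono q p_nonneg)
    also have "\<dots> = (\<Sum>n\<in>{1..N} \<union> {..L}. p n) -
        (\<Sum>n\<in>{1..N} \<union> {..L}. if n \<le> L then s * (real n * p n) - s * \<epsilon> / 4 * p n else 0)"
      unfolding sum_subtractf[symmetric] by (intro sum.cong) (auto simp: algebra_simps)
    also have "(\<Sum>n\<in>{1..N} \<union> {..L}. if n \<le> L then s * (real n * p n) - s * \<epsilon> / 4 * p n else 0) =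
       (\<Sum>n\<le>L. s * (real n * p n) - s * \<epsilon> / 4 * p n)"
      by (subst sum.inter_filter[symmetric]) (auto intro!: sum.cong)
    also have "\<dots> = s * (\<Sum>n\<le>L. real n * p n) - s * \<epsilon> / 4 * (\<Sum>n\<le>L. p n)"
      by (simp add: sum_subtractf sum_distrib_left)
    also have "(\<Sum>n\<in>{1..N} \<union> {..L}. p n) - \<dots> \<le> 1 - (s * (\<mu> - \<epsilon> / 4) - s * \<epsilon> / 4 * 1)"
      using s assms L by (intro diff_mono sum_p_le_1 mult_left_mono) auto
    also have "\<dots> = 1 + (- s * (\<mu> - \<epsilon> / 2))" by (simp add: algebra_simps)
    also have "\<dots> \<le> exp (- s * (\<mu> - \<epsilon> / 2))" by (rule exp_ge_add_one_self)
    finally show ?thesis .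
  qed
  have "eventually (\<lambda>N::nat. exp (- (s * \<epsilon> / 2) * real N) \<le> \<eta>) sequentially"
    using s assms by real_asymp
  thus ?thesis
  proof eventually_elim
    case (elim N)
    show ?case
    proof (intro allI impI)
      fix m assume m: "m \<le> N"
      let ?t = "real m * \<mu> - \<epsilon> * real N"
      have "mass p m N (\<lambda>xs. real (sum_list xs) < ?t)
            \<le> exp (s * ?t) * (\<Sum>n=1..N. p n * exp (- s * real n)) ^ m"
      proof (rule mass_Chernoff[OF p_nonneg])
        fix xs assume "real (sum_list xs) < ?t"
        hence "s * real (sum_list xs) \<le> s * ?t" using s by (intro mult_left_mono) auto
        thus "1 \<le> exp (s * ?t) * prod_list (map (\<lambda>n. exp (- s * real n)) xs)"
          by (subst prod_list_exp) (auto simp: exp_add[symmetric])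
      qed auto
      also have "\<dots> \<le> exp (s * ?t) * exp (- s * (\<mu> - \<epsilon> / 2)) ^ m"
        by (intro mult_left_mono power_mono sum_le sum_nonneg mult_nonneg_nonneg p_nonneg) auto
      also have "\<dots> = exp (s * \<epsilon> / 2 * real m - s * \<epsilon> * real N)"
        by (simp add: exp_of_nat_mult[symmetric] exp_add[symmetric] field_simps)
      also have "\<dots> \<le> exp (- (s * \<epsilon> / 2) * real N)"
      proof -
        have "s * \<epsilon> / 2 * real m \<le> s * \<epsilon> / 2 * real N"
          using s assms m by (intro mult_left_mono) auto
        thus ?thesis by (simp add: algebra_simps)
      qed
      also have "\<dots> \<le> \<eta>" by (rule elim)
      finally show "mass p m N (\<lambda>xs. real (sum_list xs) < ?t) \<le> \<eta>" .
    qed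
  qed
qed

lemma weak_law:
  assumes "\<epsilon> > 0" "\<eta> > 0"
  shows "eventually (\<lambda>N. \<forall>m\<le>N.
           mass p m N (\<lambda>xs. \<bar>real (sum_list xs) - real m * \<mu>\<bar> > \<epsilon> * real N) \<le> \<eta>) sequentially"
proof -
  have "\<eta> / 2 > 0" using assms by simp
  from upper_tail[OF assms(1) this] lower_tail[OF assms(1) this] show ?thesis
  proof eventually_elim
    case (elim N)
    show ?case
    proof (intro allI impI)
      fix m assume m: "m \<le> N"
      have "mass p m N (\<lambda>xs. \<bar>real (sum_list xs) - real m * \<mu>\<bar> > \<epsilon> * real N) \<le>
            mass p m N (\<lambda>xs. real (sum_list xs) > real m * \<mu> + \<epsilon> * real N \<or>
                             real (sum_list xs) < real m * \<mu> - \<epsilon> * real N)"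
        by (intro mass_mono p_nonneg) auto
      also have "\<dots> \<le> \<eta> / 2 + \<eta> / 2"
        using elim m by (intro order_trans[OF mass_disj_le[OF p_nonneg]] add_mono) auto
      finally show "mass p m N (\<lambda>xs. \<bar>real (sum_list xs) - real m * \<mu>\<bar> > \<epsilon> * real N) \<le> \<eta>" by simp
    qed
  qed
qed

lemma weak_law_mass_ge:
  assumes "\<epsilon> > 0" "\<eta> > 0"
  shows "eventually (\<lambda>N. \<forall>m\<le>N.
           mass p m N (\<lambda>xs. \<bar>real (sum_list xs) - real m * \<mu>\<bar> \<le> \<epsilon> * real N) \<ge> 1 - \<eta>) sequentially"
proof -
  have "\<eta> / 2 > 0" using assms by simp
  from weak_law[OF assms(1) this] total_mass_ge[OF this] show ?thesis
  proof eventually_elim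
    case (elim N)
    show ?case
    proof (intro allI impI)
      fix m assume m: "m \<le> N"
      show "1 - \<eta> \<le> mass p m N (\<lambda>xs. \<bar>real (sum_list xs) - real m * \<mu>\<bar> \<le> \<epsilon> * real N)"
        using elim(1)[rule_format, OF m] elim(2)[rule_format, OF m] mass_split[of p m N "\<lambda>xs. \<bar>real (sum_list xs) - real m * \<mu>\<bar> \<le> \<epsilon> * real N", OF p_nonneg]
        by (simp add: not_le)
    qed
  qed
qed

text \<open>Fuk--Nagaev type bound: exponential Markov inequality at scale \<open>s = C ln N / N\<close>, where the
  truncation \<open>\<gamma>N\<close> is so small that \<open>exp (s \<gamma> N)\<close> is only a small power of \<open>N\<close>.\<close>
lemma truncated_upper_tail:
  assumes "\<beta> > 0" "summable (\<lambda>n. real n powr (1 + \<beta>) * p n)" "\<kappa> > 0" "D \<ge> 0"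
  obtains \<gamma> where "\<gamma> > 0" "eventually (\<lambda>N. \<forall>m\<le>N.
     mass p m N (\<lambda>xs. real (sum_list xs) \<ge> real m * \<mu> + \<kappa> * real N \<and>
                       (\<forall>x\<in>set xs. real x \<le> \<gamma> * real N)) \<le> real N powr (- D)) sequentially"
proof -
  define M where "M = (\<Sum>n. real n powr (1 + \<beta>) * p n)"
  define C where "C = 2 * (D + 1) / \<kappa>"
  define \<gamma> where "\<gamma> = \<beta> / (2 * C)"
  define \<theta> where "\<theta> = ln (1 + \<kappa> / (2 * \<mu> + 2))"
  have mu: "\<mu> \<ge> 0" by (rule mean_nonneg)
  have C: "C > 0" using assms by (auto simp: C_def)
  have g: "\<gamma> > 0" using assms C by (auto simp: \<gamma>_def)
  have pos: "1 + \<kappa> / (2 * \<mu> + 2) > 1" using mu assms by (simp add: field_simps)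
  have th: "\<theta> > 0" using pos unfolding \<theta>_def by (intro ln_gt_zero) auto
  have e: "exp \<theta> = 1 + \<kappa> / (2 * \<mu> + 2)" using pos by (simp add: \<theta>_def)
  have me: "\<mu> * (exp \<theta> - 1) \<le> \<kappa> / 2" unfolding e using mu assms by (simp add: field_simps)
  define R where "R = (\<lambda>N::nat. real N powr (\<beta> / 2) * (C * ln (real N) / real N / \<theta>) powr (1 + \<beta>) * M)"
  have "(\<lambda>N. real N * R N) \<longlonglongrightarrow> 0"
    unfolding R_def using assms C th by real_asymp
  hence "eventually (\<lambda>N. real N * R N < 1) sequentially" by (rule order_tendstoD) auto
  moreover have "eventually (\<lambda>N::nat. real N > exp 1) sequentially" by real_asymp
  ultimately have "eventually (\<lambda>N. \<forall>m\<le>N.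
     mass p m N (\<lambda>xs. real (sum_list xs) \<ge> real m * \<mu> + \<kappa> * real N \<and>
                       (\<forall>x\<in>set xs. real x \<le> \<gamma> * real N)) \<le> real N powr (- D)) sequentially"
  proof eventually_elim
    case (elim N)
    have "exp (1::real) > 1" by simp
    hence N1: "real N > 1" using elim(2) by linarith
    show ?case
    proof (intro allI impI)
      fix m assume m: "m \<le> N"
      define s where "s = C * ln (real N) / real N"
      have s: "s > 0" using C N1 by (auto simp: s_def)
      have sN: "s * real N = C * ln (real N)" using N1 by (simp add: s_def)
      let ?t = "real m * \<mu> + \<kappa> * real N"
      let ?f = "\<lambda>n. if real n \<le> \<gamma> * real N then exp (s * real n) else 0"
      have R: "R N = real N powr (\<beta> / 2) * (s / \<theta>) powr (1 + \<beta>) * M" by (simp add: R_def s_def)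
      have fs: "(\<Sum>n=1..N. p n * ?f n) \<le> 1 + (s * \<mu> * exp \<theta> + R N)"
      proof -
        have f: "?f n \<le> 1 + s * real n * exp \<theta> + real N powr (\<beta> / 2) * (s / \<theta> * real n) powr (1 + \<beta>)" for n
        proof (cases "real n \<le> \<gamma> * real N")
          case True
          show ?thesis
          proof (cases "s * real n \<le> \<theta>")
            case le: True
            have "exp (s * real n) \<le> 1 + s * real n * exp (s * real n)"
            by (rule exp_le_one_plus_mult_exp)
            also have "\<dots> \<le> 1 + s * real n * exp \<theta>"
              using le s by (intro add_left_mono mult_left_mono) auto
            finally show ?thesis using True by (auto intro: add_increasing2)
          next
            case False
            have "exp (s * real n) \<le> exp (s * (\<gamma> * real N))" using True s by auto
            also have "s * (\<gamma> * real N) = \<beta> / 2 * ln (real N)"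
              using C N1 by (simp add: s_def \<gamma>_def)
            also have "exp \<dots> = real N powr (\<beta> / 2)" using N1 by (simp add: powr_def)
            also have "\<dots> \<le> real N powr (\<beta> / 2) * (s / \<theta> * real n) powr (1 + \<beta>)"
            proof -
              have "(s / \<theta> * real n) powr (1 + \<beta>) \<ge> 1"
                using False th assms by (intro ge_one_powr_ge_zero) (auto simp: field_simps)
              from mult_left_mono[OF this, of "real N powr (\<beta> / 2)"] show ?thesis by simp
            qed
            finally have "exp (s * real n) \<le> real N powr (\<beta> / 2) * (s / \<theta> * real n) powr (1 + \<beta>)" .
            moreover have "0 \<le> 1 + s * real n * exp \<theta>" using s by auto
            ultimately show ?thesis using True by auto
          qed
        qed (use s in \<open>auto intro!: add_nonneg_nonneg\<close>)
        have "(\<Sum>n=1..N. p n * ?f n) \<le>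
           (\<Sum>n=1..N. p n * (1 + s * real n * exp \<theta> + real N powr (\<beta> / 2) * (s / \<theta> * real n) powr (1 + \<beta>)))"
          by (intro sum_mono mult_left_mono f p_nonneg)
        also have "\<dots> = (\<Sum>n=1..N. p n) + s * exp \<theta> * (\<Sum>n=1..N. real n * p n) +
            real N powr (\<beta> / 2) * (s / \<theta>) powr (1 + \<beta>) * (\<Sum>n=1..N. real n powr (1 + \<beta>) * p n)"
        proof -
          have "(s / \<theta> * real n) powr (1 + \<beta>) = (s / \<theta>) powr (1 + \<beta>) * real n powr (1 + \<beta>)" for n
            using s th by (intro powr_mult)
          thus ?thesis
            by (simp add: distrib_left sum.distrib sum_distrib_left mult_ac)
        qed
        also have "\<dots> \<le> 1 + s * exp \<theta> * \<mu> + real N powr (\<beta> / 2) * (s / \<theta>) powr (1 + \<beta>) * M"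
          unfolding M_def using s assms
          by (intro add_mono mult_left_mono sum_p_le_1 sum_mean_le sum_le_suminf) (auto simp: p_nonneg)
        finally show ?thesis by (simp add: R add_ac mult_ac)
      qed
      have "mass p m N (\<lambda>xs. real (sum_list xs) \<ge> ?t \<and> (\<forall>x\<in>set xs. real x \<le> \<gamma> * real N))
            \<le> exp (real m * (s * \<mu> * exp \<theta> + R N) - s * ?t)"
        by (rule truncated_Chernoff[OF less_imp_le[OF s] fs])
      also have "\<dots> = exp (s * real m * (\<mu> * (exp \<theta> - 1)) + real m * R N - \<kappa> * (s * real N))"
        by (simp add: algebra_simps)
      also have "\<dots> \<le> exp (s * real N * (\<kappa> / 2) + 1 - \<kappa> * (s * real N))"
      proof -
        have "s * real m * (\<mu> * (exp \<theta> - 1)) \<le> s * real N * (\<kappa> / 2)"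
          using me s m assms th mu by (intro mult_mono) auto
        moreover have "R N \<ge> 0"
          unfolding R M_def using assms by (intro mult_nonneg_nonneg suminf_nonneg) (auto simp: p_nonneg)
        hence "real m * R N \<le> real N * R N" using m by (intro mult_right_mono) auto
        hence "real m * R N \<le> 1" using elim(1) by linarith
        ultimately show ?thesis by (simp only: exp_le_cancel_iff)
      qed
      also have "s * real N * (\<kappa> / 2) + 1 - \<kappa> * (s * real N) = - D * ln (real N) + (1 - ln (real N))"
        unfolding sN using assms by (simp add: C_def field_simps)
      also have "exp (- D * ln (real N) + (1 - ln (real N))) \<le> exp (- D * ln (real N))"
      proof -
        have "ln (real N) \<ge> ln (exp 1)" using elim(2) N1 by (subst ln_le_cancel_iff) auto
        thus ?thesis by simp
      qed
      also have "\<dots> = real N powr (- D)" using N1 by (simp add: powr_def)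
      finally show "mass p m N (\<lambda>xs. real (sum_list xs) \<ge> ?t \<and> (\<forall>x\<in>set xs. real x \<le> \<gamma> * real N))
         \<le> real N powr (- D)" .
    qed
  qed
  thus ?thesis using that g by blast
qed

end

section \<open>The one-big-jump principle\<close>

definition one_jump :: "real \<Rightarrow> real \<Rightarrow> nat list \<Rightarrow> bool" where
  "one_jump c \<epsilon> xs \<longleftrightarrow> (\<exists>i<length xs. \<bar>real (xs ! i) - c\<bar> \<le> \<epsilon> \<and>
     (\<forall>y\<in>set (take i xs @ drop (Suc i) xs). y \<le> xs ! i \<and> real y \<le> \<epsilon>))"

lemma sum_list_remove_nth:
  "i < length xs \<Longrightarrow> sum_list (xs :: nat list) = xs ! i + sum_list (take i xs @ drop (Suc i) xs)"
  using sum_list_insert_nth[of i "take i xs @ drop (Suc i) xs" "xs ! i"] id_take_nth_drop[of i xs]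
  by (simp add: min_def)

locale power_law_kernel =
  fixes K :: "nat \<Rightarrow> real" and \<alpha> C_K :: real
  assumes K0: "K 0 = 0"
    and Kpos: "\<And>n. n \<ge> 1 \<Longrightarrow> K n > 0"
    and Ksum: "K sums 1"
    and alpha: "\<alpha> > 0" and CK: "C_K > 0"
    and Kasym: "K \<sim>[at_top] (\<lambda>n. C_K * real n powr (- (1 + \<alpha>)))"
begin

abbreviation pinned_mass :: "nat \<Rightarrow> nat \<Rightarrow> real" where
  "pinned_mass m N \<equiv> mass K m N (\<lambda>xs. sum_list xs = N)"

lemma K_nonneg: "K n \<ge> 0"
  using K0 Kpos[of n] by (cases "n = 0") auto

lemma K_ratio_tendsto: "(\<lambda>n. K n * real n powr (1 + \<alpha>)) \<longlonglongrightarrow> C_K"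
proof -
  have "(\<lambda>n. K n / (C_K * real n powr (- (1 + \<alpha>)))) \<longlonglongrightarrow> 1"
    by (rule asymp_equivD_strong[OF Kasym])
       (use CK in \<open>auto intro!: eventually_mono[OF eventually_gt_at_top[of 0]]\<close>)
  from tendsto_mult_left[OF this[unfolded powr_minus], of C_K] show ?thesis
    using CK by (simp add: field_simps)
qed

lemma K_upper: obtains C where "C > 0" "\<And>n. n \<ge> 1 \<Longrightarrow> K n \<le> C * real n powr (- (1 + \<alpha>))"
proof -
  have "Bseq (\<lambda>n. K n * real n powr (1 + \<alpha>))"
    using K_ratio_tendsto by (intro convergent_imp_Bseq) (auto simp: convergent_def)
  then obtain C where C: "C > 0" "\<And>n. norm (K n * real n powr (1 + \<alpha>)) \<le> C"
    by (auto simp: Bseq_def)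
  have "K n \<le> C * real n powr (- (1 + \<alpha>))" if "n \<ge> 1" for n
    unfolding powr_minus using C(2)[of n] that K_nonneg[of n] by (simp add: field_simps)
  thus ?thesis using that C by blast
qed

lemma K_lower: obtains c where "c > 0" "\<And>n. n \<ge> 1 \<Longrightarrow> K n \<ge> c * real n powr (- (1 + \<alpha>))"
proof -
  have "(\<lambda>n. inverse (K n * real n powr (1 + \<alpha>))) \<longlonglongrightarrow> inverse C_K"
    using CK by (intro tendsto_inverse K_ratio_tendsto) auto
  hence "Bseq (\<lambda>n. inverse (K n * real n powr (1 + \<alpha>)))"
    by (intro convergent_imp_Bseq) (auto simp: convergent_def)
  then obtain B where B: "B > 0" "\<And>n. norm (inverse (K n * real n powr (1 + \<alpha>))) \<le> B"
    by (auto simp: Bseq_def)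
  have "K n \<ge> inverse B * real n powr (- (1 + \<alpha>))" if "n \<ge> 1" for n
    unfolding powr_minus using B(2)[of n] B(1) that Kpos[of n] by (simp add: field_simps)
  thus ?thesis using that B by (metis inverse_positive_iff_positive)
qed

lemma K_lower_uniform:
  obtains c where "c > 0" "\<And>n N. 1 \<le> n \<Longrightarrow> n \<le> N \<Longrightarrow> K n \<ge> c * real N powr (- (1 + \<alpha>))"
proof -
  obtain c where c: "c > 0" "\<And>n. n \<ge> 1 \<Longrightarrow> K n \<ge> c * real n powr (- (1 + \<alpha>))"
    using K_lower by blast
  have "c * real N powr (- (1 + \<alpha>)) \<le> K n" if "1 \<le> n" "n \<le> N" for n N
  proof -
    have "c * real N powr (- (1 + \<alpha>)) \<le> c * real n powr (- (1 + \<alpha>))"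
      using that c alpha by (intro mult_left_mono powr_mono2') auto
    thus ?thesis using c(2)[of n] that by linarith
  qed
  thus ?thesis using that c by blast
qed

lemma finite_mean_imp_alpha_gt_1:
  assumes "summable (\<lambda>n. real n * K n)"
  shows "\<alpha> > 1"
proof -
  obtain c where c: "c > 0" "\<And>n. n \<ge> 1 \<Longrightarrow> K n \<ge> c * real n powr (- (1 + \<alpha>))"
    using K_lower by blast
  have "summable (\<lambda>n. c * real n powr (- \<alpha>))"
  proof (rule summable_comparison_test'[OF assms, of 1])
    fix n :: nat assume n: "n \<ge> 1"
    have "c * real n powr (- \<alpha>) = real n * (c * real n powr (- (1 + \<alpha>)))"
      using n powr_add[of "real n" 1 "- (1 + \<alpha>)"] by simp
    also have "\<dots> \<le> real n * K n" using c(2)[OF n] by (intro mult_left_mono) auto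
    finally show "norm (c * real n powr (- \<alpha>)) \<le> real n * K n" using c by simp
  qed
  hence "summable (\<lambda>n. real n powr (- \<alpha>))" using c by simp
  thus ?thesis by (simp add: summable_real_powr_iff)
qed

lemma higher_moment:
  assumes "summable (\<lambda>n. real n * K n)"
  obtains \<beta> where "\<beta> > 0" "summable (\<lambda>n. real n powr (1 + \<beta>) * K n)"
proof -
  have a: "\<alpha> > 1" by (rule finite_mean_imp_alpha_gt_1[OF assms])
  obtain C where C: "C > 0" "\<And>n. n \<ge> 1 \<Longrightarrow> K n \<le> C * real n powr (- (1 + \<alpha>))"
    using K_upper by blast
  define \<beta> where "\<beta> = (\<alpha> - 1) / 2"
  have "summable (\<lambda>n. real n powr (\<beta> - \<alpha>))"
    using a by (simp add: summable_real_powr_iff \<beta>_def field_simps)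
  hence "summable (\<lambda>n. C * real n powr (\<beta> - \<alpha>))" by (intro summable_mult)
  hence "summable (\<lambda>n. real n powr (1 + \<beta>) * K n)"
  proof (rule summable_comparison_test'[of _ 1])
    fix n :: nat assume n: "n \<ge> 1"
    have "real n powr (1 + \<beta>) * K n \<le> real n powr (1 + \<beta>) * (C * real n powr (- (1 + \<alpha>)))"
      using C(2)[OF n] by (intro mult_left_mono) auto
    also have "\<dots> = C * real n powr (\<beta> - \<alpha>)"
      using powr_add[of "real n" "1 + \<beta>" "- (1 + \<alpha>)"] by simp
    finally show "norm (real n powr (1 + \<beta>) * K n) \<le> C * real n powr (\<beta> - \<alpha>)"
      using K_nonneg by simp
  qed
  moreover have "\<beta> > 0" using a by (simp add: \<beta>_def)
  ultimately show ?thesis using that by blast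
qed

lemma finite_mean_law: "(\<lambda>n. real n * K n) sums \<mu> \<Longrightarrow> finite_mean_law K \<mu>"
  by unfold_locales (auto simp: K_nonneg K0 Ksum)

lemma mean_ge_1:
  assumes "(\<lambda>n. real n * K n) sums \<mu>"
  shows "\<mu> \<ge> 1"
proof (rule sums_le[OF _ Ksum assms])
  fix n show "K n \<le> real n * K n"
    using K_nonneg[of n] K0 by (cases "n = 0") (auto simp: mult_le_cancel_right1)
qed

lemma gap_count_le:
  assumes "(\<lambda>n. real n * K n) sums \<mu>" "a * \<mu> < 1" "real m \<le> a * real N"
  shows "real m * \<mu> \<le> a * \<mu> * real N" "m \<le> N"
proof -
  have mu: "\<mu> \<ge> 1" by (rule mean_ge_1[OF assms(1)])
  have "real m * \<mu> \<le> a * real N * \<mu>" using assms(3) mu by (intro mult_right_mono) auto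
  thus 1: "real m * \<mu> \<le> a * \<mu> * real N" by (simp add: mult_ac)
  have "real m * 1 \<le> real m * \<mu>" using mu by (intro mult_left_mono) auto
  also note 1
  also have "a * \<mu> * real N \<le> 1 * real N" using assms(2) by (intro mult_right_mono) auto
  finally show "m \<le> N" by simp
qed

lemma pinned_mass_ge:
  assumes mean: "(\<lambda>n. real n * K n) sums \<mu>" and a: "a * \<mu> < 1"
  obtains c where "c > 0" "eventually (\<lambda>N. \<forall>m\<ge>1. real m \<le> a * real N \<longrightarrow>
     pinned_mass m N \<ge> c * real m * real N powr (- (1 + \<alpha>))) sequentially"
proof -
  interpret L: finite_mean_law K \<mu> by (rule finite_mean_law[OF mean])
  define \<kappa> where "\<kappa> = (1 - a * \<mu>) / 2"
  have k: "\<kappa> > 0" using a by (simp add: \<kappa>_def)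
  have mu: "\<mu> \<ge> 1" by (rule mean_ge_1[OF mean])
  obtain c where c: "c > 0" "\<And>n N. 1 \<le> n \<Longrightarrow> n \<le> N \<Longrightarrow> K n \<ge> c * real N powr (- (1 + \<alpha>))"
    using K_lower_uniform by blast
  have "eventually (\<lambda>N. \<forall>m\<le>N. mass K m N (\<lambda>xs. \<bar>real (sum_list xs) - real m * \<mu>\<bar> \<le> \<kappa> * real N) \<ge> 1 - 1/2) sequentially"
    by (rule L.weak_law_mass_ge) (use k in auto)
  hence "eventually (\<lambda>N. \<forall>m\<ge>1. real m \<le> a * real N \<longrightarrow>
     pinned_mass m N \<ge> \<kappa> * c / 2 * real m * real N powr (- (1 + \<alpha>))) sequentially"
    using eventually_gt_at_top[of 0]
  proof eventually_elim
    case (elim N)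
    show ?case
    proof (intro allI impI)
      fix m :: nat assume m: "m \<ge> 1" "real m \<le> a * real N"
      then obtain k' where m': "m = Suc k'" by (cases m) auto
      have kN: "k' \<le> N" using gap_count_le(2)[OF mean a m(2)] m' by simp
      define B where "B = {n. n \<in> {1..N} \<and> real n \<ge> \<kappa> * real N}"
      have finB: "finite B" by (auto simp: B_def)
      have "1 / 2 \<le> mass K k' N (\<lambda>xs. \<bar>real (sum_list xs) - real k' * \<mu>\<bar> \<le> \<kappa> * real N)"
        using elim kN by auto
      also have "\<dots> \<le> mass K k' N (\<lambda>xs. sum_list xs \<in> (\<lambda>n. N - n) ` B \<and> True)"
      proof (intro mass_mono K_nonneg)
        fix xs assume xs: "\<bar>real (sum_list xs) - real k' * \<mu>\<bar> \<le> \<kappa> * real N"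
        have "real k' * \<mu> \<le> real m * \<mu>" using m' mu by simp
        hence "real (sum_list xs) \<le> a * \<mu> * real N + \<kappa> * real N"
          using xs gap_count_le(1)[OF mean a m(2)] by linarith
        also have "\<dots> = real N - \<kappa> * real N" by (simp add: \<kappa>_def field_simps)
        finally have le: "real (sum_list xs) \<le> real N - \<kappa> * real N" .
        hence "real (sum_list xs) < real N" using k elim(2) by (smt (verit) mult_pos_pos of_nat_0_less_iff)
        hence "sum_list xs < N" by simp
        thus "sum_list xs \<in> (\<lambda>n. N - n) ` B \<and> True" using le
          by (auto simp: B_def intro!: image_eqI[of _ _ "N - sum_list xs"])
      qed
      also have "\<dots> = (\<Sum>n\<in>B. mass K k' N (\<lambda>xs. sum_list xs = N - n \<and> True))"
        by (rule mass_sum_values[symmetric, OF K_nonneg finB]) (auto simp: inj_on_def B_def)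
      finally have half: "1 / 2 \<le> (\<Sum>n\<in>B. mass K k' N (\<lambda>xs. sum_list xs = N - n))" by simp
      have "\<kappa> * c / 2 * real m * real N powr (- (1 + \<alpha>)) =
            \<kappa> * real m * ((c * real N powr (- (1 + \<alpha>))) * (1 / 2))" by simp
      also have "\<dots> \<le> \<kappa> * real m * ((c * real N powr (- (1 + \<alpha>))) * (\<Sum>n\<in>B. mass K k' N (\<lambda>xs. sum_list xs = N - n)))"
        using k c half by (intro mult_left_mono) auto
      also have "\<dots> \<le> \<kappa> * real m * (\<Sum>n\<in>B. K n * mass K k' N (\<lambda>xs. sum_list xs = N - n))"
        unfolding sum_distrib_left[where r = "c * real N powr (- (1 + \<alpha>))"]
        using k c by (intro mult_left_mono[OF sum_mono] mult_right_mono mass_nonneg K_nonneg) (auto simp: B_def)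
      also have "\<dots> \<le> pinned_mass m N"
        unfolding B_def m' using k elim(2) by (intro mass_one_large_entry K_nonneg) auto
      finally show "\<kappa> * c / 2 * real m * real N powr (- (1 + \<alpha>)) \<le> pinned_mass m N" .
    qed
  qed
  moreover have "\<kappa> * c / 2 > 0" using k c by simp
  ultimately show ?thesis using that by blast
qed

lemma big_jump:
  assumes mean: "(\<lambda>n. real n * K n) sums \<mu>" and a: "a * \<mu> < 1" and "\<epsilon> > 0" "\<eta> > 0"
  shows "eventually (\<lambda>N. \<forall>m\<ge>1. real m \<le> a * real N \<longrightarrow>
     mass K m N (\<lambda>xs. sum_list xs = N \<and> \<not> one_jump (real N - real m * \<mu>) (\<epsilon> * real N) xs)
       \<le> \<eta> * pinned_mass m N) sequentially"
proof -
  interpret L: finite_mean_law K \<mu> by (rule finite_mean_law[OF mean])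
  define \<kappa> where "\<kappa> = 1 - a * \<mu>"
  have k: "\<kappa> > 0" using a by (simp add: \<kappa>_def)
  have mu: "\<mu> \<ge> 1" by (rule mean_ge_1[OF mean])
  obtain \<beta> where \<beta>: "\<beta> > 0" "summable (\<lambda>n. real n powr (1 + \<beta>) * K n)"
    using higher_moment mean by (auto simp: sums_iff)
  obtain \<gamma>0 where \<gamma>0: "\<gamma>0 > 0" and FN: "eventually (\<lambda>N. \<forall>m\<le>N.
     mass K m N (\<lambda>xs. real (sum_list xs) \<ge> real m * \<mu> + \<kappa> * real N \<and>
          (\<forall>x\<in>set xs. real x \<le> \<gamma>0 * real N)) \<le> real N powr (- (\<alpha> + 2))) sequentially"
    using L.truncated_upper_tail[OF \<beta> k, of "\<alpha> + 2"] alpha by auto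
  define \<gamma> where "\<gamma> = min \<gamma>0 \<epsilon>"
  have g: "\<gamma> > 0" "\<gamma> \<le> \<gamma>0" "\<gamma> \<le> \<epsilon>" using \<gamma>0 assms by (auto simp: \<gamma>_def)
  obtain C where C: "C > 0" "\<And>n. n \<ge> 1 \<Longrightarrow> K n \<le> C * real n powr (- (1 + \<alpha>))"
    using K_upper by blast
  obtain c where c: "c > 0" and low: "eventually (\<lambda>N. \<forall>m\<ge>1. real m \<le> a * real N \<longrightarrow>
     pinned_mass m N \<ge> c * real m * real N powr (- (1 + \<alpha>))) sequentially"
    using pinned_mass_ge[OF mean a] by blast
  define D where "D = C * \<gamma> powr (- (1 + \<alpha>))"
  have D: "D > 0" using C g by (simp add: D_def)
  define \<eta>1 where "\<eta>1 = \<eta> * c / (4 * D)"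
  have \<eta>1: "\<eta>1 > 0" using assms c D by (simp add: \<eta>1_def)
  have "eventually (\<lambda>N. \<forall>m\<le>N. mass K m N (\<lambda>xs. \<bar>real (sum_list xs) - real m * \<mu>\<bar> > \<epsilon> / 2 * real N) \<le> \<eta>1) sequentially"
    by (rule L.weak_law) (use \<eta>1 assms in auto)
  moreover have "eventually (\<lambda>N::nat. \<forall>B. finite B \<longrightarrow> (\<forall>n\<in>B. \<gamma> * real N < real n) \<longrightarrow>
           real N * (\<Sum>n\<in>B. K n) \<le> \<eta>1) sequentially"
    by (rule L.tail_small) (use g \<eta>1 in auto)
  moreover have "eventually (\<lambda>N::nat. 1 / real N \<le> \<eta> * c / 2) sequentially"
    using assms c by real_asymp
  moreover have "eventually (\<lambda>N::nat. \<mu> \<le> \<epsilon> / 2 * real N) sequentially"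
    using assms by real_asymp
  ultimately show ?thesis using FN low eventually_gt_at_top[of 0]
  proof eventually_elim
    case (elim N)
    have N: "N > 0" using elim by simp
    show ?case
    proof (intro allI impI)
      fix m :: nat assume m: "m \<ge> 1" "real m \<le> a * real N"
      then obtain k' where m': "m = Suc k'" by (cases m) auto
      note mmu = gap_count_le(1)[OF mean a m(2)] and mN = gap_count_le(2)[OF mean a m(2)]
      let ?nj = "mass K m N (\<lambda>xs. sum_list xs = N \<and> \<not> one_jump (real N - real m * \<mu>) (\<epsilon> * real N) xs)"
      define bad where "bad = (\<lambda>ys. \<bar>real (sum_list ys) - real m * \<mu>\<bar> > \<epsilon> * real N \<or>
                                     (\<exists>y\<in>set ys. real y > \<gamma> * real N))"
      define P where "P = (\<lambda>n ys. sum_list ys = N - n \<and> real n > \<gamma> * real N \<and> bad ys)"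
      define E1 where "E1 = (\<lambda>xs. real (sum_list xs) \<ge> real m * \<mu> + \<kappa> * real N \<and>
          (\<forall>x\<in>set xs. real x \<le> \<gamma>0 * real N))"
      define E2 where "E2 = (\<lambda>xs. \<exists>i\<le>k'. P (xs ! i) (take i xs @ drop (Suc i) xs))"
      have "?nj
            \<le> mass K m N (\<lambda>xs. E1 xs \<or> E2 xs)"
      proof (intro mass_mono K_nonneg)
        fix xs assume xs: "xs \<in> seqs m N"
          and s: "sum_list xs = N \<and> \<not> one_jump (real N - real m * \<mu>) (\<epsilon> * real N) xs"
        have l: "length xs = Suc k'" using xs m' by (simp add: seqs_def)
        show "E1 xs \<or> E2 xs"
        proof (cases "\<exists>x\<in>set xs. real x > \<gamma> * real N")
          case False
          have "real m * \<mu> + \<kappa> * real N \<le> real N" using mmu by (simp add: \<kappa>_def algebra_simps)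
          moreover have "real x \<le> \<gamma>0 * real N" if "x \<in> set xs" for x
          proof -
            have "real x \<le> \<gamma> * real N" using False that by auto
            also have "\<dots> \<le> \<gamma>0 * real N" using g by (intro mult_right_mono) auto
            finally show ?thesis .
          qed
          ultimately show ?thesis using s by (simp add: E1_def)
        next
          case True
          then obtain i where i: "i < length xs" "real (xs ! i) > \<gamma> * real N"
            by (auto simp: in_set_conv_nth)
          let ?r = "take i xs @ drop (Suc i) xs"
          have sr: "N = xs ! i + sum_list ?r" using sum_list_remove_nth[OF i(1)] s by simp
          have "bad ?r"
          proof (rule ccontr)
            assume nb: "\<not> bad ?r"
            have "\<bar>real (xs ! i) - (real N - real m * \<mu>)\<bar> \<le> \<epsilon> * real N"
              using nb sr unfolding bad_def by linarith
            moreover have "y \<le> xs ! i \<and> real y \<le> \<epsilon> * real N" if "y \<in> set ?r" for y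
            proof -
              have y: "real y \<le> \<gamma> * real N" using nb that unfolding bad_def by (meson not_less)
              also have "\<dots> \<le> \<epsilon> * real N" using g by (intro mult_right_mono) auto
              finally show ?thesis using y i(2) by linarith
            qed
            ultimately have "one_jump (real N - real m * \<mu>) (\<epsilon> * real N) xs"
              unfolding one_jump_def using i(1) by blast
            thus False using s by simp
          qed
          hence "P (xs ! i) ?r" using i(2) sr by (auto simp: P_def)
          thus ?thesis using i l unfolding E2_def by (auto simp: less_Suc_eq_le)
        qed
      qed
      also have "\<dots> \<le> mass K m N E1 + mass K m N E2" by (rule mass_disj_le[OF K_nonneg])
      also have "mass K m N E1 \<le> real N powr (- (\<alpha> + 2))"
        using elim(5) mN by (auto simp: E1_def)
      also have "real N powr (- (\<alpha> + 2)) = 1 / real N * real N powr (- (1 + \<alpha>))"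
      proof -
        have e: "- (\<alpha> + 2) = -1 + - (1 + \<alpha>)" by simp
        show ?thesis unfolding e powr_add using N by (simp add: powr_minus_divide)
      qed
      also have "\<dots> \<le> \<eta> * c / 2 * (real m * real N powr (- (1 + \<alpha>)))"
        using elim(3) m N assms c by (intro mult_mono) auto
      finally have step: "?nj
            \<le> \<eta> * c / 2 * (real m * real N powr (- (1 + \<alpha>))) + mass K m N E2" by simp
      have mb: "mass K k' N bad \<le> 2 * \<eta>1"
      proof -
        have "mass K k' N bad \<le> mass K k' N (\<lambda>xs. \<bar>real (sum_list xs) - real k' * \<mu>\<bar> > \<epsilon> / 2 * real N \<or>
                (\<exists>y\<in>set xs. real y > \<gamma> * real N))"
          unfolding bad_def
        proof (intro mass_mono K_nonneg, elim disjE)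
          fix xs assume "\<bar>real (sum_list xs) - real m * \<mu>\<bar> > \<epsilon> * real N"
          hence "\<bar>real (sum_list xs) - real k' * \<mu>\<bar> > \<epsilon> / 2 * real N"
            using elim(4) mu m' by (simp add: algebra_simps abs_if split: if_splits)
          thus "\<bar>real (sum_list xs) - real k' * \<mu>\<bar> > \<epsilon> / 2 * real N \<or>
                (\<exists>y\<in>set xs. real y > \<gamma> * real N)" by simp
        qed auto
        also have "\<dots> \<le> mass K k' N (\<lambda>xs. \<bar>real (sum_list xs) - real k' * \<mu>\<bar> > \<epsilon> / 2 * real N) +
             mass K k' N (\<lambda>xs. \<exists>y\<in>set xs. real y > \<gamma> * real N)"
          by (rule mass_disj_le[OF K_nonneg])
        also have "mass K k' N (\<lambda>xs. \<bar>real (sum_list xs) - real k' * \<mu>\<bar> > \<epsilon> / 2 * real N) \<le> \<eta>1"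
          using elim(1) mN m' by auto
        also have "mass K k' N (\<lambda>xs. \<exists>y\<in>set xs. real y > \<gamma> * real N) \<le> \<eta>1"
        proof -
          let ?B = "{n. n \<in> {1..N} \<and> real n > \<gamma> * real N}"
          have "mass K k' N (\<lambda>xs. \<exists>y\<in>set xs. real y > \<gamma> * real N) \<le> real k' * (\<Sum>n\<in>?B. K n)"
            by (rule L.mass_large_entry_le)
          also have "\<dots> \<le> real N * (\<Sum>n\<in>?B. K n)"
            using mN m' by (intro mult_right_mono sum_nonneg K_nonneg) auto
          also have "\<dots> \<le> \<eta>1" by (intro elim(2)[rule_format]) auto
          finally show ?thesis .
        qed
        finally show ?thesis by simp
      qed
      have "mass K m N E2 \<le> real m * (\<Sum>n=1..N. K n * mass K k' N (P n))"
        unfolding m' E2_def by (intro mass_union_bound K_nonneg)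
      also have "(\<Sum>n=1..N. K n * mass K k' N (P n)) \<le>
          (\<Sum>n=1..N. D * real N powr (- (1 + \<alpha>)) * mass K k' N (\<lambda>ys. sum_list ys = N - n \<and> bad ys))"
      proof (intro sum_mono)
        fix n assume n: "n \<in> {1..N}"
        show "K n * mass K k' N (P n) \<le> D * real N powr (- (1 + \<alpha>)) * mass K k' N (\<lambda>ys. sum_list ys = N - n \<and> bad ys)"
        proof (cases "real n > \<gamma> * real N")
          case True
          have "K n \<le> C * real n powr (- (1 + \<alpha>))" using C n by auto
          also have "\<dots> \<le> C * (\<gamma> * real N) powr (- (1 + \<alpha>))"
            using True C g N alpha by (intro mult_left_mono powr_mono2') auto
          also have "\<dots> = D * real N powr (- (1 + \<alpha>))"
            using g N by (simp add: D_def powr_mult)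
          finally show ?thesis
            using D by (intro mult_mono mass_mono mass_nonneg K_nonneg) (auto simp: P_def)
        next
          case False
          hence "P n = (\<lambda>_. False)" by (auto simp: P_def)
          thus ?thesis using D by (auto simp: mass_def[of _ _ _ "\<lambda>_. False"] intro!: mult_nonneg_nonneg mass_nonneg K_nonneg)
        qed
      qed
      also have "\<dots> = D * real N powr (- (1 + \<alpha>)) * mass K k' N (\<lambda>ys. sum_list ys \<in> (\<lambda>n. N - n) ` {1..N} \<and> bad ys)"
        by (subst mass_sum_values[symmetric, OF K_nonneg]) (auto simp: inj_on_def sum_distrib_left)
      also have "\<dots> \<le> D * real N powr (- (1 + \<alpha>)) * (2 * \<eta>1)"
        using D by (intro mult_left_mono order_trans[OF mass_mono mb] K_nonneg) auto
      also have "\<dots> = \<eta> * c / 2 * real N powr (- (1 + \<alpha>))" using D by (simp add: \<eta>1_def field_simps)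
      finally have "mass K m N E2 \<le> real m * (\<eta> * c / 2 * real N powr (- (1 + \<alpha>)))"
        by (simp add: mult_left_mono)
      with step have "?nj
            \<le> \<eta> * (c * real m * real N powr (- (1 + \<alpha>)))" by (simp add: algebra_simps)
      also have "\<dots> \<le> \<eta> * pinned_mass m N"
        using elim(6) m assms by (intro mult_left_mono) auto
      finally show "?nj
            \<le> \<eta> * pinned_mass m N" .
    qed
  qed
qed

end

section \<open>Renewal sets and their gaps\<close>

fun partial_sums :: "nat \<Rightarrow> nat list \<Rightarrow> nat list" where
  "partial_sums s [] = [s]"
| "partial_sums s (x # xs) = s # partial_sums (s + x) xs"

lemma hd_partial_sums [simp]: "hd (partial_sums s xs) = s"
  by (cases xs) auto

lemma partial_sums_bounds: "y \<in> set (partial_sums s xs) \<Longrightarrow> s \<le> y \<and> y \<le> s + sum_list xs"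
  by (induction s xs rule: partial_sums.induct) auto

lemma partial_sums_endpoints: "s \<in> set (partial_sums s xs)" "s + sum_list xs \<in> set (partial_sums s xs)"
proof -
  show "s \<in> set (partial_sums s xs)" by (cases xs) auto
  show "s + sum_list xs \<in> set (partial_sums s xs)"
    by (induction s xs rule: partial_sums.induct) (auto simp: add.assoc)
qed

lemma strict_sorted_partial_sums:
  "0 \<notin> set xs \<Longrightarrow> sorted_wrt (<) (partial_sums s xs)"
proof (induction s xs rule: partial_sums.induct)
  case (2 s x xs)
  thus ?case using partial_sums_bounds by fastforce
qed simp

definition diffs_list :: "nat list \<Rightarrow> nat list" where
  "diffs_list ys = map (\<lambda>i. ys ! Suc i - ys ! i) [0..<length ys - 1]"

lemma diffs_list_Cons: "ys \<noteq> [] \<Longrightarrow> diffs_list (y # ys) = (hd ys - y) # diffs_list ys"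
  by (rule nth_equalityI) (auto simp: diffs_list_def nth_Cons hd_conv_nth split: nat.split)

lemma diffs_list_partial_sums: "diffs_list (partial_sums s xs) = xs"
proof (induction s xs rule: partial_sums.induct)
  case (2 s x xs)
  have "partial_sums (s + x) xs \<noteq> []" by (cases xs) auto
  thus ?case using 2 by (simp add: diffs_list_Cons)
qed (simp add: diffs_list_def)

lemma partial_sums_diffs_list:
  "sorted_wrt (<) ys \<Longrightarrow> ys \<noteq> [] \<Longrightarrow> partial_sums (hd ys) (diffs_list ys) = ys"
proof (induction ys)
  case (Cons y ys)
  show ?case
  proof (cases "ys = []")
    case False
    hence e: "y + (hd ys - y) = hd ys" using Cons.prems by (simp add: less_imp_le)
    show ?thesis using Cons False by (simp add: diffs_list_Cons e)
  qed (simp add: diffs_list_def)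
qed simp

lemma diffs_list_pos: "sorted_wrt (<) ys \<Longrightarrow> 0 \<notin> set (diffs_list ys)"
proof (induction ys)
  case (Cons y ys)
  show ?case
  proof (cases "ys = []")
    case False
    hence e: "\<not> hd ys \<le> y" using Cons.prems by (simp add: not_le)
    show ?thesis using Cons False by (simp add: diffs_list_Cons e)
  qed (simp add: diffs_list_def)
qed (simp add: diffs_list_def)

lemma gaps_eq_diffs_list: "gaps A = diffs_list (sorted_list_of_set A)"
  by (simp add: gaps_def diffs_list_def Let_def)

definition compositions :: "nat \<Rightarrow> nat list set" where
  "compositions N = {xs. 0 \<notin> set xs \<and> sum_list xs = N}"

lemma bij_betw_gaps: "bij_betw gaps (confs N) (compositions N)"
proof (rule bij_betw_byWitness[where f' = "\<lambda>xs. set (partial_sums 0 xs)"])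
  have A: "partial_sums 0 (gaps A) = sorted_list_of_set A" if "A \<in> confs N" for A
  proof -
    have fin: "finite A" and ne: "0 \<in> A" using that finite_subset[of A] by (auto simp: confs_def)
    have "hd (sorted_list_of_set A) = Min A" using fin ne by (intro sorted_list_of_set_nonempty[THEN arg_cong[of _ _ hd], THEN trans]) auto
    also have "\<dots> = 0" using fin ne by (metis Min_le le_zero_eq)
    finally have "hd (sorted_list_of_set A) = 0" .
    thus ?thesis using partial_sums_diffs_list[of "sorted_list_of_set A"] fin ne
      by (auto simp: gaps_eq_diffs_list)
  qed
  show 1: "\<forall>A\<in>confs N. set (partial_sums 0 (gaps A)) = A"
    using A finite_subset by (fastforce simp: confs_def)
  have B: "sorted_list_of_set (set (partial_sums 0 xs)) = partial_sums 0 xs" if "xs \<in> compositions N" for xs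
    using strict_sorted_partial_sums[of xs 0] that
    by (auto simp: compositions_def strict_sorted_iff sorted_list_of_set.idem_if_sorted_distinct)
  show 2: "\<forall>xs\<in>compositions N. gaps (set (partial_sums 0 xs)) = xs"
    using B by (simp add: gaps_eq_diffs_list diffs_list_partial_sums)
  show "gaps ` confs N \<subseteq> compositions N"
  proof safe
    fix A assume AN: "A \<in> confs N"
    have p: "0 \<notin> set (gaps A)" unfolding gaps_eq_diffs_list by (rule diffs_list_pos) simp
    have fin: "finite A" using AN finite_subset[of A] by (auto simp: confs_def)
    have eq: "set (partial_sums 0 (gaps A)) = A" using 1 AN by blast
    have "sum_list (gaps A) \<in> A" using partial_sums_endpoints(2)[of 0 "gaps A"] eq by simp
    hence "sum_list (gaps A) \<le> N" using AN by (auto simp: confs_def)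
    moreover have "N \<le> sum_list (gaps A)"
      using AN partial_sums_bounds[of N 0 "gaps A"] eq by (auto simp: confs_def)
    ultimately show "gaps A \<in> compositions N" using p by (simp add: compositions_def)
  qed
  show "(\<lambda>xs. set (partial_sums 0 xs)) ` compositions N \<subseteq> confs N"
    using partial_sums_bounds[of _ 0] partial_sums_endpoints[of 0]
    by (fastforce simp: confs_def compositions_def)
qed

lemma nren_eq_length_gaps: "finite A \<Longrightarrow> nren A = length (gaps A)"
  by (simp add: nren_def gaps_def Let_def)

lemma composition_iff_seqs:
  "xs \<in> compositions N \<longleftrightarrow> xs \<in> seqs (length xs) N \<and> sum_list xs = N"
proof -
  have "x \<le> N" if "x \<in> set xs" "sum_list xs = N" for x
    using member_le_sum_list[OF that(1)] that(2) by simp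
  moreover have "0 \<notin> set xs \<longleftrightarrow> (\<forall>x\<in>set xs. 1 \<le> x)" by (metis One_nat_def Suc_leI gr0I not_one_le_zero)
  ultimately show ?thesis unfolding compositions_def seqs_def by auto
qed

lemma length_le_sum_list: "0 \<notin> set xs \<Longrightarrow> length xs \<le> sum_list (xs :: nat list)"
  by (induction xs) (auto intro: add_mono[of 1, simplified])

lemma sum_confs_eq:
  assumes "N \<ge> 1"
  shows "(\<Sum>A | A \<in> confs N \<and> E (gaps A). w (nren A) * renewal_prob K A) =
         (\<Sum>m=1..N. w m * mass K m N (\<lambda>xs. sum_list xs = N \<and> E xs))"
proof -
  have fin: "finite A" if "A \<in> confs N" for A using that finite_subset by (auto simp: confs_def)
  have bij: "bij_betw gaps {A. A \<in> confs N \<and> E (gaps A)} {xs. xs \<in> compositions N \<and> E xs}"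
    using bij_betw_gaps[of N] by (auto simp: bij_betw_def inj_on_def)
  let ?S = "\<lambda>m. {xs. xs \<in> seqs m N \<and> sum_list xs = N \<and> E xs}"
  have eq: "{xs. xs \<in> compositions N \<and> E xs} = (\<Union>m\<in>{1..N}. ?S m)"
  proof (intro set_eqI iffI)
    fix xs assume "xs \<in> {xs. xs \<in> compositions N \<and> E xs}"
    hence xs: "xs \<in> compositions N" "E xs" by auto
    have "length xs \<le> N" using xs length_le_sum_list by (auto simp: compositions_def)
    moreover have "length xs \<ge> 1" using xs assms by (cases xs) (auto simp: compositions_def)
    ultimately show "xs \<in> (\<Union>m\<in>{1..N}. ?S m)" using xs composition_iff_seqs by auto
  next
    fix xs assume "xs \<in> (\<Union>m\<in>{1..N}. ?S m)"
    thus "xs \<in> {xs. xs \<in> compositions N \<and> E xs}" by (auto simp: composition_iff_seqs seqs_def)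
  qed
  have "(\<Sum>A | A \<in> confs N \<and> E (gaps A). w (nren A) * renewal_prob K A) =
        (\<Sum>A | A \<in> confs N \<and> E (gaps A). w (length (gaps A)) * prod_list (map K (gaps A)))"
    using fin by (intro sum.cong) (auto simp: nren_eq_length_gaps renewal_prob_def)
  also have "\<dots> = (\<Sum>xs | xs \<in> compositions N \<and> E xs. w (length xs) * prod_list (map K xs))"
    by (rule sum.reindex_bij_betw[OF bij])
  also have "\<dots> = (\<Sum>m=1..N. \<Sum>xs\<in>?S m. w (length xs) * prod_list (map K xs))"
    unfolding eq
  proof (rule sum.UNION_disjoint)
    show "\<forall>i\<in>{1..N}. finite (?S i)" by (auto intro: finite_subset[OF _ finite_seqs])
  qed (auto simp: seqs_def)
  also have "\<dots> = (\<Sum>m=1..N. w m * mass K m N (\<lambda>xs. sum_list xs = N \<and> E xs))"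
    unfolding mass_def sum_distrib_left by (intro sum.cong) (auto simp: seqs_def)
  finally show ?thesis .
qed

lemma Zpin_eq:
  assumes "N \<ge> 1"
  shows "Zpin K Q H N h = (\<Sum>m=1..N. exp (h * real m) * Psi Q H m N * mass K m N (\<lambda>xs. sum_list xs = N))"
  using sum_confs_eq[OF assms, where E = "\<lambda>_. True" and w = "\<lambda>m. exp (h * real m) * Psi Q H m N" and K = K]
  by (simp add: Zpin_def pin_weight_def)

lemma Ppin_eq:
  assumes "N \<ge> 1" "\<And>A. A \<in> confs N \<Longrightarrow> A \<in> E \<longleftrightarrow> F (gaps A)"
  shows "Ppin K Q H N h E = (\<Sum>m=1..N. exp (h * real m) * Psi Q H m N *
            mass K m N (\<lambda>xs. sum_list xs = N \<and> F xs)) / Zpin K Q H N h"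
proof -
  have "confs N \<inter> E = {A. A \<in> confs N \<and> F (gaps A)}" using assms by auto
  thus ?thesis
    using sum_confs_eq[OF assms(1), where E = F and w = "\<lambda>m. exp (h * real m) * Psi Q H m N" and K = K]
    by (simp add: Ppin_def pin_weight_def)
qed

lemma card_interior_eq:
  assumes "N \<ge> 1" "A \<in> confs N"
  shows "card (A \<inter> {0<..<N}) = length (gaps A) - 1"
proof -
  have fin: "finite A" using assms finite_subset by (auto simp: confs_def)
  have "A \<inter> {0<..<N} = A - {0, N}" using assms by (auto simp: confs_def)
  moreover have "card (A - {0, N}) = card A - 2"
    using assms fin by (subst card_Diff_subset) (auto simp: confs_def)
  ultimately show ?thesis using nren_eq_length_gaps[OF fin] by (simp add: nren_def)
qed

definition largest :: "nat list \<Rightarrow> nat" where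
  "largest xs = (let ds = rev (sort xs) in if ds = [] then 0 else ds ! 0)"

definition second_largest :: "nat list \<Rightarrow> nat" where
  "second_largest xs = (let ds = rev (sort xs) in if length ds < 2 then 0 else ds ! 1)"

lemma eta1_eq: "eta1 A = largest (gaps A)"
  and eta2_eq: "eta2 A = second_largest (gaps A)"
  by (simp_all add: eta1_def eta2_def largest_def second_largest_def)

lemma sort_eq_Nil_iff: "sort xs = [] \<longleftrightarrow> xs = []"
  by (metis length_0_conv length_sort)

lemma largest_in_set:
  assumes "xs \<noteq> []" shows "largest xs \<in> set xs"
proof -
  have "rev (sort xs) ! 0 \<in> set (rev (sort xs))" using assms by (intro nth_mem) simp
  thus ?thesis using assms by (simp add: largest_def Let_def sort_eq_Nil_iff)
qed

lemma second_largest_le_largest: "second_largest xs \<le> largest xs"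
proof (cases "length xs < 2")
  case False
  have "sorted (sort xs)" by simp
  hence "rev (sort xs) ! 1 \<le> rev (sort xs) ! 0" using False
    by (intro sorted_rev_nth_mono) auto
  moreover have "xs \<noteq> []" using False by auto
  ultimately show ?thesis using False by (auto simp: largest_def second_largest_def Let_def sort_eq_Nil_iff)
qed (simp add: second_largest_def)

lemma sort_dominating:
  assumes "\<forall>y\<in>set (us @ vs). y \<le> x"
  shows "sort (us @ x # vs) = sort (us @ vs) @ [x :: nat]"
  using assms by (intro properties_for_sort) (auto simp: sorted_append)

lemma one_jump_order_stats:
  assumes "i < length xs" "\<forall>y\<in>set (take i xs @ drop (Suc i) xs). y \<le> xs ! i \<and> real y \<le> \<epsilon>" "\<epsilon> \<ge> 0"
  shows "largest xs = xs ! i" "real (second_largest xs) \<le> \<epsilon>"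
proof -
  define r where "r = take i xs @ drop (Suc i) xs"
  have s: "sort xs = sort r @ [xs ! i]"
    unfolding r_def using sort_dominating[of "take i xs" "drop (Suc i) xs" "xs ! i"] assms id_take_nth_drop[OF assms(1)] by simp
  thus "largest xs = xs ! i" by (auto simp: largest_def Let_def)
  show "real (second_largest xs) \<le> \<epsilon>"
  proof (cases "r = []")
    case False
    have "rev (sort r) ! 0 \<in> set (rev (sort r))" using False by (intro nth_mem) simp
    hence "rev (sort r) ! 0 \<in> set r" by simp
    hence "real (rev (sort r) ! 0) \<le> \<epsilon>" using assms(2) unfolding r_def by blast
    thus ?thesis using False assms(3) by (simp add: second_largest_def Let_def s)
  qed (use assms in \<open>auto simp: second_largest_def Let_def s\<close>)
qed

section \<open>Large deviations\<close>

definition laplace :: "(nat \<Rightarrow> real) \<Rightarrow> real \<Rightarrow> real" where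
  "laplace K l = (\<Sum>n. K n * exp (- l * real n))"

definition log_laplace :: "(nat \<Rightarrow> real) \<Rightarrow> real \<Rightarrow> real" where
  "log_laplace K l = ln (laplace K l)"

definition tilt :: "(nat \<Rightarrow> real) \<Rightarrow> real \<Rightarrow> nat \<Rightarrow> real" where
  "tilt K l n = K n * exp (- l * real n) / laplace K l"

text \<open>The exponential rate of \<open>P(\<tau>\<^sub>m = N)\<close> at \<open>m = x N\<close>; it is nonpositive.\<close>
definition rate :: "(nat \<Rightarrow> real) \<Rightarrow> real \<Rightarrow> real" where
  "rate K x = (INF l\<in>{0..}. l + x * log_laplace K l)"

context power_law_kernel
begin

lemma K_summable: "summable K" and K_suminf: "suminf K = 1"
  using Ksum by (auto simp: sums_iff)

lemma K1: "K 1 > 0" "K 1 \<le> 1"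
  using Kpos[of 1] sum_le_suminf[OF K_summable, of "{1}"] K_nonneg K_suminf by auto

lemma laplace_term_le: "l \<ge> 0 \<Longrightarrow> norm (K n * exp (- l * real n)) \<le> K n"
  using K_nonneg[of n] by (simp add: mult_left_le)

lemma laplace_summable: "l \<ge> 0 \<Longrightarrow> summable (\<lambda>n. K n * exp (- l * real n))"
  by (rule summable_comparison_test'[OF K_summable laplace_term_le])

lemma laplace_ge: "l \<ge> 0 \<Longrightarrow> laplace K l \<ge> K 1 * exp (- l)"
  unfolding laplace_def
  using sum_le_suminf[OF laplace_summable, of l "{1}"] K_nonneg by simp

lemma laplace_pos: "l \<ge> 0 \<Longrightarrow> laplace K l > 0"
  using laplace_ge[of l] K1 by (meson exp_gt_zero less_le_trans mult_pos_pos)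

lemma laplace_antimono: "0 \<le> l \<Longrightarrow> l \<le> l' \<Longrightarrow> laplace K l' \<le> laplace K l"
  unfolding laplace_def
  by (intro suminf_le laplace_summable mult_left_mono K_nonneg) (auto intro: mult_right_mono)

lemma laplace_0: "laplace K 0 = 1"
  by (simp add: laplace_def K_suminf)

lemma exp_log_laplace: "l \<ge> 0 \<Longrightarrow> exp (log_laplace K l) = laplace K l"
  using laplace_pos by (simp add: log_laplace_def)

lemma log_laplace_0: "log_laplace K 0 = 0"
  by (simp add: log_laplace_def laplace_0)

lemma log_laplace_antimono: "0 \<le> l \<Longrightarrow> l \<le> l' \<Longrightarrow> log_laplace K l' \<le> log_laplace K l"
  unfolding log_laplace_def using laplace_antimono laplace_pos by (subst ln_le_cancel_iff) auto

lemma log_laplace_nonpos: "l \<ge> 0 \<Longrightarrow> log_laplace K l \<le> 0"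
  using log_laplace_antimono[of 0 l] log_laplace_0 by simp

lemma log_laplace_ge: "l \<ge> 0 \<Longrightarrow> log_laplace K l \<ge> ln (K 1) - l"
proof -
  assume l: "l \<ge> 0"
  have "ln (K 1 * exp (- l)) \<le> log_laplace K l"
    unfolding log_laplace_def using laplace_ge[OF l] laplace_pos[OF l] K1 by (subst ln_le_cancel_iff) auto
  thus ?thesis using K1 by (simp add: ln_mult)
qed

lemma continuous_on_log_laplace: "continuous_on {0..} (log_laplace K)"
proof -
  have "uniform_limit {0..} (\<lambda>n l. \<Sum>i<n. K i * exp (- l * real i)) (laplace K) sequentially"
    unfolding laplace_def[abs_def] by (rule Weierstrass_m_test[OF laplace_term_le K_summable]) auto
  hence "continuous_on {0..} (laplace K)"
    by (rule uniform_limit_theorem[rotated]) (auto intro!: always_eventually continuous_intros)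
  thus ?thesis unfolding log_laplace_def[abs_def] using laplace_pos
    by (intro continuous_on_ln) (auto simp: less_le)
qed

lemma tilt_nonneg: "l \<ge> 0 \<Longrightarrow> tilt K l n \<ge> 0"
  using laplace_pos[of l] K_nonneg by (simp add: tilt_def)

lemma tilt_sums: "l \<ge> 0 \<Longrightarrow> tilt K l sums 1"
  using sums_divide[OF summable_sums[OF laplace_summable[of l]], of "laplace K l"] laplace_pos[of l]
  by (simp add: tilt_def[abs_def] laplace_def)

lemma log_laplace_deriv:
  assumes "l > 0"
  shows "\<exists>\<mu>. (\<lambda>n. real n * tilt K l n) sums \<mu> \<and> (log_laplace K has_real_derivative - \<mu>) (at l)"
proof -
  define z where "z = exp (- l)"
  have z: "0 < z" "z < 1" using assms by (auto simp: z_def)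
  define D where "D = (\<Sum>n. diffs K n * z ^ n)"
  have sm: "summable (\<lambda>n. K n * y ^ n)" if "norm y < 1" for y :: real
    using powser_inside[of K 1 y] K_summable that by simp
  have ex: "exp (- l * real n) = exp (- l) ^ n" for l n by (simp add: exp_of_nat_mult[symmetric] mult.commute)
  have "((\<lambda>y. \<Sum>n. K n * y ^ n) has_field_derivative D) (at z)"
    unfolding D_def by (rule termdiffs_strong'[OF sm]) (use z in auto)
  hence "((\<lambda>y. \<Sum>n. K n * y ^ n) has_field_derivative D) (at (exp (- l)))" by (simp add: z_def)
  moreover have "((\<lambda>l::real. exp (- l)) has_field_derivative - z) (at l)"
    by (auto intro!: derivative_eq_intros simp: z_def)
  ultimately have "((\<lambda>l. \<Sum>n. K n * exp (- l) ^ n) has_field_derivative D * (- z)) (at l)"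
    by (rule DERIV_chain2[where g = "\<lambda>l. exp (- l)"])
  hence L: "(laplace K has_field_derivative D * (- z)) (at l)"
    unfolding laplace_def[abs_def] ex .
  have pos: "laplace K l > 0" using laplace_pos assms by simp
  have LL: "(log_laplace K has_field_derivative - (D * z / laplace K l)) (at l)"
    unfolding log_laplace_def[abs_def] using L pos by (auto intro!: derivative_eq_intros)
  have "summable (\<lambda>n. diffs K n * z ^ n)"
    by (rule termdiff_converges[OF _ sm]) (use z in auto)
  hence "(\<lambda>n. real n * K n * z ^ (n - Suc 0)) sums D" unfolding D_def by (rule diffs_equiv)
  hence "(\<lambda>n. real n * K n * z ^ (n - Suc 0) * (z / laplace K l)) sums (D * (z / laplace K l))"
    by (rule sums_mult2)
  moreover have "real n * K n * z ^ (n - Suc 0) * (z / laplace K l) = real n * tilt K l n" for n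
    unfolding tilt_def ex z_def[symmetric] by (cases n) auto
  ultimately have "(\<lambda>n. real n * tilt K l n) sums (D * z / laplace K l)" by simp
  thus ?thesis using LL by blast
qed

lemma mean_le_of_log_laplace_ge:
  assumes "\<And>l. l > 0 \<Longrightarrow> log_laplace K l \<ge> - (c * l)"
  shows "summable (\<lambda>n. real n * K n)" "(\<Sum>n. real n * K n) \<le> c"
proof -
  have part: "(\<Sum>n<L. real n * K n) \<le> c" for L
  proof (rule tendsto_upperbound)
    have "((\<lambda>l. (1 - exp (- l * y)) / l) \<longlongrightarrow> y) (at_right 0)" for y :: real
      by real_asymp
    thus "((\<lambda>l. \<Sum>n<L. (1 - exp (- l * real n)) / l * K n) \<longlongrightarrow> (\<Sum>n<L. real n * K n)) (at_right 0)"
      by (intro tendsto_intros) auto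
    show "\<forall>\<^sub>F l in at_right 0. (\<Sum>n<L. (1 - exp (- l * real n)) / l * K n) \<le> c"
      using eventually_at_right_less[of 0]
    proof eventually_elim
      case (elim l)
      have d: "(\<lambda>n. K n - K n * exp (- l * real n)) sums (1 - laplace K l)"
        unfolding laplace_def using elim by (intro sums_diff Ksum summable_sums laplace_summable) auto
      have "1 - c * l \<le> exp (- (c * l))" using exp_ge_add_one_self[of "- (c * l)"] by simp
      also have "\<dots> \<le> exp (log_laplace K l)" using assms[OF elim] by simp
      also have "\<dots> = laplace K l" using elim by (simp add: exp_log_laplace)
      finally have "1 - laplace K l \<le> c * l" by simp
      moreover have "(\<Sum>n<L. K n - K n * exp (- l * real n)) \<le> 1 - laplace K l"
        using sum_le_suminf[OF sums_summable[OF d], of "{..<L}"] d elim K_nonneg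
        by (auto simp: sums_iff mult_left_le)
      ultimately have "(\<Sum>n<L. K n - K n * exp (- l * real n)) / l \<le> c"
        using elim by (simp add: divide_le_eq)
      thus ?case by (simp add: sum_divide_distrib algebra_simps)
    qed
  qed auto
  show s: "summable (\<lambda>n. real n * K n)"
    by (rule bounded_imp_summable[of _ c]) (use part[of "Suc _"] K_nonneg in \<open>auto simp: lessThan_Suc_atMost\<close>)
  show "(\<Sum>n. real n * K n) \<le> c" by (rule suminf_le_const[OF s part])
qed

lemma rate_bdd_below:
  assumes "0 \<le> x" "x \<le> 1" "l \<ge> 0"
  shows "l + x * log_laplace K l \<ge> l * (1 - x) + x * ln (K 1)"
    and "l + x * log_laplace K l \<ge> x * ln (K 1)"
proof -
  have "x * (ln (K 1) - l) \<le> x * log_laplace K l"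
    using assms log_laplace_ge by (intro mult_left_mono) auto
  thus "l + x * log_laplace K l \<ge> l * (1 - x) + x * ln (K 1)" by (simp add: algebra_simps)
  moreover have "l * (1 - x) \<ge> 0" using assms by simp
  ultimately show "l + x * log_laplace K l \<ge> x * ln (K 1)" by linarith
qed

lemma rate_le: "0 \<le> x \<Longrightarrow> x \<le> 1 \<Longrightarrow> l \<ge> 0 \<Longrightarrow> rate K x \<le> l + x * log_laplace K l"
  unfolding rate_def
  by (rule cINF_lower[OF bdd_belowI2[where m = "x * ln (K 1)"]]) (rule rate_bdd_below(2), simp_all)

lemma rate_ge: "(\<And>l. l \<ge> 0 \<Longrightarrow> c \<le> l + x * log_laplace K l) \<Longrightarrow> c \<le> rate K x"
  unfolding rate_def by (rule cINF_greatest) auto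

lemma rate_nonpos: "0 \<le> x \<Longrightarrow> x \<le> 1 \<Longrightarrow> rate K x \<le> 0"
  using rate_le[of x 0] by (simp add: log_laplace_0)

lemma rate_antimono:
  assumes "0 \<le> x" "x \<le> y" "y \<le> 1"
  shows "rate K y \<le> rate K x"
proof (rule rate_ge)
  fix l :: real assume l: "l \<ge> 0"
  have "rate K y \<le> l + y * log_laplace K l" by (rule rate_le) (use assms l in auto)
  also have "\<dots> \<le> l + x * log_laplace K l"
    using assms log_laplace_nonpos[OF l] by (intro add_left_mono mult_right_mono_neg) auto
  finally show "rate K y \<le> l + x * log_laplace K l" .
qed

lemma rate_concave: "concave_on {0..1} (rate K)"
proof (subst concave_on_iff, intro conjI convex_real_interval ballI allI impI)
  fix x y u v :: real
  assume xy: "x \<in> {0..1}" "y \<in> {0..1}" and uv: "0 \<le> u" "0 \<le> v" "u + v = 1"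
  show "u * rate K x + v * rate K y \<le> rate K (u *\<^sub>R x + v *\<^sub>R y)"
  proof (rule rate_ge)
    fix l :: real assume l: "l \<ge> 0"
    have "u * rate K x + v * rate K y \<le> u * (l + x * log_laplace K l) + v * (l + y * log_laplace K l)"
      using xy uv l by (intro add_mono mult_left_mono rate_le) auto
    also have "\<dots> = (u + v) * l + (u * x + v * y) * log_laplace K l" by (simp add: algebra_simps)
    finally show "u * rate K x + v * rate K y \<le> l + (u *\<^sub>R x + v *\<^sub>R y) * log_laplace K l" using uv by simp
  qed
qed

lemma rate_attained:
  assumes "0 < x" "x < 1"
  obtains l where "l \<ge> 0" "rate K x = l + x * log_laplace K l"
proof -
  define R where "R = max 0 (- (x * ln (K 1)) / (1 - x))"
  have "\<exists>l0\<in>{0..R}. \<forall>l\<in>{0..R}. l0 + x * log_laplace K l0 \<le> l + x * log_laplace K l"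
    by (intro continuous_attains_inf continuous_intros continuous_on_subset[OF continuous_on_log_laplace])
       (auto simp: R_def)
  then obtain l0 where l0: "l0 \<ge> 0" "l0 \<le> R" "\<And>l. l \<in> {0..R} \<Longrightarrow> l0 + x * log_laplace K l0 \<le> l + x * log_laplace K l"
    by auto
  have "l0 + x * log_laplace K l0 \<le> rate K x"
  proof (rule rate_ge)
    fix l :: real assume l: "l \<ge> 0"
    show "l0 + x * log_laplace K l0 \<le> l + x * log_laplace K l"
    proof (cases "l \<le> R")
      case False
      have "l0 + x * log_laplace K l0 \<le> 0" using l0(3)[of 0] by (simp add: log_laplace_0 R_def)
      also have "0 \<le> l * (1 - x) + x * ln (K 1)"
      proof -
        have "- (x * ln (K 1)) / (1 - x) \<le> l" using False by (simp add: R_def)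
        hence "- (x * ln (K 1)) \<le> l * (1 - x)" using assms by (subst (asm) pos_divide_le_eq) auto
        thus ?thesis by linarith
      qed
      also have "\<dots> \<le> l + x * log_laplace K l" by (rule rate_bdd_below) (use assms l in auto)
      finally show ?thesis .
    qed (use l0 l in auto)
  qed
  moreover have "rate K x \<le> l0 + x * log_laplace K l0" by (rule rate_le) (use assms l0 in auto)
  ultimately show ?thesis using that l0 by force
qed

lemma log_laplace_near_0:
  assumes "\<epsilon> > 0"
  obtains l where "l > 0" "log_laplace K l \<ge> - \<epsilon>"
proof -
  have "(log_laplace K \<longlongrightarrow> log_laplace K 0) (at 0 within {0..})"
    using continuous_on_log_laplace by (auto simp: continuous_on_def)
  hence "(log_laplace K \<longlongrightarrow> 0) (at_right 0)"
    by (auto simp: log_laplace_0 intro: tendsto_within_subset)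
  hence "eventually (\<lambda>l. log_laplace K l > - \<epsilon>) (at_right 0)"
    using assms by (intro order_tendstoD) auto
  hence "eventually (\<lambda>l. log_laplace K l > - \<epsilon> \<and> l > 0) (at_right 0)"
    by (intro eventually_conj eventually_at_right_less)
  then obtain l where "log_laplace K l > - \<epsilon>" "l > 0"
    using eventually_happens'[OF trivial_limit_at_right_real] by blast
  thus ?thesis using that by force
qed

lemma rate_near_0:
  assumes "\<epsilon> > 0"
  obtains d where "d > 0" "\<And>x. 0 < x \<Longrightarrow> x < d \<Longrightarrow> rate K x \<ge> - \<epsilon> * x"
proof -
  obtain l0 where l0: "l0 > 0" "log_laplace K l0 \<ge> - \<epsilon>" using log_laplace_near_0 assms by blast
  define d where "d = min (1/2) (l0 / (2 * (1 - ln (K 1))))"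
  have k: "1 - ln (K 1) \<ge> 1" using K1 by simp
  have "d > 0" using l0 k by (auto simp: d_def)
  moreover have "rate K x \<ge> - \<epsilon> * x" if x: "0 < x" "x < d" for x
  proof (rule rate_ge)
    fix l :: real assume l: "l \<ge> 0"
    have x1: "x < 1/2" using x by (simp add: d_def)
    show "- \<epsilon> * x \<le> l + x * log_laplace K l"
    proof (cases "l \<le> l0")
      case True
      have "x * (- \<epsilon>) \<le> x * log_laplace K l"
        using log_laplace_antimono[OF l True] l0 x by (intro mult_left_mono) auto
      thus ?thesis using l by (simp add: algebra_simps)
    next
      case False
      have "x \<le> l0 / (2 * (1 - ln (K 1)))" using x by (simp add: d_def)
      hence "x * (1 - ln (K 1)) \<le> l0 / 2" using k by (simp add: field_simps)
      moreover have "l * (1 - x) \<ge> l0 * (1/2)" using False x1 l0 by (intro mult_mono) auto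
      ultimately have "0 \<le> l * (1 - x) + x * ln (K 1)" using x by (simp add: algebra_simps)
      also have "\<dots> \<le> l + x * log_laplace K l" by (rule rate_bdd_below) (use x x1 l in auto)
      finally show ?thesis using assms x by (smt (verit) mult_nonneg_nonneg mult_minus_left)
    qed
  qed
  ultimately show ?thesis using that by blast
qed

lemma minimizer_tilt_mean:
  assumes x: "0 < x" "x \<le> 1" and l: "l > 0" "rate K x = l + x * log_laplace K l"
  shows "(\<lambda>n. real n * tilt K l n) sums (1 / x)"
proof -
  obtain \<mu> where \<mu>: "(\<lambda>n. real n * tilt K l n) sums \<mu>" "(log_laplace K has_real_derivative - \<mu>) (at l)"
    using log_laplace_deriv[OF l(1)] by blast
  have D: "((\<lambda>l. l + x * log_laplace K l) has_real_derivative 1 + x * (- \<mu>)) (at l)"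
    by (intro DERIV_add DERIV_ident DERIV_cmult \<mu>)
  have "1 + x * (- \<mu>) = 0"
    by (rule DERIV_local_min[OF D l(1)])
       (use rate_le[of x] x l in \<open>auto simp: abs_if split: if_splits\<close>)
  hence "\<mu> = 1 / x" using x by (simp add: field_simps)
  thus ?thesis using \<mu> by simp
qed

lemma rate_convex_imp_0:
  assumes uv: "0 \<le> u" "u < v" "v \<le> 1" and conv: "convex_on {u<..<v} (rate K)"
    and x: "x \<in> {u<..<v}"
  shows "rate K x = 0"
proof -
  define z where "z = (u + v) / 2"
  have z: "u < z" "z < v" "0 < z" "z < 1" using uv by (auto simp: z_def)
  obtain l where l: "l \<ge> 0" "rate K z = l + z * log_laplace K l"
    using rate_attained z by blast
  have eq: "rate K y = l + y * log_laplace K l" if y: "y \<in> {u<..<v}" for y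
  proof -
    let ?y' = "2 * z - y"
    have y': "?y' \<in> {u<..<v}" using y unfolding z_def greaterThanLessThan_iff by argo
    have "rate K ((1 - 1/2) *\<^sub>R y + (1/2) *\<^sub>R ?y') \<le> (1 - 1/2) * rate K y + (1/2) * rate K ?y'"
      by (rule convex_onD[OF conv _ _ y y']) auto
    moreover have "(1 - 1/2) *\<^sub>R y + (1/2) *\<^sub>R ?y' = z" by (simp add: field_simps)
    ultimately have "2 * rate K z \<le> rate K y + rate K ?y'" by simp
    moreover have "rate K ?y' \<le> l + ?y' * log_laplace K l" by (rule rate_le) (use y' uv l in auto)
    moreover have "rate K y \<le> l + y * log_laplace K l" by (rule rate_le) (use y uv l in auto)
    ultimately show ?thesis unfolding l(2) by (simp add: algebra_simps)
  qed
  have "l = 0"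
  proof (rule ccontr)
    assume "l \<noteq> 0"
    hence l0: "l > 0" using l by simp
    define y where "y = (z + v) / 2"
    have y: "y \<in> {u<..<v}" "z < y" using z by (auto simp: y_def)
    have 1: "(\<lambda>n. real n * tilt K l n) sums (1 / z)"
      by (rule minimizer_tilt_mean[OF _ _ l0 l(2)]) (use z in auto)
    have 2: "(\<lambda>n. real n * tilt K l n) sums (1 / y)"
      by (rule minimizer_tilt_mean[OF _ _ l0 eq[OF y(1)]]) (use y uv in auto)
    have "1 / z = 1 / y" by (rule sums_unique2[OF 1 2])
    thus False using y z by simp
  qed
  thus ?thesis using eq[OF x] by (simp add: log_laplace_0)
qed

lemma exists_strict_tilt:
  assumes x: "0 < x" "x \<le> 1" and \<epsilon>: "\<epsilon> > 0"
    and sup: "\<And>\<mu>. (\<lambda>n. real n * K n) sums \<mu> \<Longrightarrow> x * \<mu> \<ge> 1"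
  obtains l where "l > 0" "l * (1 - \<epsilon>) + x * log_laplace K l < rate K x"
proof (rule ccontr)
  assume "\<not> thesis"
  hence no: "l * (1 - \<epsilon>) + x * log_laplace K l \<ge> rate K x" if "l > 0" for l
    using that \<open>(\<And>l. 0 < l \<Longrightarrow> l * (1 - \<epsilon>) + x * log_laplace K l < rate K x \<Longrightarrow> thesis)\<close> by force
  have r: "rate K x \<ge> x * log_laplace K l0" if l0: "l0 > 0" for l0
  proof (rule ccontr)
    assume neg: "\<not> rate K x \<ge> x * log_laplace K l0"
    define c where "c = min (x * log_laplace K l0) (rate K x + \<epsilon> * l0)"
    have "c \<le> rate K x"
    proof (rule rate_ge)
      fix l :: real assume l: "l \<ge> 0"
      show "c \<le> l + x * log_laplace K l"
      proof (cases "l \<le> l0")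
        case True
        have "x * log_laplace K l0 \<le> x * log_laplace K l"
          using log_laplace_antimono[OF l True] x by (intro mult_left_mono) auto
        thus ?thesis using l by (simp add: c_def)
      next
        case False
        have "\<epsilon> * l0 \<le> \<epsilon> * l" using False \<epsilon> by (intro mult_left_mono) auto
        hence "rate K x + \<epsilon> * l0 \<le> l + x * log_laplace K l"
          using no[of l] False l0 by (simp add: algebra_simps)
        thus ?thesis by (simp add: c_def)
      qed
    qed
    thus False using neg mult_pos_pos[OF \<epsilon> l0] by (auto simp: c_def min_le_iff_disj)
  qed
  have "rate K x \<ge> 0"
  proof (rule field_le_epsilon)
    fix e :: real assume "e > 0"
    then obtain l where l: "l > 0" "log_laplace K l \<ge> - e" using log_laplace_near_0 by blast
    have "- e \<le> x * (- e)" using x \<open>e > 0\<close> by (simp add: mult_le_cancel_right1)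
    also have "\<dots> \<le> x * log_laplace K l" using l x by (intro mult_left_mono) auto
    also have "\<dots> \<le> rate K x" by (rule r[OF l(1)])
    finally show "0 \<le> rate K x + e" by simp
  qed
  hence "log_laplace K l \<ge> - ((1 - \<epsilon>) / x * l)" if "l > 0" for l
    using no[OF that] x by (simp add: field_simps)
  from mean_le_of_log_laplace_ge[OF this]
  have "(\<lambda>n. real n * K n) sums (\<Sum>n. real n * K n)" "(\<Sum>n. real n * K n) \<le> (1 - \<epsilon>) / x"
    by (auto intro: summable_sums)
  with sup[OF this(1)] show False using x \<epsilon> by (simp add: field_simps)
qed

lemma mass_le_log_laplace:
  assumes "l \<ge> 0"
  shows "mass K m N (\<lambda>xs. sum_list xs = S) \<le> exp (l * real S + real m * log_laplace K l)"
proof -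
  have "mass K m N (\<lambda>xs. sum_list xs = S) \<le>
        exp (l * real S) * (\<Sum>n=1..N. K n * exp (- l * real n)) ^ m"
  proof (rule mass_Chernoff[OF K_nonneg])
    fix xs assume "sum_list xs = S"
    moreover have "prod_list (map (\<lambda>n. exp (- l * real n)) xs) = exp (- l * real (sum_list xs))"
      by (rule prod_list_exp)
    ultimately show "1 \<le> exp (l * real S) * prod_list (map (\<lambda>n. exp (- l * real n)) xs)"
      by (simp add: exp_add[symmetric])
  qed auto
  also have "\<dots> \<le> exp (l * real S) * laplace K l ^ m"
    unfolding laplace_def using K_nonneg assms
    by (intro mult_left_mono power_mono sum_le_suminf laplace_summable sum_nonneg) auto
  also have "\<dots> = exp (l * real S + real m * log_laplace K l)"
    using exp_log_laplace[OF assms] by (simp add: exp_add exp_of_nat_mult)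
  finally show ?thesis .
qed

lemma mass_le_rate:
  assumes "1 \<le> m" "m \<le> N"
  shows "pinned_mass m N \<le> exp (real N * rate K (real m / real N))"
proof (cases "pinned_mass m N > 0")
  case True
  have N: "real N > 0" using assms by simp
  have "ln (pinned_mass m N) / real N \<le> rate K (real m / real N)"
  proof (rule rate_ge)
    fix l :: real assume "l \<ge> 0"
    hence "ln (pinned_mass m N) \<le> l * real N + real m * log_laplace K l"
      using mass_le_log_laplace[of l m N N] True by (metis exp_gt_zero ln_exp ln_le_cancel_iff)
    thus "ln (pinned_mass m N) / real N \<le> l + real m / real N * log_laplace K l"
      using N by (simp add: field_simps)
  qed
  hence "ln (pinned_mass m N) \<le> real N * rate K (real m / real N)"
    using N by (simp add: field_simps)
  thus ?thesis using True by (metis exp_le_cancel_iff exp_ln)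
next
  case False
  thus ?thesis by (meson exp_ge_zero not_less order_trans)
qed

lemma minimizing_tilt:
  assumes x: "0 < x" "x < 1"
  obtains l \<mu> where "l \<ge> 0" "rate K x = l + x * log_laplace K l"
    "finite_mean_law (tilt K l) \<mu>" "\<mu> \<le> 1 / x" "l * \<mu> = l / x"
proof -
  obtain l where l: "l \<ge> 0" "rate K x = l + x * log_laplace K l" using rate_attained x by blast
  have law: "finite_mean_law (tilt K l) \<mu>" if "(\<lambda>n. real n * tilt K l n) sums \<mu>" for \<mu>
    by unfold_locales (use that l in \<open>auto simp: tilt_nonneg tilt_sums\<close>, simp add: tilt_def K0)
  show ?thesis
  proof (cases "l = 0")
    case True
    have t0: "tilt K 0 = K" by (auto simp: tilt_def laplace_0)
    have "log_laplace K l' \<ge> - (1 / x * l')" if "l' > 0" for l'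
    proof -
      have "0 \<le> l' + x * log_laplace K l'" using rate_le[of x l'] l True x that by (simp add: log_laplace_0)
      thus ?thesis using x by (simp add: field_simps)
    qed
    from mean_le_of_log_laplace_ge[OF this]
    have "(\<lambda>n. real n * K n) sums (\<Sum>n. real n * K n)" "(\<Sum>n. real n * K n) \<le> 1 / x"
      by (auto intro: summable_sums)
    thus ?thesis using that[OF l law] True t0 by auto
  next
    case False
    hence "(\<lambda>n. real n * tilt K l n) sums (1 / x)"
      using minimizer_tilt_mean[of x l] x l by auto
    thus ?thesis using that[OF l law] by auto
  qed
qed

lemma prod_list_tilt:
  assumes "l \<ge> 0"
  shows "prod_list (map K xs) =
         exp (l * real (sum_list xs) + real (length xs) * log_laplace K l) * prod_list (map (tilt K l) xs)"
proof (induction xs)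
  case (Cons y xs)
  have "K y = exp (l * real y + log_laplace K l) * tilt K l y"
    using laplace_pos[OF assms] by (simp add: tilt_def exp_add exp_log_laplace[OF assms] exp_minus field_simps)
  thus ?case using Cons by (simp add: algebra_simps exp_add)
qed simp

text \<open>Tilting makes \<open>\<tau>\<^sub>m\<close> typically slightly smaller than \<open>N\<close>; one further gap, whose cost is only
  polynomial because \<open>K\<close> has a power tail, then reaches \<open>N\<close> exactly.\<close>
lemma mass_ge_rate:
  assumes x: "0 < x" "x < 1" and \<delta>: "\<delta> > 0"
  shows "eventually (\<lambda>N. \<exists>m. 1 \<le> m \<and> m \<le> N \<and> \<bar>real m / real N - x\<bar> \<le> \<delta> \<and>
           pinned_mass m N \<ge> exp (real N * (rate K x - \<delta>))) sequentially"
proof -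
  obtain l \<mu> where l: "l \<ge> 0" "rate K x = l + x * log_laplace K l"
    and law: "finite_mean_law (tilt K l) \<mu>" and \<mu>: "\<mu> \<le> 1 / x" "l * \<mu> = l / x"
    using minimizing_tilt[OF x] by blast
  interpret L: finite_mean_law "tilt K l" \<mu> by (rule law)
  obtain c where c: "c > 0" "\<And>n N. 1 \<le> n \<Longrightarrow> n \<le> N \<Longrightarrow> K n \<ge> c * real N powr (- (1 + \<alpha>))"
    using K_lower_uniform by blast
  define d where "d = min (1/2) (min \<delta> (\<delta> / (l + 1)))"
  have d: "d > 0" "d \<le> 1/2" "d \<le> \<delta>" "l * d \<le> \<delta>"
  proof -
    show "d > 0" using \<delta> l by (auto simp: d_def)
    show "d \<le> 1/2" unfolding d_def by (rule min.cobounded1)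
    show "d \<le> \<delta>" unfolding d_def by (meson min.cobounded1 min.cobounded2 order_trans)
    have "l * d \<le> (l + 1) * (\<delta> / (l + 1))" using l \<open>d > 0\<close> by (intro mult_mono) (auto simp: d_def)
    thus "l * d \<le> \<delta>" using l by simp
  qed
  have "eventually (\<lambda>N. \<forall>m\<le>N. mass (tilt K l) m N (\<lambda>xs. \<bar>real (sum_list xs) - real m * \<mu>\<bar> \<le> d/2 * real N) \<ge> 1 - 1/2) sequentially"
    by (rule L.weak_law_mass_ge) (use d in auto)
  moreover have "eventually (\<lambda>N::nat. 1 / real N \<le> d / 2) sequentially"
    using d by real_asymp
  moreover have "eventually (\<lambda>N::nat. c * real N powr (- (1 + \<alpha>)) * exp (- (l / x)) * (1/2) \<ge> exp (- (\<delta> / 2) * real N)) sequentially"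
    using c \<delta> alpha by real_asymp
  moreover have "eventually (\<lambda>N::nat. real N * (1 - x) \<ge> 1) sequentially"
    using x by real_asymp
  ultimately show ?thesis using eventually_gt_at_top[of 0]
  proof eventually_elim
    case (elim N)
    have N: "real N > 0" using elim by simp
    define k where "k = nat \<lfloor>x * (1 - d) * real N\<rfloor>"
    have k: "real k \<le> x * (1 - d) * real N" "real k > x * (1 - d) * real N - 1"
    proof -
      have "0 \<le> x * (1 - d) * real N" using x d by auto
      thus "real k \<le> x * (1 - d) * real N" "real k > x * (1 - d) * real N - 1"
        unfolding k_def by (simp_all add: of_nat_floor)
    qed
    have xN: "x * (1 - d) * real N \<le> x * real N" using x d N by (intro mult_right_mono) (auto simp: algebra_simps)
    have kN: "k \<le> N" "Suc k \<le> N"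
    proof -
      have "real k + 1 \<le> real N" using k xN elim(4) by (simp add: algebra_simps)
      thus "k \<le> N" "Suc k \<le> N" by linarith+
    qed
    have near: "\<bar>real (Suc k) / real N - x\<bar> \<le> \<delta>"
    proof -
      have "real (Suc k) \<le> x * real N + 1" "real (Suc k) \<ge> x * real N - d * (x * real N)"
        using k xN by (auto simp: algebra_simps)
      moreover have "d * (x * real N) \<le> d * (1 * real N)" using x d by (intro mult_left_mono mult_right_mono) auto
      moreover have "1 \<le> d / 2 * real N" using elim(2) N by (simp add: field_simps)
      moreover have "d / 2 * real N \<le> \<delta> * real N" using d N by (intro mult_right_mono) auto
      moreover have "d * real N \<le> \<delta> * real N" using d N by (intro mult_right_mono) auto
      ultimately have "real (Suc k) - x * real N \<le> \<delta> * real N" "real (Suc k) - x * real N \<ge> - \<delta> * real N"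
        by linarith+
      thus ?thesis using N by (simp add: abs_le_iff field_simps)
    qed
    let ?W = "\<lambda>xs. \<bar>real (sum_list xs) - real k * \<mu>\<bar> \<le> d/2 * real N"
    define e where "e = exp (real N * (rate K x - l * d / 2) - l / x)"
    have mu0: "\<mu> \<ge> 0" by (rule L.mean_nonneg)
    have sum_lt: "sum_list xs < N" if "?W xs" for xs
    proof -
      have "real k * \<mu> \<le> (x * (1 - d) * real N) * (1 / x)" using k \<mu> mu0 x d by (intro mult_mono) auto
      also have "\<dots> = (1 - d) * real N" using x by simp
      finally have "real (sum_list xs) \<le> (1 - d) * real N + d / 2 * real N" using that by linarith
      also have "\<dots> = real N - d / 2 * real N" by (simp add: algebra_simps)
      also have "\<dots> < real N" using d N by simp
      finally show ?thesis by simp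
    qed
    have "e * (1/2) \<le> e * mass (tilt K l) k N ?W"
      using elim(1) kN by (intro mult_left_mono) (auto simp: e_def)
    also have "\<dots> \<le> mass K k N ?W"
      unfolding mass_def sum_distrib_left
    proof (intro sum_mono)
      fix xs assume "xs \<in> {xs. xs \<in> seqs k N \<and> ?W xs}"
      hence W: "?W xs" and len: "length xs = k" by (auto simp: seqs_def)
      have "l * (real k * \<mu> - d/2 * real N) \<le> l * real (sum_list xs)"
        using W l by (intro mult_left_mono) linarith+
      moreover have "l * (real k * \<mu>) = real k * (l / x)" using \<mu>(2) by (metis mult.left_commute)
      moreover have "real k * (l / x) \<ge> (x * (1 - d) * real N - 1) * (l / x)"
        using k l x by (intro mult_right_mono) auto
      moreover have "(x * (1 - d) * real N - 1) * (l / x) = l * (1 - d) * real N - l / x"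
        using x by (simp add: field_simps)
      moreover have "real k * log_laplace K l \<ge> (x * (1 - d) * real N) * log_laplace K l"
        using k log_laplace_nonpos[OF l(1)] by (intro mult_right_mono_neg) auto
      moreover have "real N * rate K x \<le> (1 - d) * real N * rate K x"
        using rate_nonpos[of x] x d N by (intro mult_right_mono_neg) auto
      moreover have "(1 - d) * real N * rate K x = l * (1 - d) * real N + (x * (1 - d) * real N) * log_laplace K l"
        unfolding l(2) by (simp add: algebra_simps)
      ultimately have "real N * (rate K x - l * d / 2) - l / x \<le> l * real (sum_list xs) + real k * log_laplace K l"
        by (simp add: algebra_simps)
      hence "e \<le> exp (l * real (sum_list xs) + real k * log_laplace K l)" by (simp add: e_def)
      thus "e * prod_list (map (tilt K l) xs) \<le> prod_list (map K xs)"
        unfolding prod_list_tilt[OF l(1), of xs] len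
        by (intro mult_right_mono prod_list_map_nonneg tilt_nonneg l)
    qed
    also have "\<dots> \<le> mass K k N (\<lambda>xs. sum_list xs \<in> (\<lambda>n. N - n) ` {1..N} \<and> True)"
    proof (intro mass_mono K_nonneg)
      fix xs assume "?W xs"
      hence "sum_list xs < N" by (rule sum_lt)
      thus "sum_list xs \<in> (\<lambda>n. N - n) ` {1..N} \<and> True"
        by (auto intro!: image_eqI[of _ _ "N - sum_list xs"])
    qed
    also have "\<dots> = (\<Sum>n=1..N. mass K k N (\<lambda>xs. sum_list xs = N - n \<and> True))"
      by (rule mass_sum_values[symmetric, OF K_nonneg]) (auto simp: inj_on_def)
    finally have half: "e * (1/2) \<le> (\<Sum>n=1..N. mass K k N (\<lambda>xs. sum_list xs = N - n))" by simp
    have "exp (real N * (rate K x - \<delta>)) \<le> exp (- (\<delta> / 2) * real N) * exp (real N * (rate K x - l * d / 2))"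
    proof -
      have "real N * (l * d) \<le> real N * \<delta>" using d N by (intro mult_left_mono) auto
      thus ?thesis by (simp add: exp_add[symmetric] algebra_simps)
    qed
    also have "\<dots> \<le> (c * real N powr (- (1 + \<alpha>)) * exp (- (l / x)) * (1/2)) * exp (real N * (rate K x - l * d / 2))"
      using elim(3) by (intro mult_right_mono) auto
    also have "\<dots> = c * real N powr (- (1 + \<alpha>)) * (e * (1/2))"
    proof -
      have "e = exp (real N * (rate K x - l * d / 2)) * exp (- (l / x))"
        by (simp add: e_def exp_add[symmetric])
      thus ?thesis by simp
    qed
    also have "\<dots> \<le> c * real N powr (- (1 + \<alpha>)) * (\<Sum>n=1..N. mass K k N (\<lambda>xs. sum_list xs = N - n))"
      using half c by (intro mult_left_mono) auto
    also have "\<dots> \<le> (\<Sum>n=1..N. K n * mass K k N (\<lambda>xs. sum_list xs = N - n))"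
      unfolding sum_distrib_left
      by (intro sum_mono mult_right_mono c(2) mass_nonneg K_nonneg) auto
    also have "\<dots> = mass K (Suc k) N (\<lambda>xs. sum_list xs = N)"
      by (rule mass_last_entry[symmetric, OF K_nonneg])
    finally show ?case using near kN by (intro exI[of _ "Suc k"]) auto
  qed
qed

end

section \<open>Real-analytic and concave functions\<close>

lemma real_analytic_differentiable:
  assumes "real_analytic_on S f" "x \<in> S"
  shows "f differentiable (at x)"
proof -
  obtain r c where r: "r > 0" and c: "\<And>y. \<bar>y - x\<bar> < r \<Longrightarrow> (\<lambda>n. c n * (y - x) ^ n) sums f y"
    using assms unfolding real_analytic_on_def by meson
  have sm: "summable (\<lambda>n. c n * w ^ n)" if "norm w < r" for w :: real
    using c[of "x + w"] that by (auto simp: sums_iff)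
  have "((\<lambda>w. \<Sum>n. c n * w ^ n) has_field_derivative (\<Sum>n. diffs c n * 0 ^ n)) (at (0::real))"
    by (rule termdiffs_strong'[OF sm]) (use r in auto)
  hence D: "((\<lambda>w. \<Sum>n. c n * w ^ n) has_field_derivative (\<Sum>n. diffs c n * 0 ^ n)) (at (x - x))"
    by simp
  have "((\<lambda>y. y - x) has_field_derivative 1) (at x)"
    by (auto intro!: derivative_eq_intros)
  from DERIV_chain2[OF D this]
  have D2: "((\<lambda>y. \<Sum>n. c n * (y - x) ^ n) has_field_derivative (\<Sum>n. diffs c n * 0 ^ n)) (at x)"
    by simp
  have "(f has_field_derivative (\<Sum>n. diffs c n * 0 ^ n)) (at x)"
    by (rule has_field_derivative_transform_within_open[OF D2, of "ball x r"])
       (use c r in \<open>auto simp: dist_real_def abs_minus_commute sums_iff\<close>)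
  thus ?thesis by (auto simp: field_differentiable_def real_differentiable_def)
qed

lemma real_analytic_affine_propagates:
  assumes an: "real_analytic_on S f" and "open S" "connected S"
    and uv: "u < v" "{u<..<v} \<subseteq> S" and eq: "\<And>x. x \<in> {u<..<v} \<Longrightarrow> f x = a + b * x"
    and "x \<in> S"
  shows "f x = a + b * (x::real)"
proof -
  define T where "T = {x\<in>S. \<exists>e>0. \<forall>y. \<bar>y - x\<bar> < e \<longrightarrow> f y = a + b * y}"
  have "open T"
  proof (subst open_dist, intro ballI)
    fix x assume "x \<in> T"
    then obtain e where e: "e > 0" "\<And>y. \<bar>y - x\<bar> < e \<Longrightarrow> f y = a + b * y" and "x \<in> S" by (auto simp: T_def)
    obtain d where d: "d > 0" "\<And>y. dist y x < d \<Longrightarrow> y \<in> S" using \<open>open S\<close> \<open>x \<in> S\<close> by (auto simp: open_dist)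
    show "\<exists>e>0. \<forall>y. dist y x < e \<longrightarrow> y \<in> T"
    proof (intro exI[of _ "min d (e / 2)"] conjI allI impI)
      fix y assume y: "dist y x < min d (e / 2)"
      have "f z = a + b * z" if "\<bar>z - y\<bar> < e / 2" for z
      proof (rule e(2))
        have "\<bar>y - x\<bar> < e / 2" using y by (simp add: dist_real_def)
        thus "\<bar>z - x\<bar> < e" using that by linarith
      qed
      thus "y \<in> T" using y d e unfolding T_def by (auto intro!: exI[of _ "e / 2"])
    qed (use d e in auto)
  qed
  moreover have "open (S - T)"
  proof (subst open_dist, intro ballI)
    fix x assume x: "x \<in> S - T"
    obtain d where d: "d > 0" "\<And>y. dist y x < d \<Longrightarrow> y \<in> S" using \<open>open S\<close> x by (auto simp: open_dist)
    obtain r c where r: "r > 0" and c: "\<And>y. \<bar>y - x\<bar> < r \<Longrightarrow> (\<lambda>n. c n * (y - x) ^ n) sums f y"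
      using an x unfolding real_analytic_on_def by (meson DiffD1)
    define g where "g = (\<lambda>y. f y - (a + b * y))"
    define c' where "c' = (\<lambda>n. c n - (if n = 0 then a + b * x else if n = 1 then b else 0))"
    have g: "(\<lambda>n. c' n * (y - x) ^ n) sums g y" if "\<bar>y - x\<bar> < r" for y
    proof -
      have "(\<lambda>n. (if n = 0 then a + b * x else if n = 1 then b else 0) * (y - x) ^ n) sums
            (\<Sum>n\<in>{0, 1::nat}. (if n = 0 then a + b * x else if n = 1 then b else 0) * (y - x) ^ n)"
        by (rule sums_finite) auto
      hence "(\<lambda>n. (if n = 0 then a + b * x else if n = 1 then b else 0) * (y - x) ^ n) sums (a + b * y)"
        by (simp add: algebra_simps)
      from sums_diff[OF c[OF that] this] show ?thesis
        unfolding g_def c'_def by (simp only: left_diff_distrib)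
    qed
    have "\<exists>s>0. \<forall>y. \<bar>y - x\<bar> < s \<longrightarrow> y \<noteq> x \<longrightarrow> g y \<noteq> 0"
    proof (cases "g x = 0")
      case True
      have "\<exists>m>0. c' m \<noteq> 0"
      proof (rule ccontr)
        assume no: "\<not> (\<exists>m>0. c' m \<noteq> 0)"
        have "c' 0 = 0"
        proof -
          have "(\<lambda>n. c' n * 0 ^ n) sums g x" using g[of x] r by simp
          from sums_unique2[OF this powser_sums_zero[of c']] True show ?thesis by simp
        qed
        with no have z: "c' m = 0" for m by (metis gr0I)
        have "g y = 0" if "\<bar>y - x\<bar> < r" for y
        proof -
          have "(\<lambda>n. 0) sums g y" using g[OF that] z by simp
          thus ?thesis by (simp add: sums_iff)
        qed
        hence "x \<in> T" using r x unfolding T_def g_def by auto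
        thus False using x by simp
      qed
      then obtain m where "m > 0" "c' m \<noteq> 0" by blast
      then obtain s where s: "0 < s" "\<And>z. z \<in> cball x s - {x} \<Longrightarrow> g z \<noteq> 0"
        using powser_0_nonzero[of r x c' g m] r g True by (metis real_norm_def)
      thus ?thesis by (intro exI[of _ s]) (auto simp: dist_real_def abs_minus_commute)
    next
      case False
      have "isCont f x" using real_analytic_differentiable[OF an] x
        by (auto intro: differentiable_imp_continuous_within)
      hence "isCont g x" unfolding g_def by (intro continuous_intros)
      then obtain s where "s > 0" "\<forall>y. dist x y < s \<longrightarrow> g y \<noteq> 0"
        using continuous_at_avoid[of x g 0] False by auto
      thus ?thesis by (intro exI[of _ s]) (auto simp: dist_real_def abs_minus_commute)
    qed
    then obtain s where s: "s > 0" "\<And>y. \<bar>y - x\<bar> < s \<Longrightarrow> y \<noteq> x \<Longrightarrow> g y \<noteq> 0" by blast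
    show "\<exists>e>0. \<forall>y. dist y x < e \<longrightarrow> y \<in> S - T"
    proof (intro exI[of _ "min d s"] conjI allI impI)
      fix y assume y: "dist y x < min d s"
      have "y \<notin> T" if "y \<noteq> x"
      proof
        assume "y \<in> T"
        then obtain e where "e > 0" "\<forall>z. \<bar>z - y\<bar> < e \<longrightarrow> f z = a + b * z" by (auto simp: T_def)
        hence "g y = 0" by (auto simp: g_def)
        thus False using s(2)[of y] y that by (auto simp: dist_real_def)
      qed
      thus "y \<in> S - T" using x d(2)[of y] y by (cases "y = x") auto
    qed (use d s in auto)
  qed
  moreover have "(u + v) / 2 \<in> T"
  proof -
    have "f y = a + b * y" if "\<bar>y - (u + v) / 2\<bar> < (v - u) / 2" for y
      using that by (intro eq) (auto simp: abs_less_iff field_simps)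
    moreover have "(u + v) / 2 \<in> S" using uv by (intro subsetD[OF uv(2)]) auto
    ultimately show ?thesis unfolding T_def using uv(1) by (auto intro!: exI[of _ "(v - u) / 2"])
  qed
  ultimately have "S - T = {}"
    using connectedD[OF \<open>connected S\<close> \<open>open T\<close> \<open>open (S - T)\<close>] by (auto simp: T_def)
  hence "x \<in> T" using \<open>x \<in> S\<close> by auto
  thus ?thesis by (auto simp: T_def)
qed

lemma concave_on_min_le:
  fixes f :: "real \<Rightarrow> real"
  assumes conc: "concave_on S f" and ab: "a \<in> S" "b \<in> S" "min a b \<le> x" "x \<le> max a b"
  shows "min (f a) (f b) \<le> f x"
proof -
  have *: "min (f c) (f d) \<le> f x" if cd: "c \<in> S" "d \<in> S" "c \<le> x" "x \<le> d" for c d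
  proof (rule concave_on_ge_min[where x = c and y = d and f = f and a = x])
    have "{c..d} \<subseteq> S"
      using concave_on_imp_convex[OF conc] cd closed_segment_eq_real_ivl[of c d]
      by (auto simp: convex_contains_segment)
    thus "concave_on {c..d} f"
      using conc unfolding concave_on_def by - (rule convex_on_subset[of S], auto)
  qed (use cd in auto)
  show ?thesis
  proof (cases "a \<le> b")
    case True
    thus ?thesis using *[of a b] ab by simp
  next
    case False
    thus ?thesis using *[of b a] ab by (simp add: min.commute)
  qed
qed

lemma concave_separated_max:
  fixes f :: "real \<Rightarrow> real"
  defines "M \<equiv> (SUP x\<in>{0<..<1}. f x)"
  assumes conc: "concave_on {0<..<1} f" and bdd: "bdd_above (f ` {0<..<1})"
    and noflat: "\<And>u v. 0 \<le> u \<Longrightarrow> u < v \<Longrightarrow> v \<le> 1 \<Longrightarrow> \<exists>x\<in>{u<..<v}. f x \<noteq> M"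
  obtains \<rho> where "\<rho> \<in> {0..1}"
    "\<And>\<epsilon>. \<epsilon> > 0 \<Longrightarrow> \<exists>c>0. \<forall>x\<in>{0<..<1}. \<bar>x - \<rho>\<bar> \<ge> \<epsilon> \<longrightarrow> f x \<le> M - c"
proof -
  have le: "f x \<le> M" if "x \<in> {0<..<1}" for x
    unfolding M_def using that bdd by (intro cSUP_upper) auto
  have ex: "\<exists>x\<in>{0<..<1}. f x > M - 1 / real (Suc n)" for n
  proof -
    have "M - 1 / real (Suc n) < M" by simp
    thus ?thesis unfolding M_def by (subst (asm) less_cSUP_iff) (use bdd in auto)
  qed
  then obtain X where X: "\<And>n. X n \<in> {0<..<1}" "\<And>n. f (X n) > M - 1 / real (Suc n)" by metis
  obtain \<rho> r where \<rho>: "\<rho> \<in> {0..1}" and r: "strict_mono r" "(X \<circ> r) \<longlonglongrightarrow> \<rho>"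
    using compact_Icc[of 0 "1::real", unfolded compact_def, rule_format, of X] X(1)
    by (auto simp: less_imp_le)
  have "\<exists>c>0. \<forall>x\<in>{0<..<1}. \<bar>x - \<rho>\<bar> \<ge> \<epsilon> \<longrightarrow> f x \<le> M - c" if \<epsilon>: "\<epsilon> > 0" for \<epsilon>
  proof (rule ccontr)
    assume no: "\<not> ?thesis"
    have "\<exists>x\<in>{0<..<1}. \<bar>x - \<rho>\<bar> \<ge> \<epsilon> \<and> f x > M - 1 / real (Suc n)" for n
      using no by (auto simp: not_le dest!: spec[of _ "1 / real (Suc n)"])
    then obtain Y where Y: "\<And>n. Y n \<in> {0<..<1}" "\<And>n. \<bar>Y n - \<rho>\<bar> \<ge> \<epsilon>" "\<And>n. f (Y n) > M - 1 / real (Suc n)"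
      by metis
    obtain \<sigma> s where \<sigma>: "\<sigma> \<in> {0..1}" and s: "strict_mono s" "(Y \<circ> s) \<longlonglongrightarrow> \<sigma>"
      using compact_Icc[of 0 "1::real", unfolded compact_def, rule_format, of Y] Y(1)
      by (auto simp: less_imp_le)
    have "(\<lambda>n. \<bar>(Y \<circ> s) n - \<rho>\<bar>) \<longlonglongrightarrow> \<bar>\<sigma> - \<rho>\<bar>" by (intro tendsto_intros s)
    hence "\<bar>\<sigma> - \<rho>\<bar> \<ge> \<epsilon>" by (rule LIMSEQ_le_const) (use Y in auto)
    hence ne: "min \<rho> \<sigma> < max \<rho> \<sigma>" using \<epsilon> by (auto simp: min_def max_def)
    have "f x = M" if x: "x \<in> {min \<rho> \<sigma><..<max \<rho> \<sigma>}" for x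
    proof -
      have x01: "x \<in> {0<..<1}" using x \<rho> \<sigma> by (auto simp: min_def max_def split: if_splits)
      have "(\<lambda>n. min ((X \<circ> r) n) ((Y \<circ> s) n)) \<longlonglongrightarrow> min \<rho> \<sigma>" by (intro tendsto_min r s)
      hence "eventually (\<lambda>n. min ((X \<circ> r) n) ((Y \<circ> s) n) < x) sequentially"
        using x by (intro order_tendstoD) auto
      moreover have "(\<lambda>n. max ((X \<circ> r) n) ((Y \<circ> s) n)) \<longlonglongrightarrow> max \<rho> \<sigma>" by (intro tendsto_max r s)
      hence "eventually (\<lambda>n. max ((X \<circ> r) n) ((Y \<circ> s) n) > x) sequentially"
        using x by (intro order_tendstoD) auto
      ultimately have "eventually (\<lambda>n. M - 1 / real (Suc n) \<le> f x) sequentially"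
      proof eventually_elim
        case (elim n)
        have mono: "M - 1 / real (Suc n) \<le> M - 1 / real (Suc k)" if "n \<le> k" for k
          using that by (simp add: frac_le)
        have "M - 1 / real (Suc n) \<le> min (f (X (r n))) (f (Y (s n)))"
          using mono[OF seq_suble[OF r(1)]] mono[OF seq_suble[OF s(1)]] X(2)[of "r n"] Y(3)[of "s n"]
          by simp
        also have "\<dots> \<le> f x" by (rule concave_on_min_le[OF conc X(1) Y(1)]) (use elim in auto)
        finally show ?case .
      qed
      moreover have "(\<lambda>n. M - 1 / real (Suc n)) \<longlonglongrightarrow> M" by real_asymp
      ultimately have "M \<le> f x" by (intro tendsto_upperbound) auto
      thus ?thesis using le[OF x01] by simp
    qed
    thus False using noflat[of "min \<rho> \<sigma>" "max \<rho> \<sigma>"] ne \<rho> \<sigma> by auto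
  qed
  thus ?thesis using that \<rho> by blast
qed

lemma sup_affine_has_derivative:
  fixes f :: "real \<Rightarrow> real"
  defines "F \<equiv> (\<lambda>h. SUP x\<in>{0<..<1}. h * x + f x)"
  assumes bdd: "\<And>h. bdd_above ((\<lambda>x. h * x + f x) ` {0<..<1})"
    and sep: "\<And>\<epsilon>. \<epsilon> > 0 \<Longrightarrow> \<exists>c>0. \<forall>x\<in>{0<..<1}. \<bar>x - \<rho>\<bar> \<ge> \<epsilon> \<longrightarrow> h * x + f x \<le> F h - c"
    and \<rho>: "\<rho> \<in> {0..1}"
  shows "(F has_real_derivative \<rho>) (at h)"
proof -
  have le: "h * x + f x \<le> F h" if "x \<in> {0<..<1}" for x h
    unfolding F_def using that bdd by (intro cSUP_upper) auto
  have near: "\<exists>x\<in>{0<..<1}. h * x + f x > F h - d \<and> \<bar>x - \<rho>\<bar> < d" if d: "d > 0" for d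
  proof -
    obtain c where c: "c > 0" "\<forall>x\<in>{0<..<1}. \<bar>x - \<rho>\<bar> \<ge> d \<longrightarrow> h * x + f x \<le> F h - c"
      using sep[OF d] by blast
    have "F h - min c d < F h" using c d by simp
    then obtain x where x: "x \<in> {0<..<1}" "F h - min c d < h * x + f x"
      using less_cSUP_iff[OF _ bdd, of "F h - min c d" h] by (auto simp: F_def)
    have "\<bar>x - \<rho>\<bar> < d"
    proof (rule ccontr)
      assume "\<not> \<bar>x - \<rho>\<bar> < d"
      hence "h * x + f x \<le> F h - c" using c x by auto
      thus False using x by linarith
    qed
    thus ?thesis using x by (intro bexI[of _ x]) auto
  qed
  have lower: "F (h + t) \<ge> F h + t * \<rho>" for t
  proof (rule field_le_epsilon)
    fix e :: real assume e: "e > 0"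
    define d where "d = e / (1 + \<bar>t\<bar>)"
    have d: "d > 0" using e by (simp add: d_def)
    obtain x where x: "x \<in> {0<..<1}" "h * x + f x > F h - d" "\<bar>x - \<rho>\<bar> < d" using near[OF d] by blast
    have "t * (\<rho> - x) \<le> \<bar>t\<bar> * \<bar>\<rho> - x\<bar>" by (metis abs_ge_self abs_mult)
    also have "\<dots> \<le> \<bar>t\<bar> * d" using x by (intro mult_left_mono) auto
    finally have "t * (\<rho> - x) \<le> \<bar>t\<bar> * d" .
    moreover have "(1 + \<bar>t\<bar>) * d = e" by (simp add: d_def add_nonneg_eq_0_iff)
    moreover have "(h + t) * x + f x \<le> F (h + t)" by (rule le[OF x(1)])
    ultimately show "F h + t * \<rho> \<le> F (h + t) + e" using x(2) by (simp add: algebra_simps)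
  qed
  have "((\<lambda>t. (F (h + t) - F h) / t) \<longlongrightarrow> \<rho>) (at 0)"
  proof (rule tendstoI)
    fix e :: real assume e: "e > 0"
    obtain c where c: "c > 0" "\<forall>x\<in>{0<..<1}. \<bar>x - \<rho>\<bar> \<ge> e / 2 \<longrightarrow> h * x + f x \<le> F h - c"
      using sep[of "e / 2"] e by auto
    have upper: "F (h + t) \<le> F h + t * \<rho> + \<bar>t\<bar> * (e / 2)" if t: "\<bar>t\<bar> < c / 2" for t
    proof -
      have "(SUP x\<in>{0<..<1}. (h + t) * x + f x) \<le> F h + t * \<rho> + \<bar>t\<bar> * (e / 2)"
      proof (rule cSUP_least)
        fix x :: real assume x: "x \<in> {0<..<1}"
        show "(h + t) * x + f x \<le> F h + t * \<rho> + \<bar>t\<bar> * (e / 2)"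
        proof (cases "\<bar>x - \<rho>\<bar> \<ge> e / 2")
          case True
          have "t * (x - \<rho>) \<le> \<bar>t\<bar> * \<bar>x - \<rho>\<bar>" by (metis abs_ge_self abs_mult)
          also have "\<dots> \<le> \<bar>t\<bar> * 1" using x \<rho> by (intro mult_left_mono) auto
          finally have "t * (x - \<rho>) \<le> c" using t c by simp
          moreover have "h * x + f x \<le> F h - c" using c x True by auto
          moreover have "\<bar>t\<bar> * (e / 2) \<ge> 0" using e by simp
          ultimately show ?thesis by (simp add: algebra_simps)
        next
          case False
          have "t * (x - \<rho>) \<le> \<bar>t\<bar> * \<bar>x - \<rho>\<bar>" by (metis abs_ge_self abs_mult)
          also have "\<dots> \<le> \<bar>t\<bar> * (e / 2)" using False by (intro mult_left_mono) auto
          finally show ?thesis using le[OF x, of h] by (simp add: algebra_simps)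
        qed
      qed auto
      thus ?thesis unfolding F_def .
    qed
    have "eventually (\<lambda>t::real. \<bar>t\<bar> < c / 2) (at 0)"
      unfolding eventually_at using c(1) by (intro exI[of _ "c / 2"]) (auto simp: dist_real_def)
    moreover have "eventually (\<lambda>t::real. t \<noteq> 0) (at 0)" by (simp add: eventually_at_filter)
    ultimately show "eventually (\<lambda>t. dist ((F (h + t) - F h) / t) \<rho> < e) (at 0)"
    proof eventually_elim
      case (elim t)
      have "\<bar>F (h + t) - F h - t * \<rho>\<bar> \<le> \<bar>t\<bar> * (e / 2)"
        using upper[OF elim(1)] lower[of t] e by (simp add: abs_le_iff)
      moreover have "(F (h + t) - F h) / t - \<rho> = (F (h + t) - F h - t * \<rho>) / t"
        using elim by (simp add: field_simps)
      ultimately have "\<bar>(F (h + t) - F h) / t - \<rho>\<bar> \<le> e / 2"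
        using elim by (simp add: abs_divide divide_le_eq mult.commute)
      thus ?case using e by (simp add: dist_real_def)
    qed
  qed
  thus ?thesis by (simp add: DERIV_def)
qed

section \<open>Free energy and contact density\<close>

locale pinning_model = power_law_kernel K \<alpha> C_K
  for K :: "nat \<Rightarrow> real" and \<alpha> C_K :: real +
  fixes Q :: "nat \<Rightarrow> nat \<Rightarrow> real" and H :: "real \<Rightarrow> ereal"
  assumes H_fin: "\<forall>x\<in>{0<..<1}. H x \<noteq> \<infinity> \<and> H x \<noteq> - \<infinity>"
    and H_notinf: "\<forall>x\<in>{0..1}. H x \<noteq> \<infinity>"
    and H_cont: "continuous_on {0..1} H"
    and H_concave: "concave_on {0<..<1} (\<lambda>x. real_of_ereal (H x))"
    and H_analytic: "real_analytic_on {0<..<1} (\<lambda>x. real_of_ereal (H x))"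
    and Q_nonneg: "\<forall>m N. 1 \<le> m \<longrightarrow> m \<le> N \<longrightarrow> Q m N \<ge> 0"
    and Q_upper: "\<forall>b>0. \<exists>c. \<forall>m N. 1 \<le> m \<longrightarrow> m \<le> N \<longrightarrow> Q m N \<le> c * exp (b * real N)"
    and Q_lower: "\<forall>u v b. 0 < u \<longrightarrow> u < v \<longrightarrow> v < 1 \<longrightarrow> b > 0 \<longrightarrow>
        (\<exists>c>0. \<forall>m N. 1 \<le> m \<longrightarrow> m \<le> N \<longrightarrow> real m / real N \<in> {u..v} \<longrightarrow>
            Q m N \<ge> c * exp (- b * real N))"
begin

abbreviation weight :: "real \<Rightarrow> nat \<Rightarrow> nat \<Rightarrow> real" where
  "weight h m N \<equiv> exp (h * real m) * Psi Q H m N"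

abbreviation Hr :: "real \<Rightarrow> real" where
  "Hr \<equiv> (\<lambda>x. real_of_ereal (H x))"

definition entropy :: "real \<Rightarrow> real" where
  "entropy x = Hr x + rate K x"

definition F :: "real \<Rightarrow> real" where
  "F h = (SUP x\<in>{0<..<1}. h * x + entropy x)"

lemma Hr_has_derivative: "x \<in> {0<..<1} \<Longrightarrow> (Hr has_real_derivative deriv Hr x) (at x)"
  using real_analytic_differentiable[OF H_analytic]
  by (metis DERIV_imp_deriv real_differentiableE)

lemma Hr_isCont: "x \<in> {0<..<1} \<Longrightarrow> isCont Hr x"
  using Hr_has_derivative DERIV_isCont by blast

lemma Hr_bounded_above: obtains B where "\<And>x. x \<in> {0<..<1} \<Longrightarrow> Hr x \<le> B"
proof -
  obtain x0 where x0: "x0 \<in> {0..1}" "\<And>y. y \<in> {0..1} \<Longrightarrow> H y \<le> H x0"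
    using continuous_attains_sup[of "{0..1::real}" H] H_cont by auto
  have "Hr x \<le> Hr x0" if x: "x \<in> {0<..<1}" for x
  proof -
    have "H x \<le> H x0" using x by (intro x0) auto
    thus ?thesis using H_fin[rule_format, OF x] H_notinf[rule_format, OF x0(1)]
      by (cases "H x"; cases "H x0") auto
  qed
  thus ?thesis using that by blast
qed

lemma entropy_bdd: "bdd_above ((\<lambda>x. h * x + entropy x) ` {0<..<1})"
proof -
  obtain B where B: "\<And>x. x \<in> {0<..<1} \<Longrightarrow> Hr x \<le> B" using Hr_bounded_above by blast
  have "h * x + entropy x \<le> \<bar>h\<bar> + B" if x: "x \<in> {0<..<1}" for x
  proof -
    have "h * x \<le> \<bar>h\<bar> * \<bar>x\<bar>" by (metis abs_ge_self abs_mult)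
    also have "\<dots> \<le> \<bar>h\<bar> * 1" using x by (intro mult_left_mono) auto
    finally show ?thesis using B[OF x] rate_nonpos[of x] x by (simp add: entropy_def)
  qed
  thus ?thesis by (intro bdd_aboveI2[where M = "\<bar>h\<bar> + B"])
qed

lemma le_F: "x \<in> {0<..<1} \<Longrightarrow> h * x + entropy x \<le> F h"
  unfolding F_def by (rule cSUP_upper[OF _ entropy_bdd])

lemma linear_plus_Hr_concave: "concave_on {0<..<1} (\<lambda>x. h * x + Hr x)"
  by (rule concave_on_add[OF _ H_concave]) (auto simp: concave_on_iff algebra_simps)

lemma concave_objective: "concave_on {0<..<1} (\<lambda>x. h * x + entropy x)"
proof -
  have "concave_on {0<..<1} (rate K)"
    using rate_concave unfolding concave_on_def by (rule convex_on_subset) auto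
  from concave_on_add[OF linear_plus_Hr_concave this] show ?thesis
    by (simp add: entropy_def add_ac)
qed

lemma flat_imp_critical:
  assumes uv: "0 \<le> u" "u < v" "v \<le> 1" and flat: "\<And>x. x \<in> {u<..<v} \<Longrightarrow> h * x + entropy x = M"
  shows "ereal h = - Hder0 H"
proof -
  have sub: "{u<..<v} \<subseteq> {0<..<1}" using uv by auto
  have "concave_on {u<..<v} (\<lambda>x. h * x + Hr x)"
    using linear_plus_Hr_concave unfolding concave_on_def by (rule convex_on_subset) (use sub in auto)
  hence "convex_on {u<..<v} (\<lambda>x. M - (h * x + Hr x))"
    by (intro convex_on_diff) (auto simp: convex_on_const)
  hence "convex_on {u<..<v} (rate K)"
  proof -
    assume c: "convex_on {u<..<v} (\<lambda>x. M - (h * x + Hr x))"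
    have eq: "rate K x = M - (h * x + Hr x)" if "x \<in> {u<..<v}" for x
      using flat[OF that] by (simp add: entropy_def)
    have in_uv: "(1 - t) *\<^sub>R x + t *\<^sub>R y \<in> {u<..<v}"
      if "t > 0" "t < 1" "x \<in> {u<..<v}" "y \<in> {u<..<v}" for t x y :: real
      using convexD_alt[of "{u<..<v}" x y t] that by auto
    show ?thesis
    proof (rule convex_onI)
      fix t x y :: real assume txy: "t > 0" "t < 1" "x \<in> {u<..<v}" "y \<in> {u<..<v}"
      show "rate K ((1 - t) *\<^sub>R x + t *\<^sub>R y) \<le> (1 - t) * rate K x + t * rate K y"
        unfolding eq[OF in_uv[OF txy]] eq[OF txy(3)] eq[OF txy(4)]
        by (rule convex_onD[OF c]) (use txy in auto)
    qed simp
  qed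
  hence r0: "rate K x = 0" if "x \<in> {u<..<v}" for x
    using rate_convex_imp_0 uv that by blast
  have "Hr x = M + (- h) * x" if "x \<in> {u<..<v}" for x
    using flat[OF that] r0[OF that] by (simp add: entropy_def)
  hence aff: "Hr x = M + (- h) * x" if "x \<in> {0<..<1}" for x
    using real_analytic_affine_propagates[OF H_analytic _ _ uv(2) sub _ that, of M "- h"] by auto
  have "deriv Hr x = - h" if x: "x \<in> {0<..<1}" for x
  proof -
    have "((\<lambda>x. M + (- h) * x) has_real_derivative - h) (at x)" by (auto intro!: derivative_eq_intros)
    hence "(Hr has_real_derivative - h) (at x)"
      by (rule has_field_derivative_transform_within_open[OF _ _ x]) (auto simp: aff)
    thus ?thesis by (rule DERIV_imp_deriv)
  qed
  hence "eventually (\<lambda>x. ereal (deriv Hr x) = ereal (- h)) (at_right 0)"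
    unfolding eventually_at_right_field by (intro exI[of _ 1]) auto
  hence "((\<lambda>x. ereal (deriv Hr x)) \<longlongrightarrow> ereal (- h)) (at_right 0)"
    by (rule tendsto_eventually)
  hence "Hder0 H = ereal (- h)"
    unfolding Hder0_def by (intro tendsto_Lim) auto
  thus ?thesis by simp
qed

lemma exists_density:
  assumes "ereal h \<noteq> - Hder0 H"
  obtains \<rho> where "\<rho> \<in> {0..1}"
    "\<And>\<epsilon>. \<epsilon> > 0 \<Longrightarrow> \<exists>c>0. \<forall>x\<in>{0<..<1}. \<bar>x - \<rho>\<bar> \<ge> \<epsilon> \<longrightarrow> h * x + entropy x \<le> F h - c"
proof (rule concave_separated_max[OF concave_objective entropy_bdd, of h])
  fix u v :: real assume uv: "0 \<le> u" "u < v" "v \<le> 1"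
  show "\<exists>x\<in>{u<..<v}. h * x + entropy x \<noteq> (SUP x\<in>{0<..<1}. h * x + entropy x)"
  proof (rule ccontr)
    assume "\<not> ?thesis"
    hence "ereal h = - Hder0 H" by (intro flat_imp_critical[OF uv]) auto
    thus False using assms by simp
  qed
qed (use that in \<open>auto simp: F_def\<close>)

lemma tangent: "x \<in> {0<..<1} \<Longrightarrow> y \<in> {0<..<1} \<Longrightarrow> Hr y - Hr x \<le> deriv Hr x * (y - x)"
proof -
  assume xy: "x \<in> {0<..<1}" "y \<in> {0<..<1}"
  have "- deriv Hr x * (y - x) \<le> - Hr y - (- Hr x)"
  proof (rule convex_on_imp_above_tangent)
    show "convex_on {0<..<1} (\<lambda>x. - Hr x)" using H_concave by (simp add: concave_on_def)
    show "((\<lambda>x. - Hr x) has_real_derivative - deriv Hr x) (at x within {0<..<1})"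
      using DERIV_minus[OF Hr_has_derivative[OF xy(1)]] by (rule DERIV_subset) auto
  qed (use xy in \<open>auto simp: interior_open\<close>)
  thus ?thesis by simp
qed

lemma deriv_Hr_antimono:
  assumes "x \<in> {0<..<1}" "y \<in> {0<..<1}" "x \<le> y"
  shows "deriv Hr y \<le> deriv Hr x"
proof (cases "x = y")
  case False
  have "Hr y - Hr x \<le> deriv Hr x * (y - x)" "Hr x - Hr y \<le> deriv Hr y * (x - y)"
    using tangent assms by auto
  hence "deriv Hr y * (y - x) \<le> deriv Hr x * (y - x)" by (simp add: algebra_simps)
  thus ?thesis using False assms by simp
qed simp

lemma supercritical_derivative:
  assumes "ereal h > - Hder0 H"
  obtains x where "x \<in> {0<..<1}" "deriv Hr x > - h"
proof -
  define S where "S = (SUP x\<in>{0<..<1::real}. ereal (deriv Hr x))"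
  have "((\<lambda>x. ereal (deriv Hr x)) \<longlongrightarrow> S) (at_right 0)"
  proof (rule order_tendstoI)
    fix a assume "a < S"
    then obtain x0 where x0: "x0 \<in> {0<..<1}" "a < ereal (deriv Hr x0)"
      unfolding S_def by (auto simp: less_SUP_iff)
    have "a < ereal (deriv Hr x)" if "0 < x" "x < x0" for x
      using x0 deriv_Hr_antimono[of x x0] that by (auto elim: less_le_trans)
    thus "eventually (\<lambda>x. a < ereal (deriv Hr x)) (at_right 0)"
      unfolding eventually_at_right_field using x0 by (intro exI[of _ x0]) auto
  next
    fix a assume a: "S < a"
    have "ereal (deriv Hr x) < a" if "0 < x" "x < 1" for x
    proof -
      have "ereal (deriv Hr x) \<le> S" unfolding S_def using that by (intro SUP_upper) auto
      thus ?thesis using a by (rule le_less_trans)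
    qed
    thus "eventually (\<lambda>x. ereal (deriv Hr x) < a) (at_right 0)"
      unfolding eventually_at_right_field by (intro exI[of _ 1]) auto
  qed
  hence "Hder0 H = S" unfolding Hder0_def by (intro tendsto_Lim) auto
  hence "S > ereal (- h)" using assms by (cases S) auto
  thus ?thesis using that unfolding S_def by (auto simp: less_SUP_iff)
qed

lemma density_pos:
  assumes h: "ereal h > - Hder0 H" and \<rho>: "\<rho> \<in> {0..1}"
    and sep: "\<And>\<epsilon>. \<epsilon> > 0 \<Longrightarrow> \<exists>c>0. \<forall>x\<in>{0<..<1}. \<bar>x - \<rho>\<bar> \<ge> \<epsilon> \<longrightarrow> h * x + entropy x \<le> F h - c"
  shows "\<rho> > 0"
proof (rule ccontr)
  assume "\<not> \<rho> > 0"
  hence \<rho>0: "\<rho> = 0" using \<rho> by auto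
  obtain x1 where x1: "x1 \<in> {0<..<1}" "deriv Hr x1 > - h" using supercritical_derivative[OF h] by blast
  define e where "e = deriv Hr x1 + h"
  have e: "e > 0" using x1 by (simp add: e_def)
  obtain d where d: "d > 0" "\<And>x. 0 < x \<Longrightarrow> x < d \<Longrightarrow> rate K x \<ge> - (e / 2) * x"
    using rate_near_0[of "e / 2"] e by auto
  define x' where "x' = min d x1 / 2"
  have x': "0 < x'" "x' < d" "x' < x1" "x' < 1" using d x1 by (auto simp: x'_def)
  have small: "h * y + entropy y \<le> F h - e * x' / 4" if y: "0 < y" "y < x' / 4" for y
  proof -
    have "Hr y - Hr x' \<le> deriv Hr x' * (y - x')" using y x' by (intro tangent) auto
    also have "\<dots> \<le> deriv Hr x1 * (y - x')"
      using deriv_Hr_antimono[of x' x1] x' x1 y by (intro mult_right_mono_neg) auto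
    finally have "h * y + Hr y \<le> h * x' + Hr x' - e * (x' - y)" by (simp add: e_def algebra_simps)
    moreover have "rate K y \<le> 0" using y x' by (intro rate_nonpos) auto
    moreover have "rate K x' \<ge> - (e / 2) * x'" using x' by (intro d) auto
    moreover have "h * x' + entropy x' \<le> F h" using x' by (intro le_F) auto
    moreover have "e * y \<le> e * (x' / 4)" using e y by (intro mult_left_mono) auto
    ultimately show ?thesis by (simp add: entropy_def algebra_simps)
  qed
  obtain c where c: "c > 0" "\<forall>x\<in>{0<..<1}. \<bar>x - \<rho>\<bar> \<ge> x' / 4 \<longrightarrow> h * x + entropy x \<le> F h - c"
    using sep[of "x' / 4"] x' by auto
  have "(SUP x\<in>{0<..<1}. h * x + entropy x) \<le> F h - min c (e * x' / 4)"
  proof (rule cSUP_least)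
    fix x :: real assume x: "x \<in> {0<..<1}"
    show "h * x + entropy x \<le> F h - min c (e * x' / 4)"
    proof (cases "x < x' / 4")
      case True
      thus ?thesis using small[of x] x by auto
    next
      case False
      hence "h * x + entropy x \<le> F h - c" using c(2) x \<rho>0 by auto
      thus ?thesis by linarith
    qed
  qed auto
  hence "min c (e * x' / 4) \<le> 0" by (simp add: F_def[symmetric])
  thus False using c e x' by (auto simp: min_le_iff_disj mult_le_0_iff)
qed

lemma Psi_nonneg: "1 \<le> m \<Longrightarrow> m \<le> N \<Longrightarrow> Psi Q H m N \<ge> 0"
  using Q_nonneg by (simp add: Psi_def)

lemma weight_nonneg: "1 \<le> m \<Longrightarrow> m \<le> N \<Longrightarrow> weight h m N \<ge> 0"
  using Psi_nonneg by simp

text \<open>At \<open>m = N\<close> the value \<open>H 1\<close> is controlled by the values of \<open>H\<close> near \<open>1\<close>, so bounds on the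
  open interval suffice.\<close>
lemma weight_exp_le:
  assumes g: "\<And>x y. 0 < x \<Longrightarrow> x \<le> y \<Longrightarrow> y \<le> 1 \<Longrightarrow> g y \<le> g x" and U: "open U"
    and B: "\<And>x. x \<in> {0<..<1} \<Longrightarrow> x \<in> U \<Longrightarrow> h * x + Hr x + g x \<le> B" and b: "b > 0"
  obtains c where "c > 0" "\<And>m N. 1 \<le> m \<Longrightarrow> m \<le> N \<Longrightarrow> real m / real N \<in> U \<Longrightarrow>
     weight h m N * exp (real N * g (real m / real N)) \<le> c * exp ((B + b) * real N)"
proof -
  obtain c0 where c0: "\<And>m N. 1 \<le> m \<Longrightarrow> m \<le> N \<Longrightarrow> Q m N \<le> c0 * exp (b * real N)"
    using Q_upper b by blast
  define c where "c = max c0 1"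
  have c: "c > 0" "\<And>m N. 1 \<le> m \<Longrightarrow> m \<le> N \<Longrightarrow> Q m N \<le> c * exp (b * real N)"
  proof -
    fix m N :: nat assume "1 \<le> m" "m \<le> N"
    hence "Q m N \<le> c0 * exp (b * real N)" by (rule c0)
    also have "\<dots> \<le> c * exp (b * real N)" by (intro mult_right_mono) (auto simp: c_def)
    finally show "Q m N \<le> c * exp (b * real N)" .
  qed (auto simp: c_def)
  have main: "h * x + Hr x + g x \<le> B" if x: "0 < x" "x \<le> 1" "x \<in> U" "H x \<noteq> - \<infinity>" for x
  proof (cases "x = 1")
    case True
    obtain r where fin: "H 1 = ereal r" using x True H_notinf[rule_format, of 1] by (cases "H 1") auto
    have "(H \<longlongrightarrow> H 1) (at_left 1)" by (rule continuous_on_Icc_at_leftD[OF H_cont]) auto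
    hence "(Hr \<longlongrightarrow> r) (at_left 1)" unfolding fin by (rule lim_real_of_ereal)
    hence "(Hr \<longlongrightarrow> Hr 1) (at_left 1)" by (simp add: fin)
    hence "((\<lambda>y. h * y + Hr y + g 1) \<longlongrightarrow> h * 1 + Hr 1 + g 1) (at_left 1)"
      by (intro tendsto_add tendsto_mult tendsto_const tendsto_ident_at)
    moreover have "eventually (\<lambda>y. y \<in> U) (at_left 1)"
      using U x True by (auto simp: eventually_at_filter intro!: eventually_nhds_in_open[THEN eventually_mono])
    moreover have "eventually (\<lambda>y::real. y \<in> {0<..<1}) (at_left 1)"
      by (rule eventually_at_left_real) auto
    hence "eventually (\<lambda>y. h * y + Hr y + g 1 \<le> B) (at_left 1)" using calculation(2)
    proof eventually_elim
      case (elim y)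
      have "g 1 \<le> g y" using elim by (intro g) auto
      thus ?case using B[OF elim] by linarith
    qed
    ultimately have "h * 1 + Hr 1 + g 1 \<le> B" by (intro tendsto_upperbound) auto
    thus ?thesis using True by simp
  qed (use x B in auto)
  have "weight h m N * exp (real N * g (real m / real N)) \<le> c * exp ((B + b) * real N)"
    if m: "1 \<le> m" "m \<le> N" "real m / real N \<in> U" for m N
  proof (cases "H (real m / real N) = - \<infinity>")
    case True
    thus ?thesis using c by (simp add: Psi_def)
  next
    case False
    define x where "x = real m / real N"
    have x: "0 < x" "x \<le> 1" "x \<in> U" using m by (auto simp: x_def)
    have mx: "real m = x * real N" using m by (simp add: x_def)
    have "weight h m N * exp (real N * g x) =
          Q m N * exp (real N * (h * x + Hr x + g x))"
      using False unfolding Psi_def x_def[symmetric] mx by (simp add: exp_add[symmetric] algebra_simps)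
    also have "\<dots> \<le> (c * exp (b * real N)) * exp (real N * B)"
      using c m Q_nonneg main[OF x] False
      by (intro mult_mono) (auto simp: x_def intro!: mult_left_mono)
    also have "\<dots> = c * exp ((B + b) * real N)" by (simp add: exp_add[symmetric] algebra_simps)
    finally show ?thesis by (simp add: x_def)
  qed
  thus ?thesis using that c by blast
qed

lemma Zpin_ge:
  assumes \<delta>: "\<delta> > 0"
  shows "eventually (\<lambda>N. Zpin K Q H N h \<ge> exp (real N * (F h - \<delta>))) sequentially"
proof -
  have "F h - \<delta> / 4 < F h" using \<delta> by simp
  then obtain x where x: "x \<in> {0<..<1}" "h * x + entropy x > F h - \<delta> / 4"
    using less_cSUP_iff[OF _ entropy_bdd, of "F h - \<delta> / 4" h] by (auto simp: F_def)
  have "isCont (\<lambda>y. h * y + Hr y) x" by (intro continuous_intros Hr_isCont x)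
  then obtain d0 where d0: "d0 > 0" "\<And>y. dist y x < d0 \<Longrightarrow> dist (h * y + Hr y) (h * x + Hr x) < \<delta> / 4"
    using \<delta> unfolding continuous_at_eps_delta by (metis divide_pos_pos zero_less_numeral)
  define d where "d = min (d0 / 2) (min (\<delta> / 4) (min (x / 2) ((1 - x) / 2)))"
  have d: "d > 0" "d < d0" "d \<le> \<delta> / 4" "x - d > 0" "x + d < 1"
  proof -
    have "d \<le> d0 / 2" "d \<le> \<delta> / 4" "d \<le> x / 2" "d \<le> (1 - x) / 2" unfolding d_def by linarith+
    thus "d < d0" "d \<le> \<delta> / 4" "x - d > 0" "x + d < 1" using d0 x by auto
    show "d > 0" using d0 \<delta> x by (auto simp: d_def)
  qed
  have "\<exists>c>0. \<forall>m N. 1 \<le> m \<longrightarrow> m \<le> N \<longrightarrow> real m / real N \<in> {x - d..x + d} \<longrightarrow>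
            Q m N \<ge> c * exp (- (\<delta> / 8) * real N)"
    using d \<delta> by (intro Q_lower[rule_format]) auto
  then obtain c where c: "c > 0" "\<And>m N. 1 \<le> m \<Longrightarrow> m \<le> N \<Longrightarrow> real m / real N \<in> {x - d..x + d} \<Longrightarrow>
            Q m N \<ge> c * exp (- (\<delta> / 8) * real N)" by blast
  have "eventually (\<lambda>N::nat. c * exp (\<delta> / 8 * real N) \<ge> 1) sequentially" using c \<delta> by real_asymp
  moreover have "eventually (\<lambda>N. \<exists>m. 1 \<le> m \<and> m \<le> N \<and> \<bar>real m / real N - x\<bar> \<le> d \<and>
           pinned_mass m N \<ge> exp (real N * (rate K x - d))) sequentially"
    by (rule mass_ge_rate) (use x d in auto)
  ultimately show ?thesis using eventually_gt_at_top[of 0]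
  proof eventually_elim
    case (elim N)
    then obtain m where m: "1 \<le> m" "m \<le> N" "\<bar>real m / real N - x\<bar> \<le> d"
       "pinned_mass m N \<ge> exp (real N * (rate K x - d))" by blast
    define y where "y = real m / real N"
    have my: "real m = y * real N" using m by (simp add: y_def)
    have y: "y \<in> {x - d..x + d}" "y \<in> {0<..<1}" using m(3) d by (auto simp: y_def[symmetric])
    have Hf: "H y \<noteq> - \<infinity>" using H_fin y by auto
    have "h * y + Hr y \<ge> h * x + Hr x - \<delta> / 4"
    proof -
      have "dist y x < d0" using y d unfolding dist_real_def by auto
      from d0(2)[OF this] show ?thesis unfolding dist_real_def by linarith
    qed
    hence "F h - \<delta> \<le> (- (\<delta> / 8) + (h * y + Hr y) + (rate K x - d)) - \<delta> / 8"
      using x(2) d by (simp add: entropy_def)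
    hence "exp (real N * (F h - \<delta>)) \<le> exp (real N * ((- (\<delta> / 8) + (h * y + Hr y) + (rate K x - d)) - \<delta> / 8))"
      by (auto intro: mult_left_mono)
    also have "\<dots> = 1 * exp (- (\<delta> / 8) * real N) * exp (real N * (- (\<delta> / 8) + (h * y + Hr y) + (rate K x - d)))"
      by (simp add: exp_add[symmetric] algebra_simps)
    also have "\<dots> \<le> c * exp (\<delta> / 8 * real N) * exp (- (\<delta> / 8) * real N) * exp (real N * (- (\<delta> / 8) + (h * y + Hr y) + (rate K x - d)))"
      using elim(1) by (intro mult_right_mono) auto
    also have "\<dots> = exp (h * real m) * (c * exp (- (\<delta> / 8) * real N) * exp (real N * Hr y)) * exp (real N * (rate K x - d))"
      unfolding my by (simp add: exp_add[symmetric] algebra_simps)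
    also have "\<dots> \<le> weight h m N * pinned_mass m N"
    proof (intro mult_mono m(4))
      show "c * exp (- (\<delta> / 8) * real N) * exp (real N * Hr y) \<le> Psi Q H m N"
        using c(2)[OF m(1,2)] y Hf unfolding Psi_def y_def[symmetric] by (auto intro!: mult_right_mono)
    qed (use c m weight_nonneg in \<open>auto simp: Psi_nonneg\<close>)
    also have "\<dots> \<le> (\<Sum>m=1..N. weight h m N * pinned_mass m N)"
      by (rule member_le_sum) (use m in \<open>auto intro!: mult_nonneg_nonneg mass_nonneg K_nonneg simp: Psi_nonneg\<close>)
    also have "\<dots> = Zpin K Q H N h" using elim by (intro Zpin_eq[symmetric]) auto
    finally show ?case .
  qed
qed

lemma Zpin_le:
  assumes \<delta>: "\<delta> > 0"
  shows "eventually (\<lambda>N. Zpin K Q H N h \<le> exp (real N * (F h + \<delta>))) sequentially"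
proof -
  obtain c where c: "c > 0" "\<And>m N. 1 \<le> m \<Longrightarrow> m \<le> N \<Longrightarrow> real m / real N \<in> UNIV \<Longrightarrow>
     weight h m N * exp (real N * rate K (real m / real N)) \<le> c * exp ((F h + \<delta> / 2) * real N)"
  proof (rule weight_exp_le[of "rate K" UNIV h "F h" "\<delta> / 2"])
    show "h * x + Hr x + rate K x \<le> F h" if "x \<in> {0<..<1}" for x
      using le_F[OF that, of h] by (simp add: entropy_def)
  qed (use rate_antimono \<delta> in auto)
  have "eventually (\<lambda>N::nat. real N * c \<le> exp (\<delta> / 2 * real N)) sequentially" using c \<delta> by real_asymp
  thus ?thesis using eventually_gt_at_top[of 0]
  proof eventually_elim
    case (elim N)
    have "Zpin K Q H N h = (\<Sum>m=1..N. weight h m N * pinned_mass m N)"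
      using elim by (intro Zpin_eq) auto
    also have "\<dots> \<le> (\<Sum>m=1..N. c * exp ((F h + \<delta> / 2) * real N))"
    proof (intro sum_mono)
      fix m assume "m \<in> {1..N}"
      hence m: "1 \<le> m" "m \<le> N" by auto
      have "weight h m N * pinned_mass m N \<le>
            weight h m N * exp (real N * rate K (real m / real N))"
        by (intro mult_left_mono mass_le_rate weight_nonneg m)
      also have "\<dots> \<le> c * exp ((F h + \<delta> / 2) * real N)" by (intro c m) auto
      finally show "weight h m N * pinned_mass m N \<le> c * exp ((F h + \<delta> / 2) * real N)" .
    qed
    also have "\<dots> = (real N * c) * exp ((F h + \<delta> / 2) * real N)" by simp
    also have "\<dots> \<le> exp (\<delta> / 2 * real N) * exp ((F h + \<delta> / 2) * real N)"
      using elim by (intro mult_right_mono) auto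
    also have "\<dots> = exp (real N * (F h + \<delta>))" by (simp add: exp_add[symmetric] algebra_simps)
    finally show ?case .
  qed
qed

lemma free_energy_eq_F: "free_energy K Q H h = F h"
proof -
  have "(\<lambda>N. ln (Zpin K Q H N h) / real N) \<longlonglongrightarrow> F h"
  proof (rule tendstoI)
    fix e :: real assume e: "e > 0"
    hence e2: "e / 2 > 0" by simp
    from Zpin_ge[OF e2, of h] Zpin_le[OF e2, of h] eventually_gt_at_top[of 0]
    show "eventually (\<lambda>N. dist (ln (Zpin K Q H N h) / real N) (F h) < e) sequentially"
    proof eventually_elim
      case (elim N)
      have pos: "Zpin K Q H N h > 0" using elim(1) by (meson exp_gt_zero less_le_trans)
      have "real N * (F h - e / 2) \<le> ln (Zpin K Q H N h)" using elim(1) pos by (simp add: ln_ge_iff)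
      moreover have "ln (Zpin K Q H N h) \<le> real N * (F h + e / 2)"
        using elim(2) pos by (metis exp_gt_zero ln_exp ln_le_cancel_iff)
      ultimately have "F h - e / 2 \<le> ln (Zpin K Q H N h) / real N" "ln (Zpin K Q H N h) / real N \<le> F h + e / 2"
        using elim(3) by (auto simp: pos_le_divide_eq pos_divide_le_eq mult.commute)
      thus ?case using e by (auto simp: dist_real_def abs_less_iff)
    qed
  qed
  thus ?thesis unfolding free_energy_def by (rule limI)
qed

end

section \<open>Order statistics of the gaps\<close>

context power_law_kernel
begin

lemma rate_lower_semicontinuous:
  assumes \<rho>: "0 < \<rho>" "\<rho> \<le> 1" and e: "e > 0"
  obtains d where "d > 0" "\<And>x. x \<in> {0<..<1} \<Longrightarrow> \<bar>x - \<rho>\<bar> < d \<Longrightarrow> rate K x \<ge> rate K \<rho> - e"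
proof (cases "\<rho> = 1")
  case True
  have "rate K x \<ge> rate K \<rho> - e" if "x \<in> {0<..<1}" for x
    using rate_antimono[of x \<rho>] that True e by auto
  thus ?thesis using that[of 1] by auto
next
  case False
  define d where "d = (1 - \<rho>) * e / (1 + \<bar>rate K 1\<bar>)"
  have d: "d > 0" using \<rho> False e by (auto simp: d_def intro!: divide_pos_pos)
  have "rate K x \<ge> rate K \<rho> - e" if x: "x \<in> {0<..<1}" "\<bar>x - \<rho>\<bar> < d" for x
  proof (cases "x \<le> \<rho>")
    case True
    thus ?thesis using rate_antimono[of x \<rho>] x \<rho> e by auto
  next
    case gt: False
    define t where "t = (x - \<rho>) / (1 - \<rho>)"
    have p: "1 - \<rho> > 0" using \<rho> False by simp
    have t: "0 \<le> t" "t \<le> 1" using gt x p by (auto simp: t_def)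
    have tx: "(1 - t) *\<^sub>R \<rho> + t *\<^sub>R 1 = x"
    proof -
      have "t * (1 - \<rho>) = x - \<rho>" using p by (simp add: t_def)
      thus ?thesis by (simp add: algebra_simps)
    qed
    have "(1 - t) * rate K \<rho> + t * rate K 1 \<le> rate K ((1 - t) *\<^sub>R \<rho> + t *\<^sub>R 1)"
      by (rule concave_onD[OF rate_concave]) (use t \<rho> in auto)
    hence "(1 - t) * rate K \<rho> + t * rate K 1 \<le> rate K x" unfolding tx .
    moreover have "t * rate K \<rho> \<le> 0" using t rate_nonpos[of \<rho>] \<rho> by (simp add: mult_nonneg_nonpos)
    moreover have "- (t * rate K 1) \<le> e"
    proof -
      have "t \<le> d / (1 - \<rho>)" using x gt p by (auto simp: t_def intro: divide_right_mono)
      also have "\<dots> = e / (1 + \<bar>rate K 1\<bar>)" using p by (simp add: d_def)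
      finally have "t * (1 + \<bar>rate K 1\<bar>) \<le> e" by (simp add: pos_le_divide_eq add_pos_nonneg)
      moreover have "- (t * rate K 1) = t * (- rate K 1)" by simp
      moreover have "t * (- rate K 1) \<le> t * (1 + \<bar>rate K 1\<bar>)" using t by (intro mult_left_mono) auto
      ultimately show ?thesis by linarith
    qed
    ultimately show ?thesis by (simp add: algebra_simps)
  qed
  thus ?thesis using that d by blast
qed

lemma mass_large_gap_le:
  assumes l: "l > 0" and m: "1 \<le> m" "m \<le> N"
  shows "mass K m N (\<lambda>xs. sum_list xs = N \<and> (\<exists>x\<in>set xs. real x > \<epsilon> * real N)) \<le>
    exp (- log_laplace K l) * real N * exp (real N * (l * (1 - \<epsilon>) + real m / real N * log_laplace K l))"
proof -
  obtain k where k: "m = Suc k" using m by (cases m) auto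
  define P where "P = (\<lambda>n ys. real n > \<epsilon> * real N \<and> sum_list ys = N - n)"
  define e where "e = exp (l * (1 - \<epsilon>) * real N + real k * log_laplace K l)"
  have "mass K m N (\<lambda>xs. sum_list xs = N \<and> (\<exists>x\<in>set xs. real x > \<epsilon> * real N)) \<le>
        real (Suc k) * (\<Sum>n=1..N. K n * mass K k N (P n))"
    unfolding k
  proof (rule mass_union_bound[OF K_nonneg])
    fix xs assume xs: "xs \<in> seqs (Suc k) N" "sum_list xs = N \<and> (\<exists>x\<in>set xs. real x > \<epsilon> * real N)"
    then obtain i where i: "i < length xs" "real (xs ! i) > \<epsilon> * real N" by (auto simp: in_set_conv_nth)
    thus "\<exists>i\<le>k. P (xs ! i) (take i xs @ drop (Suc i) xs)"
      using xs sum_list_remove_nth[OF i(1)] by (intro exI[of _ i]) (auto simp: P_def seqs_def)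
  qed
  also have "\<dots> \<le> real (Suc k) * (\<Sum>n=1..N. K n * e)"
  proof (intro mult_left_mono sum_mono K_nonneg)
    fix n assume n: "n \<in> {1..N}"
    show "mass K k N (P n) \<le> e"
    proof (cases "real n > \<epsilon> * real N")
      case True
      have "mass K k N (P n) \<le> mass K k N (\<lambda>ys. sum_list ys = N - n)"
        by (intro mass_mono K_nonneg) (auto simp: P_def)
      also have "\<dots> \<le> exp (l * real (N - n) + real k * log_laplace K l)"
        by (rule mass_le_log_laplace) (use l in auto)
      also have "\<dots> \<le> e"
      proof -
        have "real (N - n) \<le> (1 - \<epsilon>) * real N" using True n by (simp add: of_nat_diff algebra_simps)
        hence "l * real (N - n) \<le> l * ((1 - \<epsilon>) * real N)" using l by (intro mult_left_mono) auto
        thus ?thesis by (simp add: e_def)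
      qed
      finally show ?thesis .
    next
      case False
      hence "P n = (\<lambda>_. False)" by (auto simp: P_def)
      thus ?thesis by (simp add: mass_def e_def)
    qed
  qed auto
  also have "\<dots> \<le> real N * (1 * e)"
  proof -
    have "(\<Sum>n=1..N. K n) \<le> 1"
      using sum_le_suminf[OF K_summable, of "{1..N}"] K_nonneg K_suminf by simp
    hence "(\<Sum>n=1..N. K n) * e \<le> 1 * e" by (intro mult_right_mono) (auto simp: e_def)
    thus ?thesis unfolding sum_distrib_right[symmetric] using m k
      by (intro mult_mono) (auto simp: e_def intro!: mult_nonneg_nonneg sum_nonneg K_nonneg)
  qed
  also have "e = exp (- log_laplace K l) * exp (real N * (l * (1 - \<epsilon>) + real m / real N * log_laplace K l))"
    using m unfolding e_def k by (simp add: exp_add[symmetric] field_simps)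
  finally show ?thesis by (simp add: mult_ac)
qed

end

context pinning_model
begin

lemma pin_weight_nonneg:
  assumes "N \<ge> 1" "A \<in> confs N"
  shows "pin_weight K Q H h N A \<ge> 0"
proof -
  have fin: "finite A" using assms finite_subset by (auto simp: confs_def)
  have "card {0, N} \<le> card A" using assms fin by (intro card_mono) (auto simp: confs_def)
  moreover have "card A \<le> card {0..N}" using assms by (intro card_mono) (auto simp: confs_def)
  ultimately have "1 \<le> nren A" "nren A \<le> N" using assms by (auto simp: nren_def)
  thus ?thesis unfolding pin_weight_def renewal_prob_def
    by (intro mult_nonneg_nonneg Psi_nonneg prod_list_map_nonneg K_nonneg) auto
qed

lemma finite_confs: "finite (confs N)"
  by (rule finite_subset[of _ "Pow {0..N}"]) (auto simp: confs_def)

lemma Zpin_nonneg: "N \<ge> 1 \<Longrightarrow> Zpin K Q H N h \<ge> 0"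
  unfolding Zpin_def by (intro sum_nonneg pin_weight_nonneg)

lemma Ppin_nonneg: "N \<ge> 1 \<Longrightarrow> Ppin K Q H N h E \<ge> 0"
  unfolding Ppin_def by (intro divide_nonneg_nonneg sum_nonneg Zpin_nonneg) (auto intro: pin_weight_nonneg)

lemma Ppin_union_le:
  assumes N: "N \<ge> 1" and sub: "confs N \<inter> E \<subseteq> E1 \<union> E2"
  shows "Ppin K Q H N h E \<le> Ppin K Q H N h E1 + Ppin K Q H N h E2"
proof -
  let ?w = "pin_weight K Q H h N"
  have "sum ?w (confs N \<inter> E) \<le> sum ?w ((confs N \<inter> E1) \<union> (confs N \<inter> E2))"
    using sub N finite_confs by (intro sum_mono2) (auto intro: pin_weight_nonneg)
  also have "\<dots> \<le> sum ?w (confs N \<inter> E1) + sum ?w (confs N \<inter> E2)"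
    using N finite_confs sum.union_inter[of "confs N \<inter> E1" "confs N \<inter> E2" ?w]
      sum_nonneg[of "(confs N \<inter> E1) \<inter> (confs N \<inter> E2)" ?w] pin_weight_nonneg[OF N] by auto
  finally show ?thesis unfolding Ppin_def add_divide_distrib[symmetric]
    by (intro divide_right_mono Zpin_nonneg N)
qed

lemma Ppin_union_tendsto_0:
  assumes "eventually (\<lambda>N. confs N \<inter> E N \<subseteq> E1 N \<union> E2 N) sequentially"
    and "(\<lambda>N. Ppin K Q H N h (E1 N)) \<longlonglongrightarrow> 0" "(\<lambda>N. Ppin K Q H N h (E2 N)) \<longlonglongrightarrow> 0"
  shows "(\<lambda>N. Ppin K Q H N h (E N)) \<longlonglongrightarrow> 0"
proof (rule tendsto_sandwich)
  show "eventually (\<lambda>N. 0 \<le> Ppin K Q H N h (E N)) sequentially"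
    using eventually_ge_at_top[of 1] by eventually_elim (rule Ppin_nonneg)
  show "eventually (\<lambda>N. Ppin K Q H N h (E N) \<le> Ppin K Q H N h (E1 N) + Ppin K Q H N h (E2 N)) sequentially"
    using eventually_ge_at_top[of 1] assms(1) by eventually_elim (rule Ppin_union_le)
  show "(\<lambda>N. Ppin K Q H N h (E1 N) + Ppin K Q H N h (E2 N)) \<longlonglongrightarrow> 0"
    using tendsto_add[OF assms(2,3)] by simp
qed auto

lemma Ppin_subset_tendsto_0:
  assumes "eventually (\<lambda>N. confs N \<inter> E N \<subseteq> E1 N) sequentially"
    and "(\<lambda>N. Ppin K Q H N h (E1 N)) \<longlonglongrightarrow> 0"
  shows "(\<lambda>N. Ppin K Q H N h (E N)) \<longlonglongrightarrow> 0"
  using Ppin_union_tendsto_0[OF _ assms(2,2), of E] assms(1) by simp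

lemma Ppin_exp_small:
  assumes g: "\<And>x y. 0 < x \<Longrightarrow> x \<le> y \<Longrightarrow> y \<le> 1 \<Longrightarrow> g y \<le> g x" and U: "open U"
    and B: "\<And>x. x \<in> {0<..<1} \<Longrightarrow> x \<in> U \<Longrightarrow> h * x + Hr x + g x \<le> B" "B < F h" and A: "A \<ge> 0"
    and q: "\<And>m N. 1 \<le> m \<Longrightarrow> m \<le> N \<Longrightarrow> mass K m N (\<lambda>xs. sum_list xs = N \<and> E N xs) \<le>
              A * real N * exp (real N * g (real m / real N))"
    and EU: "\<And>N xs. E N xs \<Longrightarrow> real (length xs) / real N \<in> U"
  shows "(\<lambda>N. Ppin K Q H N h {X. E N (gaps X)}) \<longlonglongrightarrow> 0"
proof -
  define b where "b = (F h - B) / 3"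
  have b: "b > 0" using B by (simp add: b_def)
  obtain c where c: "c > 0" "\<And>m N. 1 \<le> m \<Longrightarrow> m \<le> N \<Longrightarrow> real m / real N \<in> U \<Longrightarrow>
     weight h m N * exp (real N * g (real m / real N)) \<le> c * exp ((B + b) * real N)"
    using weight_exp_le[OF g U B(1) b] by blast
  show ?thesis
  proof (rule tendsto_sandwich)
    show "eventually (\<lambda>N. 0 \<le> Ppin K Q H N h {X. E N (gaps X)}) sequentially"
      using eventually_ge_at_top[of 1] by eventually_elim (rule Ppin_nonneg)
    show "(\<lambda>N::nat. real N * (A * real N * c) * exp (- b * real N)) \<longlonglongrightarrow> 0"
      using b by real_asymp
    show "eventually (\<lambda>N. Ppin K Q H N h {X. E N (gaps X)} \<le> real N * (A * real N * c) * exp (- b * real N)) sequentially"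
      using eventually_ge_at_top[of 1] Zpin_ge[OF b, of h]
    proof eventually_elim
      case (elim N)
      let ?S = "\<Sum>m=1..N. weight h m N * mass K m N (\<lambda>xs. sum_list xs = N \<and> E N xs)"
      have "?S \<le>
            (\<Sum>m=1..N. A * real N * (c * exp ((B + b) * real N)))"
      proof (intro sum_mono)
        fix m assume "m \<in> {1..N}"
        hence m: "1 \<le> m" "m \<le> N" by auto
        show "weight h m N * mass K m N (\<lambda>xs. sum_list xs = N \<and> E N xs) \<le>
              A * real N * (c * exp ((B + b) * real N))"
        proof (cases "real m / real N \<in> U")
          case True
          have "weight h m N * mass K m N (\<lambda>xs. sum_list xs = N \<and> E N xs) \<le>
                weight h m N * (A * real N * exp (real N * g (real m / real N)))"
            by (intro mult_left_mono q weight_nonneg m)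
          also have "\<dots> = A * real N * (weight h m N * exp (real N * g (real m / real N)))"
            by (simp add: mult_ac)
          also have "\<dots> \<le> A * real N * (c * exp ((B + b) * real N))"
            using A by (intro mult_left_mono c m True) auto
          finally show ?thesis .
        next
          case False
          have "mass K m N (\<lambda>xs. sum_list xs = N \<and> E N xs) = 0"
            unfolding mass_def using EU False by (intro sum.neutral) (auto simp: seqs_def)
          thus ?thesis using A c by simp
        qed
      qed
      also have "\<dots> = real N * (A * real N * c) * exp ((B + b) * real N)" by simp
      finally have le: "?S \<le>
         real N * (A * real N * c) * exp ((B + b) * real N)" .
      have "Ppin K Q H N h {X. E N (gaps X)} =
         ?S / Zpin K Q H N h"
        by (rule Ppin_eq) (use elim in auto)
      also have "\<dots> \<le> (real N * (A * real N * c) * exp ((B + b) * real N)) / exp (real N * (F h - b))"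
        using A c elim by (intro frac_le le) auto
      also have "\<dots> = real N * (A * real N * c) * exp ((B + b) * real N - real N * (F h - b))"
        by (simp add: exp_diff)
      also have "(B + b) * real N - real N * (F h - b) = - b * real N"
        by (simp add: b_def field_simps)
      finally show ?case .
    qed
  qed auto
qed

context
  fixes h \<rho> :: real
  assumes \<rho>: "\<rho> \<in> {0..1}"
    and sep: "\<And>\<epsilon>. \<epsilon> > 0 \<Longrightarrow> \<exists>c>0. \<forall>x\<in>{0<..<1}. \<bar>x - \<rho>\<bar> \<ge> \<epsilon> \<longrightarrow> h * x + entropy x \<le> F h - c"
begin

lemma deriv_free_energy: "deriv (free_energy K Q H) h = \<rho>"
proof -
  have "(F has_real_derivative \<rho>) (at h)"
    unfolding F_def[abs_def]
    by (rule sup_affine_has_derivative[OF entropy_bdd _ \<rho>]) (use sep in \<open>simp add: F_def\<close>)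
  moreover have "free_energy K Q H = F" using free_energy_eq_F by blast
  ultimately show ?thesis by (simp add: DERIV_imp_deriv)
qed

lemma density_concentrates:
  assumes \<delta>: "\<delta> > 0"
  shows "(\<lambda>N. Ppin K Q H N h {X. \<bar>real (length (gaps X)) / real N - \<rho>\<bar> > \<delta>}) \<longlonglongrightarrow> 0"
proof -
  obtain c where c: "c > 0" "\<forall>x\<in>{0<..<1}. \<bar>x - \<rho>\<bar> \<ge> \<delta> \<longrightarrow> h * x + entropy x \<le> F h - c"
    using sep[OF \<delta>] by blast
  show ?thesis
  proof (rule Ppin_exp_small[where g = "rate K" and U = "{x. \<bar>x - \<rho>\<bar> > \<delta>}" and B = "F h - c" and A = 1
        and E = "\<lambda>N xs. \<bar>real (length xs) / real N - \<rho>\<bar> > \<delta>"])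
    show "rate K y \<le> rate K x" if "0 < x" "x \<le> y" "y \<le> 1" for x y
      using that by (intro rate_antimono) auto
    show "open {x. \<delta> < \<bar>x - \<rho>\<bar>}" by (intro open_Collect_less continuous_intros)
    show "h * x + Hr x + rate K x \<le> F h - c" if "x \<in> {0<..<1}" "x \<in> {x. \<delta> < \<bar>x - \<rho>\<bar>}" for x
      using c(2) that by (auto simp: entropy_def add_ac)
    show "mass K m N (\<lambda>xs. sum_list xs = N \<and> \<delta> < \<bar>real (length xs) / real N - \<rho>\<bar>) \<le>
          1 * real N * exp (real N * rate K (real m / real N))" if m: "1 \<le> m" "m \<le> N" for m N
    proof -
      have "mass K m N (\<lambda>xs. sum_list xs = N \<and> \<delta> < \<bar>real (length xs) / real N - \<rho>\<bar>) \<le>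
            pinned_mass m N" by (intro mass_mono K_nonneg) auto
      also have "\<dots> \<le> exp (real N * rate K (real m / real N))" by (rule mass_le_rate[OF m])
      also have "\<dots> \<le> 1 * real N * exp (real N * rate K (real m / real N))" using m by simp
      finally show ?thesis .
    qed
  qed (use c in auto)
qed

lemma conv_contact_fraction:
  "conv_in_prob (\<lambda>N. Ppin K Q H N h) (\<lambda>N A. real (card (A \<inter> {0<..<N})) / real N) \<rho>"
  unfolding conv_in_prob_def
proof (intro allI impI)
  fix \<epsilon> :: real assume e: "\<epsilon> > 0"
  show "(\<lambda>N. Ppin K Q H N h {A. \<epsilon> < \<bar>real (card (A \<inter> {0<..<N})) / real N - \<rho>\<bar>}) \<longlonglongrightarrow> 0"
  proof (rule Ppin_subset_tendsto_0)
    show "(\<lambda>N. Ppin K Q H N h {X. \<bar>real (length (gaps X)) / real N - \<rho>\<bar> > \<epsilon> / 2}) \<longlonglongrightarrow> 0"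
      by (rule density_concentrates) (use e in auto)
    have "eventually (\<lambda>N::nat. 1 / real N \<le> \<epsilon> / 2) sequentially" using e by real_asymp
    thus "eventually (\<lambda>N. confs N \<inter> {A. \<epsilon> < \<bar>real (card (A \<inter> {0<..<N})) / real N - \<rho>\<bar>} \<subseteq>
            {X. \<bar>real (length (gaps X)) / real N - \<rho>\<bar> > \<epsilon> / 2}) sequentially"
      using eventually_ge_at_top[of 1]
    proof eventually_elim
      case (elim N)
      show ?case
      proof safe
        fix A assume A: "A \<in> confs N" "\<epsilon> < \<bar>real (card (A \<inter> {0<..<N})) / real N - \<rho>\<bar>"
        have "\<bar>real (card (A \<inter> {0<..<N})) - real (length (gaps A))\<bar> \<le> 1"
          using card_interior_eq[OF elim(2) A(1)] by auto
        hence "\<bar>real (card (A \<inter> {0<..<N})) - real (length (gaps A))\<bar> / real N \<le> 1 / real N"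
          by (intro divide_right_mono) auto
        also have "\<dots> \<le> \<epsilon> / 2" by (rule elim(1))
        also have "\<bar>real (card (A \<inter> {0<..<N})) - real (length (gaps A))\<bar> / real N =
              \<bar>real (card (A \<inter> {0<..<N})) / real N - real (length (gaps A)) / real N\<bar>"
          by (simp add: diff_divide_distrib[symmetric] abs_divide)
        finally have "\<bar>real (card (A \<inter> {0<..<N})) / real N - real (length (gaps A)) / real N\<bar> \<le> \<epsilon> / 2" .
        thus "\<epsilon> / 2 < \<bar>real (length (gaps A)) / real N - \<rho>\<bar>" using A(2) by linarith
      qed
    qed
  qed
qed

lemma no_large_gap:
  assumes \<rho>0: "\<rho> > 0" and sup: "\<And>\<mu>. (\<lambda>n. real n * K n) sums \<mu> \<Longrightarrow> \<rho> * \<mu> \<ge> 1" and e: "\<epsilon> > 0"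
  shows "(\<lambda>N. Ppin K Q H N h {X. \<exists>x\<in>set (gaps X). real x > \<epsilon> * real N}) \<longlonglongrightarrow> 0"
proof -
  have \<rho>1: "\<rho> \<le> 1" using \<rho> by simp
  obtain l where l: "l > 0" "l * (1 - \<epsilon>) + \<rho> * log_laplace K l < rate K \<rho>"
    using exists_strict_tilt[OF \<rho>0 \<rho>1 e sup] by blast
  define r where "r = rate K \<rho> - (l * (1 - \<epsilon>) + \<rho> * log_laplace K l)"
  have r: "r > 0" using l by (simp add: r_def)
  obtain d0 where d0: "d0 > 0" "\<And>x. x \<in> {0<..<1} \<Longrightarrow> \<bar>x - \<rho>\<bar> < d0 \<Longrightarrow> rate K x \<ge> rate K \<rho> - r / 4"
    using rate_lower_semicontinuous[OF \<rho>0 \<rho>1, of "r / 4"] r by auto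
  define d where "d = min d0 (r / (4 * (1 + \<bar>log_laplace K l\<bar>)))"
  have d: "d > 0" "d \<le> d0" using d0 r by (auto simp: d_def)
  define g where "g = (\<lambda>y. l * (1 - \<epsilon>) + y * log_laplace K l)"
  have gd: "g x \<le> g \<rho> + r / 4" if "\<bar>x - \<rho>\<bar> < d" for x
  proof -
    have "g x - g \<rho> = (x - \<rho>) * log_laplace K l" by (simp add: g_def algebra_simps)
    also have "\<dots> \<le> \<bar>x - \<rho>\<bar> * \<bar>log_laplace K l\<bar>" by (metis abs_ge_self abs_mult)
    also have "\<dots> \<le> d * (1 + \<bar>log_laplace K l\<bar>)" using that d by (intro mult_mono) auto
    also have "\<dots> \<le> r / (4 * (1 + \<bar>log_laplace K l\<bar>)) * (1 + \<bar>log_laplace K l\<bar>)"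
      by (intro mult_right_mono) (auto simp: d_def)
    also have "\<dots> = r / 4" by (simp add: field_simps add_nonneg_eq_0_iff)
    finally show ?thesis by simp
  qed
  have near: "(\<lambda>N. Ppin K Q H N h {X. (\<exists>x\<in>set (gaps X). real x > \<epsilon> * real N) \<and>
                     \<bar>real (length (gaps X)) / real N - \<rho>\<bar> < d}) \<longlonglongrightarrow> 0"
  proof (rule Ppin_exp_small[where g = g and U = "{x. \<bar>x - \<rho>\<bar> < d}" and B = "F h - r / 2"
        and A = "exp (- log_laplace K l)"
        and E = "\<lambda>N xs. (\<exists>x\<in>set xs. real x > \<epsilon> * real N) \<and> \<bar>real (length xs) / real N - \<rho>\<bar> < d"])
    show "g y \<le> g x" if "0 < x" "x \<le> y" "y \<le> 1" for x y
      using that log_laplace_nonpos[of l] l by (auto simp: g_def intro: mult_right_mono_neg)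
    show "open {x. \<bar>x - \<rho>\<bar> < d}" by (intro open_Collect_less continuous_intros)
    show "h * x + Hr x + g x \<le> F h - r / 2" if x: "x \<in> {0<..<1}" "x \<in> {x. \<bar>x - \<rho>\<bar> < d}" for x
    proof -
      have "h * x + (Hr x + rate K x) \<le> F h" using le_F[OF x(1), of h] by (simp add: entropy_def)
      moreover have "rate K x \<ge> rate K \<rho> - r / 4" using x d by (intro d0) auto
      moreover have "g x \<le> g \<rho> + r / 4" using x by (intro gd) auto
      moreover have "rate K \<rho> - g \<rho> = r" by (simp add: r_def g_def)
      ultimately show ?thesis by argo
    qed
    show "mass K m N (\<lambda>xs. sum_list xs = N \<and> (\<exists>x\<in>set xs. real x > \<epsilon> * real N) \<and>
             \<bar>real (length xs) / real N - \<rho>\<bar> < d) \<le>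
          exp (- log_laplace K l) * real N * exp (real N * g (real m / real N))" if m: "1 \<le> m" "m \<le> N" for m N
    proof -
      have "mass K m N (\<lambda>xs. sum_list xs = N \<and> (\<exists>x\<in>set xs. real x > \<epsilon> * real N) \<and>
             \<bar>real (length xs) / real N - \<rho>\<bar> < d) \<le>
            mass K m N (\<lambda>xs. sum_list xs = N \<and> (\<exists>x\<in>set xs. real x > \<epsilon> * real N))"
        by (intro mass_mono K_nonneg) auto
      also have "\<dots> \<le> exp (- log_laplace K l) * real N * exp (real N * g (real m / real N))"
        unfolding g_def by (rule mass_large_gap_le[OF l(1) m])
      finally show ?thesis .
    qed
  qed (use r in auto)
  have "d / 2 > 0" using d by simp
  show ?thesis
  proof (rule Ppin_union_tendsto_0[OF _ near density_concentrates[OF \<open>d / 2 > 0\<close>]])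
    show "eventually (\<lambda>N. confs N \<inter> {X. \<exists>x\<in>set (gaps X). real x > \<epsilon> * real N} \<subseteq>
       {X. (\<exists>x\<in>set (gaps X). real x > \<epsilon> * real N) \<and> \<bar>real (length (gaps X)) / real N - \<rho>\<bar> < d} \<union>
       {X. \<bar>real (length (gaps X)) / real N - \<rho>\<bar> > d / 2}) sequentially"
      using d by (intro always_eventually allI) (auto simp: not_less)
  qed
qed

lemma conv_eta_no_large_gap:
  assumes \<rho>0: "\<rho> > 0" and sup: "\<And>\<mu>. (\<lambda>n. real n * K n) sums \<mu> \<Longrightarrow> \<rho> * \<mu> \<ge> 1"
  shows "conv_in_prob (\<lambda>N. Ppin K Q H N h) (\<lambda>N A. real (eta1 A) / real N) 0"
    and "conv_in_prob (\<lambda>N. Ppin K Q H N h) (\<lambda>N A. real (eta2 A) / real N) 0"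
proof -
  have *: "(\<lambda>N. Ppin K Q H N h {A. \<epsilon> < \<bar>real (f A) / real N - 0\<bar>}) \<longlonglongrightarrow> 0"
    if e: "\<epsilon> > 0" and f: "\<And>A. f A \<le> eta1 A" for \<epsilon> f
  proof (rule Ppin_subset_tendsto_0[OF _ no_large_gap[OF \<rho>0 sup e]])
    show "eventually (\<lambda>N. confs N \<inter> {A. \<epsilon> < \<bar>real (f A) / real N - 0\<bar>} \<subseteq>
        {X. \<exists>x\<in>set (gaps X). real x > \<epsilon> * real N}) sequentially"
      using eventually_gt_at_top[of 0]
    proof eventually_elim
      case (elim N)
      show ?case
      proof safe
        fix A assume "\<epsilon> < \<bar>real (f A) / real N - 0\<bar>"
        hence "\<epsilon> * real N < real (f A)" using elim by (simp add: field_simps)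
        also have "\<dots> \<le> real (largest (gaps A))" using f[of A] by (simp add: eta1_eq)
        finally have gt: "\<epsilon> * real N < real (largest (gaps A))" .
        moreover have "gaps A \<noteq> []"
        proof
          assume "gaps A = []"
          hence "largest (gaps A) = 0" by (simp add: largest_def)
          moreover have "\<epsilon> * real N > 0" using e elim by simp
          ultimately show False using gt by simp
        qed
        ultimately show "\<exists>x\<in>set (gaps A). real x > \<epsilon> * real N" using largest_in_set by blast
      qed
    qed
  qed
  show "conv_in_prob (\<lambda>N. Ppin K Q H N h) (\<lambda>N A. real (eta1 A) / real N) 0"
    unfolding conv_in_prob_def by (intro allI impI *) auto
  show "conv_in_prob (\<lambda>N. Ppin K Q H N h) (\<lambda>N A. real (eta2 A) / real N) 0"
    unfolding conv_in_prob_def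
    by (intro allI impI *) (auto simp: eta1_eq eta2_eq second_largest_le_largest)
qed

lemma one_jump_typical:
  assumes mean: "(\<lambda>n. real n * K n) sums \<mu>" and sub: "\<rho> * \<mu> < 1" and e: "\<epsilon> > 0"
  shows "(\<lambda>N. Ppin K Q H N h
     {X. \<not> one_jump (real N - real (length (gaps X)) * \<mu>) (\<epsilon> * real N) (gaps X)}) \<longlonglongrightarrow> 0"
proof -
  have mu: "\<mu> \<ge> 1" by (rule mean_ge_1[OF mean])
  define a where "a = (\<rho> + 1 / \<mu>) / 2"
  have a: "a * \<mu> < 1" "\<rho> < a"
    using sub mu by (auto simp: a_def field_simps)
  let ?J = "\<lambda>N xs. one_jump (real N - real (length xs) * \<mu>) (\<epsilon> * real N) xs"
  let ?E = "\<lambda>N xs. \<not> ?J N xs \<and> real (length xs) \<le> a * real N"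
  have near: "(\<lambda>N. Ppin K Q H N h {X. ?E N (gaps X)}) \<longlonglongrightarrow> 0"
  proof (rule tendstoI)
    fix \<eta> :: real assume \<eta>: "\<eta> > 0"
    hence "\<eta> / 2 > 0" by simp
    from big_jump[OF mean a(1) e this] Zpin_ge[OF zero_less_one, of h] eventually_ge_at_top[of 1]
    show "eventually (\<lambda>N. dist (Ppin K Q H N h {X. ?E N (gaps X)}) 0 < \<eta>) sequentially"
    proof eventually_elim
      case (elim N)
      let ?S = "\<Sum>m=1..N. weight h m N * mass K m N (\<lambda>xs. sum_list xs = N \<and> ?E N xs)"
      have pos: "Zpin K Q H N h > 0" using elim(2) by (meson exp_gt_zero less_le_trans)
      have "?S \<le>
            (\<Sum>m=1..N. \<eta> / 2 * (weight h m N * pinned_mass m N))"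
      proof (intro sum_mono)
        fix m assume "m \<in> {1..N}"
        hence m: "1 \<le> m" "m \<le> N" by auto
        have "mass K m N (\<lambda>xs. sum_list xs = N \<and> ?E N xs) \<le> \<eta> / 2 * pinned_mass m N"
        proof (cases "real m \<le> a * real N")
          case True
          have "mass K m N (\<lambda>xs. sum_list xs = N \<and> ?E N xs) \<le>
                mass K m N (\<lambda>xs. sum_list xs = N \<and> \<not> one_jump (real N - real m * \<mu>) (\<epsilon> * real N) xs)"
            by (intro mass_mono K_nonneg) (auto simp: seqs_def)
          also have "\<dots> \<le> \<eta> / 2 * pinned_mass m N" using elim(1) m True by blast
          finally show ?thesis .
        next
          case False
          have "mass K m N (\<lambda>xs. sum_list xs = N \<and> ?E N xs) = 0"
            unfolding mass_def using False by (intro sum.neutral) (auto simp: seqs_def)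
          thus ?thesis using \<eta> by (simp add: mass_nonneg K_nonneg)
        qed
        from mult_left_mono[OF this weight_nonneg[OF m]]
        show "weight h m N * mass K m N (\<lambda>xs. sum_list xs = N \<and> ?E N xs) \<le>
              \<eta> / 2 * (weight h m N * pinned_mass m N)"
          by (simp add: mult_ac)
      qed
      also have "\<dots> = \<eta> / 2 * Zpin K Q H N h" by (simp add: Zpin_eq[OF elim(3)] sum_distrib_left)
      finally have "?S
          / Zpin K Q H N h \<le> \<eta> / 2" using pos by (simp add: pos_divide_le_eq)
      moreover have "Ppin K Q H N h {X. ?E N (gaps X)} =
         ?S / Zpin K Q H N h"
        by (rule Ppin_eq) (use elim in auto)
      ultimately have "Ppin K Q H N h {X. ?E N (gaps X)} \<le> \<eta> / 2" by (simp only:)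
      thus ?case using \<eta> Ppin_nonneg[OF elim(3), of h "{X. ?E N (gaps X)}"]
        unfolding dist_real_def by linarith
    qed
  qed
  have "(a - \<rho>) / 2 > 0" using a by simp
  show ?thesis
  proof (rule Ppin_union_tendsto_0[OF _ near density_concentrates[OF \<open>(a - \<rho>) / 2 > 0\<close>]])
    show "eventually (\<lambda>N. confs N \<inter> {X. \<not> ?J N (gaps X)} \<subseteq> {X. ?E N (gaps X)} \<union>
       {X. \<bar>real (length (gaps X)) / real N - \<rho>\<bar> > (a - \<rho>) / 2}) sequentially"
      using eventually_gt_at_top[of 0]
    proof eventually_elim
      case (elim N)
      have "\<bar>real k / real N - \<rho>\<bar> > (a - \<rho>) / 2" if "\<not> real k \<le> a * real N" for k
      proof -
        have "real k / real N > a" using that elim by (simp add: pos_less_divide_eq)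
        hence "real k / real N - \<rho> > (a - \<rho>) / 2" using a(2) by argo
        thus ?thesis by linarith
      qed
      thus ?case by blast
    qed
  qed
qed

lemma conv_eta_one_jump:
  assumes mean: "(\<lambda>n. real n * K n) sums \<mu>" and sub: "\<rho> * \<mu> < 1"
  shows "conv_in_prob (\<lambda>N. Ppin K Q H N h) (\<lambda>N A. real (eta1 A) / real N) (1 - \<rho> * \<mu>)"
    and "conv_in_prob (\<lambda>N. Ppin K Q H N h) (\<lambda>N A. real (eta2 A) / real N) 0"
proof -
  have mu: "\<mu> \<ge> 1" by (rule mean_ge_1[OF mean])
  have stats: "\<bar>real (largest xs) - c\<bar> \<le> e" "real (second_largest xs) \<le> e"
    if J: "one_jump c e xs" for c e xs
  proof -
    obtain i where i: "i < length xs" "\<bar>real (xs ! i) - c\<bar> \<le> e"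
      "\<forall>y\<in>set (take i xs @ drop (Suc i) xs). y \<le> xs ! i \<and> real y \<le> e"
      using J unfolding one_jump_def by blast
    have "e \<ge> 0" using i(2) by linarith
    from one_jump_order_stats[OF i(1,3) this] i(2)
    show "\<bar>real (largest xs) - c\<bar> \<le> e" "real (second_largest xs) \<le> e" by simp_all
  qed
  show "conv_in_prob (\<lambda>N. Ppin K Q H N h) (\<lambda>N A. real (eta1 A) / real N) (1 - \<rho> * \<mu>)"
    unfolding conv_in_prob_def
  proof (intro allI impI)
    fix \<epsilon> :: real assume e: "\<epsilon> > 0"
    have e2: "\<epsilon> / 2 > 0" "\<epsilon> / (2 * \<mu>) > 0" using e mu by auto
    show "(\<lambda>N. Ppin K Q H N h {A. \<epsilon> < \<bar>real (eta1 A) / real N - (1 - \<rho> * \<mu>)\<bar>}) \<longlonglongrightarrow> 0"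
    proof (rule Ppin_union_tendsto_0[OF _ one_jump_typical[OF mean sub e2(1)] density_concentrates[OF e2(2)]])
      show "eventually (\<lambda>N. confs N \<inter> {A. \<epsilon> < \<bar>real (eta1 A) / real N - (1 - \<rho> * \<mu>)\<bar>} \<subseteq>
          {X. \<not> one_jump (real N - real (length (gaps X)) * \<mu>) (\<epsilon> / 2 * real N) (gaps X)} \<union>
          {X. \<epsilon> / (2 * \<mu>) < \<bar>real (length (gaps X)) / real N - \<rho>\<bar>}) sequentially"
        using eventually_gt_at_top[of 0]
      proof eventually_elim
        case (elim N)
        have N: "real N > 0" using elim by simp
        show ?case
        proof (rule ccontr)
          assume "\<not> ?case"
          then obtain A where A: "\<epsilon> < \<bar>real (eta1 A) / real N - (1 - \<rho> * \<mu>)\<bar>"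
            "one_jump (real N - real (length (gaps A)) * \<mu>) (\<epsilon> / 2 * real N) (gaps A)"
            "\<bar>real (length (gaps A)) / real N - \<rho>\<bar> \<le> \<epsilon> / (2 * \<mu>)" by (auto simp: not_less)
          let ?k = "real (length (gaps A))"
          have "\<bar>real (eta1 A) - (real N - ?k * \<mu>)\<bar> \<le> \<epsilon> / 2 * real N"
            unfolding eta1_eq by (rule stats(1)[OF A(2)])
          hence "\<bar>real (eta1 A) - (real N - ?k * \<mu>)\<bar> / real N \<le> \<epsilon> / 2"
            using N by (simp add: pos_divide_le_eq)
          also have "\<bar>real (eta1 A) - (real N - ?k * \<mu>)\<bar> / real N =
              \<bar>real (eta1 A) / real N - (1 - ?k / real N * \<mu>)\<bar>"
          proof -
            have "real (eta1 A) / real N - (1 - ?k / real N * \<mu>) = (real (eta1 A) - (real N - ?k * \<mu>)) / real N"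
              using N by (simp add: field_simps)
            thus ?thesis using N by (simp add: abs_divide)
          qed
          finally have eta: "\<bar>real (eta1 A) / real N - (1 - ?k / real N * \<mu>)\<bar> \<le> \<epsilon> / 2" .
          have dens: "\<bar>?k / real N * \<mu> - \<rho> * \<mu>\<bar> \<le> \<epsilon> / 2"
          proof -
            have "\<bar>?k / real N * \<mu> - \<rho> * \<mu>\<bar> = \<bar>?k / real N - \<rho>\<bar> * \<mu>"
              unfolding left_diff_distrib[symmetric] abs_mult using mu by simp
            also have "\<dots> \<le> \<epsilon> / (2 * \<mu>) * \<mu>" using A(3) mu by (intro mult_right_mono) auto
            also have "\<dots> = \<epsilon> / 2" using mu by simp
            finally show ?thesis .
          qed
          have "\<bar>x - (1 - z)\<bar> \<le> \<epsilon>" if "\<bar>x - (1 - y)\<bar> \<le> \<epsilon> / 2" "\<bar>y - z\<bar> \<le> \<epsilon> / 2" for x y z :: real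
            using that by linarith
          from this[OF eta dens] show False using A(1) by simp
        qed
      qed
    qed
  qed
  show "conv_in_prob (\<lambda>N. Ppin K Q H N h) (\<lambda>N A. real (eta2 A) / real N) 0"
    unfolding conv_in_prob_def
  proof (intro allI impI)
    fix \<epsilon> :: real assume e: "\<epsilon> > 0"
    show "(\<lambda>N. Ppin K Q H N h {A. \<epsilon> < \<bar>real (eta2 A) / real N - 0\<bar>}) \<longlonglongrightarrow> 0"
    proof (rule Ppin_subset_tendsto_0[OF _ one_jump_typical[OF mean sub e]])
      show "eventually (\<lambda>N. confs N \<inter> {A. \<epsilon> < \<bar>real (eta2 A) / real N - 0\<bar>} \<subseteq>
          {X. \<not> one_jump (real N - real (length (gaps X)) * \<mu>) (\<epsilon> * real N) (gaps X)}) sequentially"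
        using eventually_gt_at_top[of 0]
      proof eventually_elim
        case (elim N)
        show ?case
        proof (intro subsetI CollectI notI)
          fix A assume A: "A \<in> confs N \<inter> {A. \<epsilon> < \<bar>real (eta2 A) / real N - 0\<bar>}"
            and J: "one_jump (real N - real (length (gaps A)) * \<mu>) (\<epsilon> * real N) (gaps A)"
          from stats(2)[OF J] have "real (eta2 A) \<le> \<epsilon> * real N" by (simp add: eta2_eq)
          thus False using A elim by (simp add: field_simps)
        qed
      qed
    qed
  qed
qed

end

end

theorem theorem1p5:
  fixes K :: "nat \<Rightarrow> real" and \<alpha> C_K :: real
    and Q :: "nat \<Rightarrow> nat \<Rightarrow> real" and H :: "real \<Rightarrow> ereal" and h :: real
  assumes K0: "K 0 = 0"
    and Kpos: "\<forall>n\<ge>1. K n > 0"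
    and Ksum: "K sums 1"
    and alpha: "\<alpha> > 0" and CK: "C_K > 0"
    and Kasym: "K \<sim>[at_top] (\<lambda>n. C_K * real n powr (- (1 + \<alpha>)))"
    and H_fin: "\<forall>x\<in>{0<..<1}. H x \<noteq> \<infinity> \<and> H x \<noteq> - \<infinity>"
    and H_notinf: "\<forall>x\<in>{0..1}. H x \<noteq> \<infinity>"
    and H_cont: "continuous_on {0..1} H"
    and H_concave: "concave_on {0<..<1} (\<lambda>x. real_of_ereal (H x))"
    and H_analytic: "real_analytic_on {0<..<1} (\<lambda>x. real_of_ereal (H x))"
    and Q_nonneg: "\<forall>m N. 1 \<le> m \<longrightarrow> m \<le> N \<longrightarrow> Q m N \<ge> 0"
    and Q_upper: "\<forall>b>0. \<exists>c. \<forall>m N. 1 \<le> m \<longrightarrow> m \<le> N \<longrightarrow> Q m N \<le> c * exp (b * real N)"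
    and Q_lower: "\<forall>u v b. 0 < u \<longrightarrow> u < v \<longrightarrow> v < 1 \<longrightarrow> b > 0 \<longrightarrow>
        (\<exists>c>0. \<forall>m N. 1 \<le> m \<longrightarrow> m \<le> N \<longrightarrow> real m / real N \<in> {u..v} \<longrightarrow>
            Q m N \<ge> c * exp (- b * real N))"
    and h_ne_hc: "ereal h \<noteq> - Hder0 H"
  shows "conv_in_prob (\<lambda>N. Ppin K Q H N h)
           (\<lambda>N A. real (card (A \<inter> {0<..<N})) / real N) (deriv (free_energy K Q H) h)
       \<and> (rho_c K > 0 \<and> ereal h \<noteq> h_b K H \<longrightarrow>
            conv_in_prob (\<lambda>N. Ppin K Q H N h) (\<lambda>N A. real (eta1 A) / real N)
              (max 0 (1 - deriv (free_energy K Q H) h / rho_c K))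
          \<and> conv_in_prob (\<lambda>N. Ppin K Q H N h) (\<lambda>N A. real (eta2 A) / real N) 0)
       \<and> (rho_c K = 0 \<and> ereal h > - Hder0 H \<longrightarrow>
            conv_in_prob (\<lambda>N. Ppin K Q H N h) (\<lambda>N A. real (eta1 A) / real N) 0)"
proof -
  interpret pinning_model K \<alpha> C_K Q H
    by unfold_locales (use assms in auto)
  obtain \<rho> where \<rho>: "\<rho> \<in> {0..1}"
    and sep: "\<And>\<epsilon>. \<epsilon> > 0 \<Longrightarrow> \<exists>c>0. \<forall>x\<in>{0<..<1}. \<bar>x - \<rho>\<bar> \<ge> \<epsilon> \<longrightarrow> h * x + entropy x \<le> F h - c"
    using exists_density[OF h_ne_hc] by blast
  have dF: "deriv (free_energy K Q H) h = \<rho>" by (rule deriv_free_energy[OF \<rho> sep])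
  have part1: "conv_in_prob (\<lambda>N. Ppin K Q H N h) (\<lambda>N A. real (card (A \<inter> {0<..<N})) / real N) \<rho>"
    by (rule conv_contact_fraction[OF \<rho> sep])
  have part2: "conv_in_prob (\<lambda>N. Ppin K Q H N h) (\<lambda>N A. real (eta1 A) / real N) (max 0 (1 - \<rho> / rho_c K))
      \<and> conv_in_prob (\<lambda>N. Ppin K Q H N h) (\<lambda>N A. real (eta2 A) / real N) 0" if rc: "rho_c K > 0"
  proof -
    have sm: "summable (\<lambda>n. real n * K n)" using rc by (auto simp: rho_c_def split: if_splits)
    define \<mu> where "\<mu> = (\<Sum>n. real n * K n)"
    have mean: "(\<lambda>n. real n * K n) sums \<mu>" using sm by (simp add: \<mu>_def summable_sums)
    have mu: "\<mu> \<ge> 1" by (rule mean_ge_1[OF mean])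
    have quot: "\<rho> / rho_c K = \<rho> * \<mu>" using sm by (simp add: rho_c_def \<mu>_def)
    show ?thesis
    proof (cases "\<rho> * \<mu> < 1")
      case True
      thus ?thesis using conv_eta_one_jump[OF \<rho> sep mean True] by (simp add: quot max_def)
    next
      case False
      have "\<rho> > 0" using False \<rho> mu by (cases "\<rho> = 0") auto
      moreover have "\<rho> * \<mu>' \<ge> 1" if "(\<lambda>n. real n * K n) sums \<mu>'" for \<mu>'
        using sums_unique2[OF mean that] False by simp
      ultimately have "conv_in_prob (\<lambda>N. Ppin K Q H N h) (\<lambda>N A. real (eta1 A) / real N) 0"
        "conv_in_prob (\<lambda>N. Ppin K Q H N h) (\<lambda>N A. real (eta2 A) / real N) 0"
        using conv_eta_no_large_gap[OF \<rho> sep] by blast+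
      thus ?thesis using False by (simp add: quot max_def)
    qed
  qed
  have part3: "conv_in_prob (\<lambda>N. Ppin K Q H N h) (\<lambda>N A. real (eta1 A) / real N) 0"
    if rc: "rho_c K = 0" and hc: "ereal h > - Hder0 H"
  proof -
    have no_mean: "\<not> (\<lambda>n. real n * K n) sums \<mu>" for \<mu>
    proof
      assume m: "(\<lambda>n. real n * K n) sums \<mu>"
      have "rho_c K = 1 / \<mu>" using m by (simp add: rho_c_def sums_iff)
      thus False using mean_ge_1[OF m] rc by simp
    qed
    show ?thesis
      by (rule conv_eta_no_large_gap(1)[OF \<rho> sep density_pos[OF hc \<rho> sep]]) (use no_mean in auto)
  qed
  show ?thesis unfolding dF using part1 part2 part3 by blast
qed

end
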